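(* Let $L,T,K>0$ and $\gamma>1/2$. Let $k\in C[0,T]$ with $k(0)\neq 0$, let $u_0\in \check H^{\gamma+2}(0,L)$ with $u_0\not\equiv 0$, and let $\alpha,\hat\alpha\in\mathcal A$. Let $u$ be the solution to $$u_t+k(t)\,{}_0^CD_t^{\alpha(t)}u-K\,u_{xx}=0,\quad (x,t)\in[0,L]\times(0,T];$$ $$u(x,0)=u_0(x),\ x\in[0,L];\qquad u(0,t)=u(L,t)=0,\ t\in[0,T],$$ and let $\hat u$ be the solution to $$\hat u_t+k(t)\,{}_0^CD_t^{\hat\alpha(t)}\hat u-K\,\hat u_{xx}=0,\quad (x,t)\in[0,L]\times(0,T];$$ $$\hat u(x,0)=u_0(x),\ x\in[0,L];\qquad \hat u(0,t)=\hat u(L,t)=0,\ t\in[0,T].$$ If there is a nonempty open interval $(a,b)\subset[0,L]$ such that $$u(x,t)=\hat u(x,t)\quad\text{for all }(x,t)\in(a,b)\times[0,T],$$ then $$\alpha(t)=\hat\alpha(t)\quad\text{for all }t\in[0,T].$$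
   Context: Variable-order Caputo derivative: for a function $\alpha$ with $0\le\alpha(t)<1$ and a function $g$ on $[0,T]$ with continuous derivative, $${}_0^CD_t^{\alpha(t)}g(t):=\frac{1}{\Gamma(1-\alpha(t))}\int_0^t\frac{g'(s)}{(t-s)^{\alpha(t)}}\,ds .$$ For $u(x,t)$ it is applied in $t$, with $g'$ replaced by $\partial_t u$. Admissible set: $\mathcal A$ is the set of functions $\alpha$ that are (real) analytic on $[0,T]$ and satisfy $0\le\alpha(t)\le\alpha_*<1$ for all $t\in[0,T]$, for some constant $\alpha_*$, and such that $\lim_{t\to0^+}(\alpha(t)-\alpha(0))\ln t$ exists. Function spaces: let $\lambda_i=K i^2\pi^2/L^2$ and $\phi_i(x)=\sin(i\pi x/L)$, $i=1,2,\dots$, be the eigenvalues and eigenfunctions of $-K\,\frac{d^2}{dx^2}$ on $[0,L]$ with homogeneous Dirichlet boundary conditions, and let $(\cdot,\cdot)$ be the $L^2(0,L)$ inner product. For $s\ge0$, $$\check H^{s}(0,L):=\Big\{v\in L^2(0,L):\ \sum_{i=1}^\infty\lambda_i^{s}(v,\phi_i)^2<\infty\Big\},$$ which is a subspace of the fractional Sobolev space $H^s(0,L)$. Solutions: for $u_0\in\check H^{\gamma+2}(0,L)$ with $\gamma>1/2$, $k\in C[0,T]$ and $\alpha\in\mathcal A$, the initial-boundary value problem is known to have a unique solution $u\in C^1([0,T];H^\gamma(0,L))$; "the solution" refers to this one (and likewise for $\hat u$ with $\hat\alpha$). *)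

theory Defs
  imports "HOL-Analysis.Analysis"
begin

section \<open>Variable-order Caputo derivative and admissible orders\<close>

text \<open>Integrating over the open interval keeps the two-sided \<^const>\<open>deriv\<close> away from the end points
  of \<open>[0,T]\<close>, where it would see the irrelevant values of \<open>g\<close> outside \<open>[0,T]\<close>.\<close>

definition caputo :: "(real \<Rightarrow> real) \<Rightarrow> (real \<Rightarrow> real) \<Rightarrow> real \<Rightarrow> real" where
  "caputo \<alpha> g t =
     1 / Gamma (1 - \<alpha> t) * (LBINT s:{0<..<t}. deriv g s / (t - s) powr \<alpha> t)"

text \<open>For a nondegenerate compact interval, a one-sided expansion at an end point converges on both
  sides of it, so this is analyticity in a neighbourhood of the interval.\<close>

definition real_analytic_on :: "(real \<Rightarrow> real) \<Rightarrow> real set \<Rightarrow> bool" where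
  "real_analytic_on f S \<longleftrightarrow>
     (\<forall>x0\<in>S. \<exists>r>0. \<exists>c. \<forall>x\<in>S. \<bar>x - x0\<bar> < r \<longrightarrow> (\<lambda>n. c n * (x - x0) ^ n) sums f x)"

definition admissible :: "real \<Rightarrow> (real \<Rightarrow> real) set" where
  "admissible T = {\<alpha>.
     real_analytic_on \<alpha> {0..T} \<and>
     (\<exists>\<alpha>s<1. \<forall>t\<in>{0..T}. 0 \<le> \<alpha> t \<and> \<alpha> t \<le> \<alpha>s) \<and>
     (\<exists>l. ((\<lambda>t. (\<alpha> t - \<alpha> 0) * ln t) \<longlongrightarrow> l) (at_right 0))}"


section \<open>Function spaces on \<open>(0,L)\<close>\<close>

text \<open>Elements are functions rather than classes modulo null sets; membership in the spaces
  below and the norms are invariant under changing a function on a null subset of \<open>(0,L)\<close>.\<close>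

definition L2_space :: "real \<Rightarrow> (real \<Rightarrow> real) set" where
  "L2_space L = {v. v \<in> borel_measurable (lebesgue_on {0<..<L}) \<and>
                    integrable (lebesgue_on {0<..<L}) (\<lambda>x. (v x)\<^sup>2)}"

definition L2_inner :: "real \<Rightarrow> (real \<Rightarrow> real) \<Rightarrow> (real \<Rightarrow> real) \<Rightarrow> real" where
  "L2_inner L v w = (\<integral>x. v x * w x \<partial>lebesgue_on {0<..<L})"

definition eigval :: "real \<Rightarrow> real \<Rightarrow> nat \<Rightarrow> real" where
  "eigval K L i = K * (real i)\<^sup>2 * pi\<^sup>2 / L\<^sup>2"

definition eigfun :: "real \<Rightarrow> nat \<Rightarrow> real \<Rightarrow> real" where
  "eigfun L i x = sin (real i * pi * x / L)"

definition H_check :: "real \<Rightarrow> real \<Rightarrow> real \<Rightarrow> (real \<Rightarrow> real) set" where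
  "H_check K L s = {v \<in> L2_space L.
     summable (\<lambda>i. eigval K L (Suc i) powr s * (L2_inner L v (eigfun L (Suc i)))\<^sup>2)}"

definition test_fun :: "real \<Rightarrow> (real \<Rightarrow> real) \<Rightarrow> bool" where
  "test_fun L \<psi> \<longleftrightarrow>
     (\<forall>n. (deriv ^^ n) \<psi> differentiable_on UNIV) \<and>
     (\<exists>c d. 0 < c \<and> d < L \<and> (\<forall>x. x \<notin> {c..d} \<longrightarrow> \<psi> x = 0))"

definition has_weak_deriv :: "real \<Rightarrow> nat \<Rightarrow> (real \<Rightarrow> real) \<Rightarrow> (real \<Rightarrow> real) \<Rightarrow> bool" where
  "has_weak_deriv L j v w \<longleftrightarrow>
     (\<forall>\<psi>. test_fun L \<psi> \<longrightarrow> L2_inner L v ((deriv ^^ j) \<psi>) = (-1) ^ j * L2_inner L w \<psi>)"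

text \<open>Weak derivatives are unique up to null sets, so the choice does not affect the norms below.\<close>

definition weak_deriv :: "real \<Rightarrow> nat \<Rightarrow> (real \<Rightarrow> real) \<Rightarrow> real \<Rightarrow> real" where
  "weak_deriv L j v = (SOME w. w \<in> L2_space L \<and> has_weak_deriv L j v w)"

definition gagliardo :: "real \<Rightarrow> real \<Rightarrow> (real \<Rightarrow> real) \<Rightarrow> ennreal" where
  "gagliardo L \<sigma> w =
     (\<integral>\<^sup>+x. (\<integral>\<^sup>+y. ennreal ((w x - w y)\<^sup>2 / \<bar>x - y\<bar> powr (1 + 2 * \<sigma>))
        \<partial>lebesgue_on {0<..<L}) \<partial>lebesgue_on {0<..<L})"

text \<open>The Sobolev--Slobodeckij space \<open>H\<^sup>s(0,L)\<close>, \<open>s \<ge> 0\<close>. For integer \<open>s\<close> there is no seminorm term: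
  \<^const>\<open>gagliardo\<close> at \<open>\<sigma> = 0\<close> is not controlled by the \<open>L\<^sup>2\<close> norm.\<close>

definition sobolev :: "real \<Rightarrow> real \<Rightarrow> (real \<Rightarrow> real) set" where
  "sobolev L s = {v \<in> L2_space L.
     (\<forall>j\<le>nat \<lfloor>s\<rfloor>. \<exists>w\<in>L2_space L. has_weak_deriv L j v w) \<and>
     (s \<notin> \<int> \<longrightarrow> gagliardo L (frac s) (weak_deriv L (nat \<lfloor>s\<rfloor>) v) < \<infinity>)}"

definition sobolev_norm :: "real \<Rightarrow> real \<Rightarrow> (real \<Rightarrow> real) \<Rightarrow> real" where
  "sobolev_norm L s v = sqrt (
     (\<Sum>j\<le>nat \<lfloor>s\<rfloor>. L2_inner L (weak_deriv L j v) (weak_deriv L j v)) +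
     (if s \<in> \<int> then 0 else enn2real (gagliardo L (frac s) (weak_deriv L (nat \<lfloor>s\<rfloor>) v))))"

text \<open>The space \<open>C\<^sup>1([0,T]; H\<^sup>s(0,L))\<close>; here the first argument of \<open>f\<close> is time.\<close>

definition C1_sobolev :: "real \<Rightarrow> real \<Rightarrow> real \<Rightarrow> (real \<Rightarrow> real \<Rightarrow> real) \<Rightarrow> bool" where
  "C1_sobolev T L s f \<longleftrightarrow> (\<exists>f'.
     (\<forall>t\<in>{0..T}. f t \<in> sobolev L s \<and> f' t \<in> sobolev L s \<and>
        ((\<lambda>r. sobolev_norm L s (\<lambda>x. (f r x - f t x) / (r - t) - f' t x)) \<longlongrightarrow> 0)
          (at t within {0..T}) \<and>
        ((\<lambda>r. sobolev_norm L s (\<lambda>x. f' r x - f' t x)) \<longlongrightarrow> 0) (at t within {0..T})))"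


section \<open>The initial-boundary value problem\<close>

text \<open>Since \<open>\<gamma> > 1/2\<close>, the embedding of \<open>H\<^sup>\<gamma>(0,L)\<close> into \<open>C[0,L]\<close> gives every
  \<open>u \<in> C\<^sup>1([0,T]; H\<^sup>\<gamma>(0,L))\<close> a continuous representative, which is \<open>C\<^sup>1\<close> in time at every \<open>x\<close>.
  Continuity of \<open>u(\<cdot>,t)\<close> and \<open>u(x,\<cdot>) \<in> C\<^sup>1[0,T]\<close> below select this representative; the equation
  is then read pointwise, the derivatives being one-sided at the end points of \<open>[0,L]\<close> and \<open>[0,T]\<close>.\<close>

definition is_solution ::
  "real \<Rightarrow> real \<Rightarrow> real \<Rightarrow> real \<Rightarrow> (real \<Rightarrow> real) \<Rightarrow> (real \<Rightarrow> real) \<Rightarrow> (real \<Rightarrow> real) \<Rightarrow>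
   (real \<Rightarrow> real \<Rightarrow> real) \<Rightarrow> bool" where
  "is_solution L T K \<gamma> k \<alpha> u0 u \<longleftrightarrow>
     C1_sobolev T L \<gamma> (\<lambda>t x. u x t) \<and>
     (\<forall>t\<in>{0..T}. continuous_on {0..L} (\<lambda>x. u x t)) \<and>
     (\<exists>ut ux uxx.
        (\<forall>x\<in>{0..L}. continuous_on {0..T} (ut x) \<and>
           (\<forall>t\<in>{0..T}. (u x has_real_derivative ut x t) (at t within {0..T}))) \<and>
        (\<forall>t\<in>{0<..T}. \<forall>x\<in>{0..L}.
           ((\<lambda>y. u y t) has_real_derivative ux x t) (at x within {0..L}) \<and>
           ((\<lambda>y. ux y t) has_real_derivative uxx x t) (at x within {0..L}) \<and>
           ut x t + k t * caputo \<alpha> (u x) t - K * uxx x t = 0)) \<and>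
     (\<forall>x\<in>{0..L}. u x 0 = u0 x) \<and>
     (\<forall>t\<in>{0..T}. u 0 t = 0 \<and> u L t = 0)"

end

theory Submission
  imports Defs "HOL-Complex_Analysis.Cauchy_Integral_Formula"
begin

text \<open>Suppose the two orders differ somewhere. By analyticity they differ at every small \<open>t > 0\<close>. On \<open>(a,b)\<close>
  the equations give \<open>D\<^sup>\<alpha> u = D\<^sup>\<alpha>\<^sup>' u\<close> for small \<open>t\<close>, and since \<open>r\<^sup>-\<^sup>\<beta> / \<Gamma>(1 - \<beta>)\<close> is increasing in \<open>\<beta>\<close> for
  small \<open>r\<close>, an extremum principle for the difference of the two Caputo derivatives forces \<open>u(x,\<cdot>)\<close> to be
  constant near \<open>t = 0\<close> for every \<open>x\<close> in \<open>(a,b)\<close>.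

  It remains to see that such a stationary \<open>u\<close> vanishes at time \<open>0\<close>. Subtracting an affine function \<open>p\<close> of \<open>x\<close>, \<open>v = u - p\<close> has zero
  Cauchy data at some \<open>c\<close> in \<open>(a,b)\<close>. Integrating \<open>v\<close> against \<open>sinh (\<mu> (L - x))\<close> over \<open>[c,L]\<close> gives a scalar
  function \<open>W\<close> with \<open>W' = K \<mu>\<^sup>2 W + O(\<mu>) + memory\<close>. As \<open>W\<close> is \<open>O(e\<^sup>\<mu>\<^sup>L)\<close> but would grow like \<open>exp (K \<mu>\<^sup>2 t / 2)\<close>, \<open>W(0)\<close>
  must stay bounded as \<open>\<mu> \<rightarrow> \<infinity>\<close>, and then \<open>v(\<cdot>,0) = 0\<close> on \<open>[c,L]\<close> by Mikusinski's lemma on bounded exponential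
  moments. The interval \<open>[0,c]\<close> is symmetric, so \<open>u\<^sub>0 = p\<close>, and the boundary values give \<open>u\<^sub>0 = 0\<close>.\<close>

section \<open>Zeros of real analytic functions\<close>

text \<open>Regularity shapes the second half. The equation holds pointwise, \<open>uxx\<close>
  comes with no integrability in x, and \<open>ut\<close> is continuous in t for each x separately.
  The Sobolev regularity enters through one consequence: t -> \<open>ut\<close>(.,t) is continuous
  into L1(0,L). This permits Fubini between weights in x and kernels in t, and the equation itself
  then makes the weighted \<open>uxx\<close> integrable. The cut is made at c because both Cauchy
  data are known there, while at 0 and L only the value is known; a sinh weight vanishing at the
  outer end removes the unknown slope there and leaves a boundary term of size O(mu). Stationarity
  is known only on a short time interval, but a short interval is what the growth argument wants:
  the Abel kernel on [0,t] has mass t^(1-alpha) / (1-alpha), so for small t the memory term is a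
  small multiple of sup |W'|, whatever the sign of k.\<close>

lemma real_analytic_on_diff:
  assumes "real_analytic_on f S" "real_analytic_on g S"
  shows "real_analytic_on (\<lambda>x. f x - g x) S"
  unfolding real_analytic_on_def
proof
  fix x0 assume x0: "x0 \<in> S"
  obtain r c where r: "r > 0" "\<And>x. x \<in> S \<Longrightarrow> \<bar>x - x0\<bar> < r \<Longrightarrow> (\<lambda>n. c n * (x - x0) ^ n) sums f x"
    using assms(1) x0 unfolding real_analytic_on_def by blast
  obtain r' c' where r': "r' > 0" "\<And>x. x \<in> S \<Longrightarrow> \<bar>x - x0\<bar> < r' \<Longrightarrow> (\<lambda>n. c' n * (x - x0) ^ n) sums g x"
    using assms(2) x0 unfolding real_analytic_on_def by blast
  have "(\<lambda>n. (c n - c' n) * (x - x0) ^ n) sums (f x - g x)"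
    if "x \<in> S" "\<bar>x - x0\<bar> < min r r'" for x
    using sums_diff[OF r(2) r'(2), of x x] that by (simp add: left_diff_distrib)
  then show "\<exists>r>0. \<exists>c. \<forall>x\<in>S. \<bar>x - x0\<bar> < r \<longrightarrow> (\<lambda>n. c n * (x - x0) ^ n) sums (f x - g x)"
    using r(1) r'(1) by (intro exI[of _ "min r r'"] conjI exI[of _ "\<lambda>n. c n - c' n"]) auto
qed

text \<open>A power series with some nonzero coefficient has isolated zeros; if all coefficients
  vanish, so does f near x0.\<close>

lemma real_analytic_on_isolated_zeros:
  fixes T :: real
  assumes "real_analytic_on f {0..T}" "0 < T" "x0 \<in> {0..T}"
  obtains r where "r > 0" "(\<forall>x\<in>{0..T}. \<bar>x - x0\<bar> < r \<longrightarrow> f x = 0) \<or>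
    (\<forall>x\<in>{0..T}. \<bar>x - x0\<bar> < r \<longrightarrow> x \<noteq> x0 \<longrightarrow> f x \<noteq> 0)"
proof -
  obtain r c where r: "r > 0" "\<And>x. x \<in> {0..T} \<Longrightarrow> \<bar>x - x0\<bar> < r \<Longrightarrow> (\<lambda>n. c n * (x - x0) ^ n) sums f x"
    using assms(1,3) unfolding real_analytic_on_def by blast
  show thesis
  proof (cases "\<forall>n. c n = 0")
    case True
    have "f x = 0" if "x \<in> {0..T}" "\<bar>x - x0\<bar> < r" for x
      using r(2)[OF that] True sums_unique2[OF _ sums_zero] by simp
    then show thesis using that r(1) by blast
  next
    case False
    then obtain m where m: "c m \<noteq> 0" by blast
    \<comment> \<open>The expansion is known to converge only at points of {0..T}, on one side of x0
      if x0 is an end point. Convergence at a single x1 already gives two-sided convergence within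
      radius |x1 - x0|.\<close>
    obtain x1 where x1: "x1 \<in> {0..T}" "x1 \<noteq> x0" "\<bar>x1 - x0\<bar> < r"
    proof (cases "x0 < T")
      case True
      then show thesis using that[of "min T (x0 + r/2)"] assms(3) r(1) by (auto simp: min_def)
    next
      case False
      then show thesis using that[of "max 0 (x0 - r/2)"] assms(2,3) r(1) by (auto simp: max_def)
    qed
    define r1 where "r1 = \<bar>x1 - x0\<bar>"
    have r1: "r1 > 0" "r1 < r" using x1 by (auto simp: r1_def)
    \<comment> \<open>\<open>powser_0_nonzero\<close> wants a function vanishing at the centre and a
      nonzero coefficient of positive order. The factor x - x0 provides both, whether or not f x0 =
      0, and creates no zeros away from x0.\<close>
    define F where "F = (\<lambda>x. (x - x0) * (\<Sum>n. c n * (x - x0) ^ n))"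
    define a where "a = (\<lambda>n. case n of 0 \<Rightarrow> 0 | Suc k \<Rightarrow> c k)"
    have S: "(\<lambda>n. a n * (x - x0) ^ n) sums F x" if x: "norm (x - x0) < r1" for x
    proof -
      have "summable (\<lambda>n. c n * (x - x0) ^ n)"
        using powser_inside[of c "x1 - x0" "x - x0"] r(2)[OF x1(1,3)] x
        by (auto simp: r1_def sums_iff)
      then have "(\<lambda>n. (x - x0) * (c n * (x - x0) ^ n)) sums F x"
        unfolding F_def by (intro sums_mult summable_sums)
      then have "(\<lambda>n. a (Suc n) * (x - x0) ^ Suc n) sums F x"
        by (simp add: a_def algebra_simps)
      from sums_Suc[OF this] show ?thesis by (simp add: a_def)
    qed
    obtain s where s: "0 < s" "\<And>z. z \<in> cball x0 s - {x0} \<Longrightarrow> F z \<noteq> 0"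
      by (rule powser_0_nonzero[OF r1(1) S, of "Suc m"]) (auto simp: F_def a_def m)
    have "f x \<noteq> 0" if x: "x \<in> {0..T}" "\<bar>x - x0\<bar> < min s r1" "x \<noteq> x0" for x
    proof -
      have "f x = (\<Sum>n. c n * (x - x0) ^ n)"
        using r(2)[OF x(1)] x(2) r1 by (simp add: sums_iff)
      moreover have "F x \<noteq> 0" using s(2)[of x] x by (auto simp: dist_real_def abs_minus_commute)
      ultimately show ?thesis by (auto simp: F_def)
    qed
    then show thesis using that[of "min s r1"] s r1 by auto
  qed
qed

text \<open>Identity theorem by connectedness: the set of points near which f vanishes is open and
  closed in {0..T}. As f is not identically 0, this set is empty, and the dichotomy at 0 leaves only
  an isolated zero.\<close>

lemma real_analytic_on_zero_or_eventually_nonzero: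
  fixes T :: real
  assumes f: "real_analytic_on f {0..T}" and T: "0 < T" and ne: "\<exists>t\<in>{0..T}. f t \<noteq> 0"
  obtains \<epsilon> where "\<epsilon> > 0" "\<epsilon> \<le> T" "\<And>t. 0 < t \<Longrightarrow> t < \<epsilon> \<Longrightarrow> f t \<noteq> 0"
proof -
  define A where "A = {t\<in>{0..T}. \<exists>r>0. \<forall>x\<in>{0..T}. \<bar>x - t\<bar> < r \<longrightarrow> f x = 0}"
  have A: "openin (top_of_set {0..T}) A"
    unfolding openin_euclidean_subtopology_iff
  proof (intro conjI ballI)
    fix t assume "t \<in> A"
    then obtain r where r: "r > 0" "\<And>x. x \<in> {0..T} \<Longrightarrow> \<bar>x - t\<bar> < r \<Longrightarrow> f x = 0" "t \<in> {0..T}"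
      unfolding A_def by blast
    have "y \<in> A" if y: "y \<in> {0..T}" "dist y t < r/2" for y
    proof -
      have "f x = 0" if "x \<in> {0..T}" "\<bar>x - y\<bar> < r/2" for x
      proof (rule r(2)[OF that(1)])
        show "\<bar>x - t\<bar> < r" using that(2) y(2) unfolding dist_real_def by arith
      qed
      then show ?thesis unfolding A_def using y r(1) by (auto intro!: exI[of _ "r/2"])
    qed
    then show "\<exists>e>0. \<forall>x'\<in>{0..T}. dist x' t < e \<longrightarrow> x' \<in> A"
      using r(1) by (intro exI[of _ "r/2"]) auto
  qed (auto simp: A_def)
  \<comment> \<open>Off A the dichotomy gives a punctured neighbourhood without zeros, and no point
    of it can lie in A.\<close>
  have B: "openin (top_of_set {0..T}) ({0..T} - A)"
    unfolding openin_euclidean_subtopology_iff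
  proof (intro conjI ballI)
    fix t assume t: "t \<in> {0..T} - A"
    obtain r where r: "r > 0" "(\<forall>x\<in>{0..T}. \<bar>x - t\<bar> < r \<longrightarrow> f x = 0) \<or>
      (\<forall>x\<in>{0..T}. \<bar>x - t\<bar> < r \<longrightarrow> x \<noteq> t \<longrightarrow> f x \<noteq> 0)"
      using real_analytic_on_isolated_zeros[OF f T, of t] t by blast
    have r2: "\<forall>x\<in>{0..T}. \<bar>x - t\<bar> < r \<longrightarrow> x \<noteq> t \<longrightarrow> f x \<noteq> 0"
      using r t unfolding A_def by blast
    have "y \<notin> A" if y: "y \<in> {0..T}" "dist y t < r" for y
    proof (cases "y = t")
      case False
      then have "f y \<noteq> 0" using r2 y by (auto simp: dist_real_def)
      then show ?thesis using y unfolding A_def by force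
    qed (use t in auto)
    then show "\<exists>e>0. \<forall>x'\<in>{0..T}. dist x' t < e \<longrightarrow> x' \<in> {0..T} - A"
      using r(1) by blast
  qed auto
  have "connected {0..T}" by simp
  moreover have "closedin (top_of_set {0..T}) A"
    using B by (simp add: closedin_def) (auto simp: A_def) 
  ultimately have "A = {} \<or> A = {0..T}" using A connected_clopen by blast
  moreover have "A \<noteq> {0..T}" using ne unfolding A_def by force
  ultimately have "0 \<notin> A" by blast
  moreover obtain r where "r > 0" "(\<forall>x\<in>{0..T}. \<bar>x - 0\<bar> < r \<longrightarrow> f x = 0) \<or>
      (\<forall>x\<in>{0..T}. \<bar>x - 0\<bar> < r \<longrightarrow> x \<noteq> 0 \<longrightarrow> f x \<noteq> 0)"
    using real_analytic_on_isolated_zeros[OF f T, of 0] T by auto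
  ultimately have "\<forall>x\<in>{0..T}. \<bar>x - 0\<bar> < r \<longrightarrow> x \<noteq> 0 \<longrightarrow> f x \<noteq> 0"
    using T unfolding A_def by auto
  then show thesis using that[of "min r T"] \<open>r > 0\<close> T by auto
qed

section \<open>The extremum principle\<close>

text \<open>The convolution kernel of the Caputo derivative: \<open>caputo \<alpha> g t\<close>
  integrates \<open>frac_kernel (\<alpha> t) (t - s)\<close> against g'(s) over [0,t].\<close>

definition frac_kernel :: "real \<Rightarrow> real \<Rightarrow> real" where
  "frac_kernel \<beta> r = r powr (- \<beta>) / Gamma (1 - \<beta>)"

text \<open>The logarithm of the kernel has \<beta>-derivative - ln r + Digamma (1 - \<beta>).
  Digamma is increasing on the positive axis, so this is smallest at \<beta> = b, and the threshold
  for r is where that smallest value is 0. It depends on b alone, hence serves all orders up to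
  b.\<close>

lemma frac_kernel_strict_mono:
  assumes "0 \<le> \<beta>" "\<beta> < \<beta>'" "\<beta>' \<le> b" "b < 1" "0 < r" "r < exp (Digamma (1 - b))"
  shows "frac_kernel \<beta> r < frac_kernel \<beta>' r"
proof -
  define \<phi> where "\<phi> = (\<lambda>\<beta>. - \<beta> * ln r - ln_Gamma (1 - \<beta>))"
  have eq: "frac_kernel x r = exp (\<phi> x)" if "x < 1" for x
    using that assms unfolding frac_kernel_def \<phi>_def
    by (simp add: powr_def Gamma_real_pos_exp exp_diff exp_minus)
  have ln: "ln r < Digamma (1 - b)" using assms by (metis exp_less_cancel_iff exp_ln)
  have "\<phi> \<beta> < \<phi> \<beta>'"
  proof (rule DERIV_pos_imp_increasing[OF assms(2)])
    fix x assume x: "\<beta> \<le> x" "x \<le> \<beta>'"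
    have "(\<phi> has_real_derivative (- ln r + Digamma (1 - x))) (at x)"
      unfolding \<phi>_def using x assms by (auto intro!: derivative_eq_intros)
    moreover have "Digamma (1 - b) \<le> Digamma (1 - x)"
      using x assms by (intro Digamma_real_mono) auto
    ultimately show "\<exists>y. DERIV \<phi> x :> y \<and> 0 < y" using ln by fastforce
  qed
  then show ?thesis using eq assms by simp
qed

lemma frac_kernel_nonneg: "\<beta> < 1 \<Longrightarrow> 0 \<le> frac_kernel \<beta> r"
  unfolding frac_kernel_def by (auto intro!: divide_nonneg_pos)

lemma frac_kernel_has_derivative:
  assumes "r > 0"
  shows "(frac_kernel \<beta> has_real_derivative - \<beta> * frac_kernel \<beta> r / r) (at r)"
proof (cases "Gamma (1 - \<beta>) = 0")
  case False
  then show ?thesis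
    using assms unfolding frac_kernel_def [abs_def]
    by (auto intro!: derivative_eq_intros simp: powr_diff powr_minus field_simps)
\<comment> \<open>\<open>Gamma\<close> has the default value 0 at its poles, and division by 0 makes
  the kernel identically 0 there.\<close>
qed (simp add: frac_kernel_def [abs_def])

text \<open>The difference \<open>w\<close> of the two kernels is positive and decreasing for small arguments, so
  \<open>w (t - s) * (G t - G s) + integral {0..s} (\<lambda>\<sigma>. w (t - \<sigma>) * g \<sigma>)\<close> is nondecreasing in \<open>s\<close>;
  it equals \<open>w t * (G t - G 0)\<close> at \<open>s = 0\<close> and tends to \<open>0\<close> as \<open>s\<close> tends to \<open>t\<close>.\<close>

lemma frac_kernel_extremum:
  fixes G g :: "real \<Rightarrow> real"
  assumes \<beta>: "0 \<le> \<beta>" "\<beta> < \<beta>'" "\<beta>' \<le> b" "b < 1" and t: "0 < t" "t < exp (Digamma (1 - b))"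
    and G: "\<And>s. s \<in> {0..t} \<Longrightarrow> (G has_real_derivative g s) (at s within {0..t})"
    and g: "continuous_on {0..t} g"
    and max: "\<And>s. s \<in> {0..t} \<Longrightarrow> G s \<le> G t"
    and int: "((\<lambda>s. (frac_kernel \<beta>' (t - s) - frac_kernel \<beta> (t - s)) * g s) has_integral 0) {0..t}"
  shows "G t \<le> G 0"
proof -
  define w where "w = (\<lambda>r. frac_kernel \<beta>' r - frac_kernel \<beta> r)"
  define w' where "w' = (\<lambda>r. - \<beta>' * frac_kernel \<beta>' r / r + \<beta> * frac_kernel \<beta> r / r)"
  have w_pos: "w r > 0" if "0 < r" "r \<le> t" for r
    using frac_kernel_strict_mono[OF \<beta>, of r] that t by (simp add: w_def)
  have w'_neg: "w' r \<le> 0" if "0 < r" "r \<le> t" for r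
  proof -
    have "\<beta> * frac_kernel \<beta> r \<le> \<beta>' * frac_kernel \<beta>' r"
      using w_pos[OF that] \<beta> by (intro mult_mono frac_kernel_nonneg) (auto simp: w_def)
    then show ?thesis using that by (simp add: w'_def field_simps)
  qed
  have dw: "(w has_real_derivative w' r) (at r)" if "0 < r" for r
    unfolding w_def w'_def using that
    by (auto intro!: derivative_eq_intros frac_kernel_has_derivative)
  have [continuous_intros]: "continuous_on S (\<lambda>s. w (t - s))" if "\<And>s. s \<in> S \<Longrightarrow> s < t" for S
  proof (rule continuous_on_compose2[of "{0<..}" w])
    show "continuous_on {0<..} w"
      by (meson DERIV_isCont continuous_at_imp_continuous_on dw greaterThan_iff)
  qed (use that in \<open>auto intro!: continuous_intros\<close>)
  define \<Phi> where "\<Phi> = (\<lambda>s. w (t - s) * (G t - G s) + integral {0..s} (\<lambda>\<sigma>. w (t - \<sigma>) * g \<sigma>))"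
  have mono: "\<Phi> 0 \<le> \<Phi> s" if s: "0 < s" "s < t" for s
  proof (rule DERIV_nonneg_imp_increasing_open[OF less_imp_le[OF s(1)]])
    have c: "continuous_on {0..s} (\<lambda>\<sigma>. w (t - \<sigma>) * g \<sigma>)"
      using s by (intro continuous_intros continuous_on_subset[OF g]) auto
    have cG: "continuous_on {0..s} G"
      using s by (intro continuous_on_subset[OF DERIV_continuous_on[OF G]]) auto
    show "continuous_on {0..s} \<Phi>"
      unfolding \<Phi>_def using s
      by (intro continuous_intros cG indefinite_integral_continuous_1 integrable_continuous_real c) auto
    fix x assume x: "0 < x" "x < s"
    have 1: "((\<lambda>s. integral {0..s} (\<lambda>\<sigma>. w (t - \<sigma>) * g \<sigma>)) has_real_derivative w (t - x) * g x) (at x)"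
      using integral_has_real_derivative[OF c, of x] x at_within_Icc_at[of 0 x s] by simp
    have 2: "((\<lambda>s. w (t - s)) has_real_derivative w' (t - x) * (0 - 1)) (at x)"
      using x s by (intro DERIV_chain2[OF dw] derivative_intros) auto
    have 3: "(G has_real_derivative g x) (at x)"
      using G[of x] x s at_within_Icc_at[of 0 x t] by simp
    \<comment> \<open>The product rule produces - w (t - x) * g x, which the derivative of the
      integral cancels; only the term with w' survives, and it has a sign because t is a maximum
      point.\<close>
    have "(\<Phi> has_real_derivative - w' (t - x) * (G t - G x)) (at x)"
      unfolding \<Phi>_def by (rule derivative_eq_intros 1 2 3 refl)+ (simp add: algebra_simps)
    moreover have "0 \<le> - w' (t - x) * (G t - G x)"
      using w'_neg[of "t - x"] max[of x] x s by (intro mult_nonneg_nonneg) auto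
    ultimately show "\<exists>y. DERIV \<Phi> x :> y \<and> 0 \<le> y" by blast
  qed
  have "\<exists>M. \<forall>s\<in>{0..t}. \<bar>g s\<bar> \<le> M"
    using compact_imp_bounded[OF compact_continuous_image[OF g]]
    by (auto simp: bounded_iff)
  then obtain M where M: "\<And>s. s \<in> {0..t} \<Longrightarrow> \<bar>g s\<bar> \<le> M" by blast
  have lip: "G t - G s \<le> M * (t - s)" if "s \<in> {0..t}" for s
  proof -
    have "norm (G t - G s) \<le> M * norm (t - s)"
      by (rule field_differentiable_bound[where S="{0..t}" and f'=g])
        (use G M that t in auto)
    then show ?thesis using that by auto
  qed
  \<comment> \<open>The kernel blows up like (t - s) powr (- \<beta>'), but G is Lipschitz, so the
    product is O((t - s) powr (1 - \<beta>')).\<close>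
  have lim1: "((\<lambda>s. w (t - s) * (G t - G s)) \<longlongrightarrow> 0) (at_left t)"
  proof (rule tendsto_sandwich[of "\<lambda>_. 0" _ _ "\<lambda>s. M / Gamma (1 - \<beta>') * (t - s) powr (1 - \<beta>')"])
    have ev: "\<forall>\<^sub>F s in at_left t. s \<in> {0<..<t}"
      using t eventually_at_left_field by (auto simp: eventually_at_left_field intro!: exI[of _ 0])
    show "\<forall>\<^sub>F s in at_left t. 0 \<le> w (t - s) * (G t - G s)"
      using ev
    proof eventually_elim
      case (elim s)
      then show ?case using w_pos[of "t - s"] max[of s] by (intro mult_nonneg_nonneg) auto
    qed
    show "\<forall>\<^sub>F s in at_left t. w (t - s) * (G t - G s) \<le> M / Gamma (1 - \<beta>') * (t - s) powr (1 - \<beta>')"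
      using ev
    proof eventually_elim
      case (elim s)
      have "w (t - s) \<le> frac_kernel \<beta>' (t - s)"
        using frac_kernel_nonneg[of \<beta> "t - s"] \<beta> by (simp add: w_def)
      then have "w (t - s) * (G t - G s) \<le> frac_kernel \<beta>' (t - s) * (M * (t - s))"
        using lip[of s] max[of s] elim \<beta> by (intro mult_mono frac_kernel_nonneg) auto
      also have "\<dots> = M / Gamma (1 - \<beta>') * (t - s) powr (1 - \<beta>')"
        using elim by (simp add: frac_kernel_def powr_diff powr_minus field_simps)
      finally show ?case .
    qed
    have "((\<lambda>s. t - s) \<longlongrightarrow> 0) (at_left t)" by (auto intro!: tendsto_eq_intros)
    then have "((\<lambda>s. (t - s) powr (1 - \<beta>')) \<longlongrightarrow> 0) (at_left t)"
      by (rule tendsto_zero_powrI[where b="1 - \<beta>'"])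
        (use \<beta> ev in \<open>auto elim!: eventually_mono\<close>)
    then show "((\<lambda>s. M / Gamma (1 - \<beta>') * (t - s) powr (1 - \<beta>')) \<longlongrightarrow> 0) (at_left t)"
      by (rule tendsto_mult_right_zero)
  qed auto
  \<comment> \<open>The integrand may be singular at \<sigma> = t. An indefinite gauge integral is
    nevertheless continuous up to the end point, which gives the limit s -> t.\<close>
  have "continuous_on {0..t} (\<lambda>s. integral {0..s} (\<lambda>\<sigma>. w (t - \<sigma>) * g \<sigma>))"
    using int unfolding w_def by (intro indefinite_integral_continuous_1) (auto simp: integrable_on_def)
  then have "((\<lambda>s. integral {0..s} (\<lambda>\<sigma>. w (t - \<sigma>) * g \<sigma>)) \<longlongrightarrow> integral {0..t} (\<lambda>\<sigma>. w (t - \<sigma>) * g \<sigma>)) (at t within {0..t})"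
    using t by (auto simp: continuous_on_def)
  then have "((\<lambda>s. integral {0..s} (\<lambda>\<sigma>. w (t - \<sigma>) * g \<sigma>)) \<longlongrightarrow> integral {0..t} (\<lambda>\<sigma>. w (t - \<sigma>) * g \<sigma>)) (at_left t)"
    by (simp add: at_within_Icc_at_left[OF t(1)])
  also have "integral {0..t} (\<lambda>\<sigma>. w (t - \<sigma>) * g \<sigma>) = 0"
    using int unfolding w_def by (rule integral_unique)
  finally have "(\<Phi> \<longlongrightarrow> 0 + 0) (at_left t)"
    unfolding \<Phi>_def by (intro tendsto_add lim1)
  moreover have "\<forall>\<^sub>F s in at_left t. \<Phi> 0 \<le> \<Phi> s"
    unfolding eventually_at_left_field using mono t by (auto intro!: exI[of _ 0])
  ultimately have "\<Phi> 0 \<le> 0 + 0"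
    by (intro tendsto_lowerbound) auto
  then have "w t * (G t - G 0) \<le> 0" by (simp add: \<Phi>_def)
  then show ?thesis using w_pos[of t] t by (simp add: mult_le_0_iff)
qed

section \<open>Exponential growth and exponential moments\<close>

text \<open>In the two lemmas below, \<open>eq\<close> says that \<open>W' = \<nu> W + f + R\<close> where the memory term \<open>R t\<close> is at most a quarter of
  the supremum of \<open>\<bar>W'\<bar>\<close> on \<open>[0,t]\<close>. It is too weak to stop the exponential growth of a solution
  that starts well above \<open>F / \<nu>\<close>.\<close>

lemma volterra_growth_pos:
  fixes W g f :: "real \<Rightarrow> real"
  assumes \<tau>: "0 < \<tau>" and \<nu>: "0 < \<nu>"
    and W: "\<And>t. t \<in> {0..\<tau>} \<Longrightarrow> (W has_real_derivative g t) (at t within {0..\<tau>})"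
    and g: "continuous_on {0..\<tau>} g"
    and F: "\<And>t. t \<in> {0..\<tau>} \<Longrightarrow> \<bar>f t\<bar> \<le> F"
    and eq: "\<And>t M. t \<in> {0..\<tau>} \<Longrightarrow> (\<And>s. s \<in> {0..t} \<Longrightarrow> \<bar>g s\<bar> \<le> M) \<Longrightarrow>
      \<bar>g t - \<nu> * W t - f t\<bar> \<le> M / 4"
    and W0: "0 < W 0" "8 * F \<le> \<nu> * W 0"
  shows "W 0 * exp (\<nu> * \<tau> / 2) \<le> W \<tau>"
proof -
  have F0: "0 \<le> F" using F[of 0] \<tau> by auto
  have mono: "W s \<le> W t" if "0 \<le> s" "s \<le> t" "t \<le> \<tau>" "\<And>r. r \<in> {0..<t} \<Longrightarrow> 0 \<le> g r" for s t
  proof (rule DERIV_nonneg_imp_increasing_open[OF that(2)])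
    show "continuous_on {s..t} W"
      using that by (intro continuous_on_subset[OF DERIV_continuous_on[OF W]]) auto
    fix x assume x: "s < x" "x < t"
    then have "(W has_real_derivative g x) (at x)"
      using W[of x] at_within_Icc_at[of 0 x \<tau>] that by simp
    then show "\<exists>y. DERIV W x :> y \<and> 0 \<le> y" using that(4)[of x] x that(1) by auto
  qed
  \<comment> \<open>Let s maximize |g| on [0,t]. The equation at s gives (3/4) |g s| <= \<nu> W s +
    F, so the memory at t is at most (\<nu> W t + F) / 3, W being nondecreasing. Hence g t >= (2/3)
    \<nu> W t - (4/3) F, and F <= \<nu> W t / 8 turns this into \<nu> W t / 2. This is where the
    constants 1/4 and 8 come from.\<close>
  have key: "\<nu> * W t / 2 \<le> g t" if t: "t \<in> {0..\<tau>}" and nonneg: "\<And>r. r \<in> {0..<t} \<Longrightarrow> 0 \<le> g r" for t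
  proof -
    have "continuous_on {0..t} (\<lambda>s. \<bar>g s\<bar>)"
      using t by (intro continuous_intros continuous_on_subset[OF g]) auto
    then obtain s where s: "s \<in> {0..t}" "\<And>r. r \<in> {0..t} \<Longrightarrow> \<bar>g r\<bar> \<le> \<bar>g s\<bar>"
      using continuous_attains_sup[of "{0..t}" "\<lambda>s. \<bar>g s\<bar>"] t by auto
    have Ws: "0 < W s" "W s \<le> W t" "W 0 \<le> W t"
      using mono[of 0 s] mono[of s t] mono[of 0 t] s t nonneg W0 by auto
    have "\<bar>g s - \<nu> * W s - f s\<bar> \<le> \<bar>g s\<bar> / 4"
      by (rule eq) (use s t in auto)
    moreover have "0 < \<nu> * W s" "\<nu> * W s \<le> \<nu> * W t" "\<nu> * W 0 \<le> \<nu> * W t"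
      using Ws \<nu> by auto
    moreover have "\<bar>f s\<bar> \<le> F" "\<bar>f t\<bar> \<le> F" using F s t by auto
    moreover have "\<bar>g t - \<nu> * W t - f t\<bar> \<le> \<bar>g s\<bar> / 4"
      by (rule eq) (use s t in auto)
    ultimately show ?thesis using W0(2) F0 by linarith
  qed
  \<comment> \<open>At the first point z with g z <= 0 the hypothesis of \<open>key\<close> still
    holds on [0,z), so g z would be positive. The case z = 0 is included, the hypothesis being
    vacuous there.\<close>
  have pos: "0 < g t" if t: "t \<in> {0..\<tau>}" for t
  proof (rule ccontr)
    assume "\<not> 0 < g t"
    define Z where "Z = {r\<in>{0..\<tau>}. g r \<le> 0}"
    have "Z \<noteq> {}" using t \<open>\<not> 0 < g t\<close> by (auto simp: Z_def)
    moreover have "compact Z"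
    proof -
      have "closed Z" unfolding Z_def
        using continuous_on_closed_Collect_le[OF g continuous_on_const] by simp
      moreover have "bounded Z" by (rule bounded_subset[of "{0..\<tau>}"]) (auto simp: Z_def)
      ultimately show ?thesis by (simp add: compact_eq_bounded_closed)
    qed
    ultimately obtain z where z: "z \<in> Z" "\<And>r. r \<in> Z \<Longrightarrow> z \<le> r"
      using compact_attains_inf by metis
    have nn: "0 \<le> g r" if "r \<in> {0..<z}" for r
      using z(2)[of r] z(1) that by (force simp: Z_def)
    have "0 < \<nu> * W z / 2" using mono[of 0 z] z(1) nn W0 \<nu> by (auto simp: Z_def)
    then show False using key[of z] z(1) nn by (auto simp: Z_def)
  qed
  have "W 0 * exp (- (\<nu> / 2) * 0) \<le> W \<tau> * exp (- (\<nu> / 2) * \<tau>)"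
  proof (rule DERIV_nonneg_imp_increasing_open[OF less_imp_le[OF \<tau>]])
    show "continuous_on {0..\<tau>} (\<lambda>t. W t * exp (- (\<nu> / 2) * t))"
      by (intro continuous_intros DERIV_continuous_on[OF W])
    fix x assume x: "0 < x" "x < \<tau>"
    have "(W has_real_derivative g x) (at x)"
      using W[of x] at_within_Icc_at[of 0 x \<tau>] x by simp
    then have "((\<lambda>t. W t * exp (- (\<nu> / 2) * t)) has_real_derivative
        (g x - \<nu> * W x / 2) * exp (- (\<nu> / 2) * x)) (at x)"
      by (auto intro!: derivative_eq_intros simp: algebra_simps)
    moreover have "0 \<le> g x - \<nu> * W x / 2"
      using key[of x] x less_imp_le[OF pos] by simp
    ultimately show "\<exists>y. ((\<lambda>t. W t * exp (- (\<nu> / 2) * t)) has_real_derivative y) (at x) \<and> 0 \<le> y"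
      by auto
  qed
  then show ?thesis by (simp add: exp_minus field_simps)
qed

lemma volterra_growth:
  fixes W g f :: "real \<Rightarrow> real"
  assumes \<tau>: "0 < \<tau>" and \<nu>: "0 < \<nu>"
    and W: "\<And>t. t \<in> {0..\<tau>} \<Longrightarrow> (W has_real_derivative g t) (at t within {0..\<tau>})"
    and g: "continuous_on {0..\<tau>} g"
    and F: "\<And>t. t \<in> {0..\<tau>} \<Longrightarrow> \<bar>f t\<bar> \<le> F"
    and eq: "\<And>t M. t \<in> {0..\<tau>} \<Longrightarrow> (\<And>s. s \<in> {0..t} \<Longrightarrow> \<bar>g s\<bar> \<le> M) \<Longrightarrow>
      \<bar>g t - \<nu> * W t - f t\<bar> \<le> M / 4"
  shows "\<bar>W 0\<bar> \<le> 8 * F / \<nu> + \<bar>W \<tau>\<bar> * exp (- \<nu> * \<tau> / 2)"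
proof -
  have F0: "0 \<le> F" using F[of 0] \<tau> by auto
  have *: "\<bar>W 0\<bar> \<le> \<bar>W \<tau>\<bar> * exp (- \<nu> * \<tau> / 2)" if h: "W 0 \<noteq> 0" "8 * F \<le> \<nu> * \<bar>W 0\<bar>"
  proof (cases "0 < W 0")
    case True
    have "W 0 * exp (\<nu> * \<tau> / 2) \<le> W \<tau>"
      by (rule volterra_growth_pos[OF \<tau> \<nu> W g F eq]) (use True h in auto)
    then have "W 0 * exp (\<nu> * \<tau> / 2) \<le> \<bar>W \<tau>\<bar>" by simp
    then show ?thesis using True by (simp add: exp_minus field_simps)
  next
    case False
    \<comment> \<open>The assumptions are invariant under changing the sign of W, g and f
      together.\<close>
    have "- W 0 * exp (\<nu> * \<tau> / 2) \<le> - W \<tau>"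
    proof (rule volterra_growth_pos[OF \<tau> \<nu>, where g = "\<lambda>t. - g t" and f = "\<lambda>t. - f t" and F = F])
      fix t M assume a: "t \<in> {0..\<tau>}" "\<And>s. s \<in> {0..t} \<Longrightarrow> \<bar>- g s\<bar> \<le> M"
      have "\<bar>g t - \<nu> * W t - f t\<bar> \<le> M / 4" using a by (intro eq) simp_all
      then show "\<bar>- g t - \<nu> * - W t - - f t\<bar> \<le> M / 4"
        by (simp only: mult_minus_right abs_le_iff) linarith
    qed (use False h F in \<open>auto intro!: derivative_intros W continuous_intros g\<close>)
    then have "- W 0 * exp (\<nu> * \<tau> / 2) \<le> \<bar>W \<tau>\<bar>" by simp
    then show ?thesis using False by (simp add: exp_minus field_simps)
  qed
  show ?thesis
  proof (cases "W 0 \<noteq> 0 \<and> 8 * F \<le> \<nu> * \<bar>W 0\<bar>")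
    case True
    then show ?thesis using * F0 \<nu> by (auto intro: order_trans[OF _ le_add_same_cancel2[THEN iffD2]])
  next
    case False
    have "\<bar>W 0\<bar> \<le> 8 * F / \<nu>" using False F0 \<nu> by (auto simp: field_simps)
    then show ?thesis by (simp add: add_increasing2)
  qed
qed

lemma integral_zero_imp_zero:
  fixes f :: "real \<Rightarrow> real"
  assumes f: "continuous_on {l..r} f" and lr: "l < r"
    and z: "\<And>x. l < x \<Longrightarrow> x < r \<Longrightarrow> integral {l..x} f = 0" and x: "x \<in> {l..r}"
  shows "f x = 0"
proof -
  have int: "f x = 0" if "x \<in> {l<..<r}" for x
  proof -
    have "((\<lambda>u. integral {l..u} f) has_real_derivative f x) (at x)"
      using integral_has_real_derivative[OF f, of x] that at_within_Icc_at[of l x r] by simp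
    moreover have "((\<lambda>u. integral {l..u} f) has_real_derivative 0) (at x)"
    proof (rule has_field_derivative_transform_within_open[of "\<lambda>_. 0" _ _ "{l<..<r}"])
    qed (use that z in auto)
    ultimately show ?thesis by (rule DERIV_unique)
  qed
  have "f x = 0" if "x \<in> closure {l<..<r}" for x
    by (rule continuous_constant_on_closure[of "{l<..<r}" f 0 x]) (use f lr int that in auto)
  then show ?thesis using x lr by simp
qed

text \<open>The weight \<open>1 - exp (- exp (n * (x - y)))\<close> tends to the indicator of \<open>y < x\<close> as \<open>n \<rightarrow> \<infinity>\<close>, and its
  exponential series expresses the weighted integral of \<open>f\<close> by the moments of order \<open>n k\<close>, each damped
  by \<open>exp (- n k (r - x))\<close> (Mikusinski).\<close>

lemma bounded_exp_moments_imp_zero: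
  fixes f :: "real \<Rightarrow> real"
  assumes f: "continuous_on {l..r} f" and lr: "l < r"
    and B: "\<And>n. (1::nat) \<le> n \<Longrightarrow> \<bar>integral {l..r} (\<lambda>y. exp (real n * (r - y)) * f y)\<bar> \<le> B"
    and x: "x \<in> {l..r}"
  shows "f x = 0"
proof (rule integral_zero_imp_zero[OF f lr _ x])
  fix x assume x: "l < x" "x < r"
  have B0: "0 \<le> B" using B[of 1] by auto
  have "\<exists>M. \<forall>y\<in>{l..r}. \<bar>f y\<bar> \<le> M"
    using compact_imp_bounded[OF compact_continuous_image[OF f]] by (auto simp: bounded_iff)
  then obtain M where M: "\<And>y. y \<in> {l..r} \<Longrightarrow> \<bar>f y\<bar> \<le> M" by blast
  \<comment> \<open>\<open>E\<close> is minus the weight. Subtracting 1 cancels the term k = 0 of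
    the exponential series, the only one whose moment is not damped as n grows.\<close>
  define E where "E = (\<lambda>(n::nat) y. exp (- exp (n * (x - y))) - 1 :: real)"
  define J where "J = (\<lambda>n. integral {l..r} (\<lambda>y. E n y * f y))"
  have bound: "\<bar>J n\<bar> \<le> B * (exp (exp (- (real n * (r - x)))) - 1)" if n: "n \<ge> 1" for n
  proof -
    define a where "a = (\<lambda>k. integral {l..r} (\<lambda>y. (- exp (n * (x - y))) ^ k / fact k * f y))"
    have ak: "\<bar>a k\<bar> \<le> exp (- (real n * (r - x))) ^ k / fact k * B" if "k \<ge> 1" for k
    proof -
      have "(- exp (n * (x - y))) ^ k / fact k * f y =
        ((-1) ^ k * exp (- (real n * (r - x))) ^ k / fact k) * (exp (real (n * k) * (r - y)) * f y)" for y
        by (simp add: power_minus[of "exp _"] exp_of_nat_mult[symmetric] exp_add[symmetric] algebra_simps)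
      then have "a k = ((-1) ^ k * exp (- (real n * (r - x))) ^ k / fact k) *
          integral {l..r} (\<lambda>y. exp (real (n * k) * (r - y)) * f y)"
        unfolding a_def by (simp only: integral_mult_right)
      then have "\<bar>a k\<bar> = exp (- (real n * (r - x))) ^ k / fact k *
          \<bar>integral {l..r} (\<lambda>y. exp (real (n * k) * (r - y)) * f y)\<bar>"
        by (simp add: abs_mult power_abs)
      also have "\<dots> \<le> exp (- (real n * (r - x))) ^ k / fact k * B"
        using that n by (intro mult_left_mono B) auto
      finally show ?thesis .
    qed
    define P where "P = (\<lambda>N y. (\<Sum>k<N. (- exp (n * (x - y))) ^ Suc k / fact (Suc k)))"
    have expsum: "(\<lambda>k. z ^ Suc k / fact (Suc k)) sums (exp z - 1)" for z :: real
    proof -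
      have "(\<lambda>k. z ^ k / fact k) sums exp z"
        using exp_converges[of z] by (simp add: scaleR_conv_of_real divide_inverse mult.commute)
      then show ?thesis by (subst sums_Suc_iff) simp
    qed
    have expsum_le: "(\<Sum>k<N. z ^ Suc k / fact (Suc k)) \<le> exp z - 1" if "0 \<le> z" for z :: real and N
    proof -
      have "(\<Sum>k<N. z ^ Suc k / fact (Suc k)) \<le> (\<Sum>k. z ^ Suc k / fact (Suc k))"
        using that by (intro sum_le_suminf sums_summable[OF expsum]) auto
      also have "\<dots> = exp z - 1" by (rule sums_unique[OF expsum, symmetric])
      finally show ?thesis .
    qed
    have Plim: "(\<lambda>N. P N y) \<longlonglongrightarrow> E n y" for y
      using expsum[of "- exp (n * (x - y))"] unfolding P_def E_def sums_def .
    have cont: "continuous_on {l..r} (\<lambda>y. P N y * f y)" for N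
      unfolding P_def by (intro continuous_intros f) auto
    have "(\<lambda>N. integral {l..r} (\<lambda>y. P N y * f y)) \<longlonglongrightarrow> J n"
      unfolding J_def
    proof (rule dominated_convergence(2)[where h = "\<lambda>y. exp (exp (n * (x - y))) * M"])
      show "norm (P N y * f y) \<le> exp (exp (n * (x - y))) * M" if "y \<in> {l..r}" for N y
      proof -
        have "\<bar>P N y\<bar> \<le> (\<Sum>k<N. exp (n * (x - y)) ^ Suc k / fact (Suc k))"
          unfolding P_def by (rule order_trans[OF sum_abs]) (simp add: power_abs abs_mult)
        also have "\<dots> \<le> exp (exp (n * (x - y))) - 1"
          by (rule expsum_le) simp
        finally have "\<bar>P N y\<bar> \<le> exp (exp (n * (x - y)))" by simp
        then show ?thesis using M[OF that] by (simp add: abs_mult mult_mono)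
      qed
    qed (auto intro!: integrable_continuous_real cont continuous_intros tendsto_intros Plim)
    moreover have "\<bar>integral {l..r} (\<lambda>y. P N y * f y)\<bar> \<le> B * (exp (exp (- (real n * (r - x)))) - 1)" for N
    proof -
      have "integral {l..r} (\<lambda>y. P N y * f y) = (\<Sum>k<N. a (Suc k))"
        unfolding P_def a_def sum_distrib_right
        by (intro integral_sum integrable_continuous_real) (auto intro!: continuous_intros f)
      also have "\<bar>\<dots>\<bar> \<le> (\<Sum>k<N. \<bar>a (Suc k)\<bar>)" by (rule sum_abs)
      also have "\<dots> \<le> (\<Sum>k<N. exp (- (real n * (r - x))) ^ Suc k / fact (Suc k) * B)"
        by (intro sum_mono ak) auto
      also have "\<dots> = (\<Sum>k<N. exp (- (real n * (r - x))) ^ Suc k / fact (Suc k)) * B"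
        by (simp add: sum_distrib_right)
      also have "\<dots> \<le> (exp (exp (- (real n * (r - x)))) - 1) * B"
        using B0 by (intro mult_right_mono expsum_le) auto
      finally show ?thesis by (simp add: mult.commute)
    qed
    ultimately show ?thesis
      by (intro LIMSEQ_le_const2[OF tendsto_rabs]) auto
  qed
  have top: "filterlim (\<lambda>n. real n * z) at_top sequentially" if "z > 0" for z :: real
    using that by (intro filterlim_at_top_mult_tendsto_pos[OF tendsto_const _ filterlim_real_sequentially]
        ) 
  have e0: "(\<lambda>n. exp (- (real n * z))) \<longlonglongrightarrow> 0" if "z > 0" for z :: real
    using top[OF that] by (intro filterlim_compose[OF exp_at_bot]) (simp add: filterlim_uminus_at_bot)
  have J0: "J \<longlonglongrightarrow> 0"
  proof (rule Lim_null_comparison)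
    show "\<forall>\<^sub>F n in sequentially. norm (J n) \<le> B * (exp (exp (- (real n * (r - x)))) - 1)"
      using bound by (auto simp: eventually_sequentially)
    have "(\<lambda>n. B * (exp (exp (- (real n * (r - x)))) - 1)) \<longlonglongrightarrow> B * (exp 0 - 1)"
      by (intro tendsto_intros e0) (use x in auto)
    then show "(\<lambda>n. B * (exp (exp (- (real n * (r - x)))) - 1)) \<longlonglongrightarrow> 0" by simp
  qed
  \<comment> \<open>The pointwise limit of \<open>E\<close>. The odd value at y = x is discarded
    later, a single point being negligible.\<close>
  define H where "H = (\<lambda>y. if y < x then -1 else if y = x then exp (-1) - 1 else 0 :: real)"
  have "J \<longlonglongrightarrow> integral {l..r} (\<lambda>y. H y * f y)"
    unfolding J_def
  proof (rule dominated_convergence(2)[where h = "\<lambda>_. M"])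
    show "(\<lambda>y. E n y * f y) integrable_on {l..r}" for n
      unfolding E_def by (intro integrable_continuous_real continuous_intros f)
    show "norm (E n y * f y) \<le> M" if "y \<in> {l..r}" for n y
    proof -
      have "\<bar>E n y\<bar> \<le> 1" unfolding E_def by (simp add: abs_le_iff)
      then have "\<bar>E n y\<bar> * \<bar>f y\<bar> \<le> 1 * M" using M[OF that] by (intro mult_mono) auto
      then show ?thesis by (simp add: abs_mult)
    qed
    show "(\<lambda>n. E n y * f y) \<longlonglongrightarrow> H y * f y" if "y \<in> {l..r}" for y
    proof (intro tendsto_mult tendsto_const)
      consider "y < x" | "y = x" | "y > x" by linarith
      then show "(\<lambda>n. E n y) \<longlonglongrightarrow> H y"
      proof cases
        case 1
        have "filterlim (\<lambda>n. exp (real n * (x - y))) at_top sequentially"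
          using top[of "x - y"] 1 by (intro filterlim_compose[OF exp_at_top]) auto
        then have "(\<lambda>n. exp (- exp (real n * (x - y)))) \<longlonglongrightarrow> 0"
          by (intro filterlim_compose[OF exp_at_bot]) (simp add: filterlim_uminus_at_bot)
        then have "(\<lambda>n. E n y) \<longlonglongrightarrow> 0 - 1" unfolding E_def by (intro tendsto_intros)
        then show ?thesis using 1 by (simp add: H_def)
      next
        case 3
        have "(\<lambda>n. exp (- exp (- (real n * (y - x)))) - 1) \<longlonglongrightarrow> exp (- 0) - 1"
          by (intro tendsto_intros e0) (use 3 in auto)
        then show ?thesis using 3 by (simp add: H_def E_def algebra_simps)
      qed (simp add: H_def E_def)
    qed
  qed auto
  then have "integral {l..r} (\<lambda>y. H y * f y) = 0" using J0 LIMSEQ_unique by blast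
  moreover have "integral {l..r} (\<lambda>y. H y * f y) = integral {l..x} (\<lambda>y. - f y)"
  proof -
    have "integral {l..r} (\<lambda>y. H y * f y) = integral {l..r} (\<lambda>y. if y \<in> {l..x} then - f y else 0)"
      by (rule integral_spike[of "{x}"]) (auto simp: H_def)
    also have "\<dots> = integral ({l..r} \<inter> {l..x}) (\<lambda>y. - f y)"
      by (simp only: integral_restrict_Int Int_commute)
    also have "{l..r} \<inter> {l..x} = {l..x}" using x by auto
    finally show ?thesis .
  qed
  ultimately show "integral {l..x} f = 0" by (simp add: integral_neg)
qed

section \<open>Sobolev regularity and time derivatives\<close>

definition flat :: "real poly \<Rightarrow> real \<Rightarrow> real" where
  "flat P x = (if x > 0 then poly P (1 / x) * exp (- (1 / x)) else 0)"

text \<open>With y = 1/x one has dy/dx = - y^2, so P(y) exp(-y) has derivative y^2 (P - P')(y)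
  exp(-y). Polynomials in 1/x are carried along because differentiation produces them; the family
  \<open>flat P\<close> is closed under it.\<close>

definition flat_deriv :: "real poly \<Rightarrow> real poly" where
  "flat_deriv P = [:0, 0, 1:] * (P - pderiv P)"

lemma poly_times_exp_tendsto_0: "((\<lambda>y. poly P y * exp (- y)) \<longlongrightarrow> (0::real)) at_top"
proof -
  have "((\<lambda>y. \<Sum>i\<le>degree P. coeff P i * (y ^ i / exp y)) \<longlongrightarrow> (\<Sum>i\<le>degree P. coeff P i * (0::real))) at_top"
    by (intro tendsto_intros tendsto_power_div_exp_0)
  then show ?thesis by (simp add: poly_altdef sum_distrib_right exp_minus divide_inverse mult.assoc)
qed

lemma flat_has_derivative: "(flat P has_real_derivative flat (flat_deriv P) x) (at x)"
proof -
  consider "x > 0" | "x < 0" | "x = 0" by linarith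
  then show ?thesis
  proof cases
    case 1
    have inv: "((\<lambda>x. 1 / x) has_real_derivative - (1 / x * (1 / x))) (at x)"
      using 1 by (auto intro!: derivative_eq_intros)
    have "((\<lambda>x. poly P (1 / x)) has_real_derivative poly (pderiv P) (1 / x) * (- (1 / x * (1 / x)))) (at x)"
      by (rule DERIV_chain2[OF poly_DERIV inv])
    moreover have "((\<lambda>x. exp (- (1 / x))) has_real_derivative exp (- (1 / x)) * (- (- (1 / x * (1 / x))))) (at x)"
      by (rule DERIV_chain2[OF DERIV_exp DERIV_minus[OF inv]])
    ultimately have "((\<lambda>x. poly P (1 / x) * exp (- (1 / x))) has_real_derivative flat (flat_deriv P) x) (at x)"
      by (rule DERIV_mult[THEN DERIV_cong]) (use 1 in \<open>simp add: flat_def flat_deriv_def algebra_simps\<close>)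
    then show ?thesis
      by (rule has_field_derivative_transform_within_open[where S="{0<..}"]) (use 1 in \<open>auto simp: flat_def\<close>)
  next
    case 2
    have "((\<lambda>x. 0) has_real_derivative flat (flat_deriv P) x) (at x)"
      using 2 by (simp add: flat_def)
    then show ?thesis
      by (rule has_field_derivative_transform_within_open[where S="{..<0}"]) (use 2 in \<open>auto simp: flat_def\<close>)
  next
    case 3
    have "((\<lambda>h. flat P h / h) \<longlongrightarrow> 0) (at 0)"
    proof (rule filterlim_split_at)
      have "((\<lambda>h. 0) \<longlongrightarrow> 0) (at_left (0::real))" by simp
      then show "((\<lambda>h. flat P h / h) \<longlongrightarrow> 0) (at_left 0)"
      proof (rule Lim_transform_eventually)
        show "\<forall>\<^sub>F h in at_left 0. 0 = flat P h / h"
          unfolding eventually_at_filter by (intro always_eventually allI) (simp add: flat_def)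
      qed
      \<comment> \<open>\<open>pCons 0 P\<close> is y P(y): dividing by h adds one power of 1/h,
        which the exponential still beats.\<close>
      have "((\<lambda>h. poly (pCons 0 P) (inverse h) * exp (- inverse h)) \<longlongrightarrow> 0) (at_right (0::real))"
        by (rule filterlim_compose[OF poly_times_exp_tendsto_0 filterlim_inverse_at_top_right])
      then show "((\<lambda>h. flat P h / h) \<longlongrightarrow> 0) (at_right 0)"
      proof (rule Lim_transform_eventually)
        show "\<forall>\<^sub>F h in at_right 0. poly (pCons 0 P) (inverse h) * exp (- inverse h) = flat P h / h"
          unfolding eventually_at_filter
          by (intro always_eventually allI) (simp add: flat_def inverse_eq_divide)
      qed
    qed
    then show ?thesis using 3 by (simp add: DERIV_def flat_def)
  qed
qed

text \<open>Differentiating such a product gives a sum of two products of the same shape. A class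
  closed under sums is therefore closed under differentiation, which yields smoothness to all orders
  without a formula for the n-th derivative.\<close>

inductive_set bump_space :: "real \<Rightarrow> real \<Rightarrow> real \<Rightarrow> (real \<Rightarrow> real) set" for m c d where
  prod: "(\<lambda>x. flat P (m * (x - c) - 1) * flat Q (m * (d - x) - 1)) \<in> bump_space m c d"
| add: "f \<in> bump_space m c d \<Longrightarrow> g \<in> bump_space m c d \<Longrightarrow> (\<lambda>x. f x + g x) \<in> bump_space m c d"

lemma bump_space_has_derivative:
  "f \<in> bump_space m c d \<Longrightarrow> \<exists>g\<in>bump_space m c d. \<forall>x. (f has_real_derivative g x) (at x)"
proof (induction rule: bump_space.induct)
  case (prod P Q)
  \<comment> \<open>The chain-rule factors m and - m are absorbed into the polynomials.\<close>
  have smult: "flat (smult a R) y = a * flat R y" for a R y by (simp add: flat_def)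
  show ?case
  proof (intro bexI allI)
    fix x
    show "((\<lambda>x. flat P (m * (x - c) - 1) * flat Q (m * (d - x) - 1)) has_real_derivative
      flat (smult m (flat_deriv P)) (m * (x - c) - 1) * flat Q (m * (d - x) - 1) +
      flat P (m * (x - c) - 1) * flat (smult (- m) (flat_deriv Q)) (m * (d - x) - 1)) (at x)"
    proof (rule DERIV_mult[THEN DERIV_cong])
      show "((\<lambda>x. flat P (m * (x - c) - 1)) has_real_derivative flat (flat_deriv P) (m * (x - c) - 1) * m) (at x)"
        by (rule DERIV_chain2[OF flat_has_derivative]) (auto intro!: derivative_eq_intros)
      show "((\<lambda>x. flat Q (m * (d - x) - 1)) has_real_derivative flat (flat_deriv Q) (m * (d - x) - 1) * (- m)) (at x)"
        by (rule DERIV_chain2[OF flat_has_derivative]) (auto intro!: derivative_eq_intros)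
    qed (unfold smult, simp)
  qed (rule bump_space.add[OF bump_space.prod bump_space.prod])
next
  case (add f g)
  then obtain f' g' where "f' \<in> bump_space m c d" "\<And>x. (f has_real_derivative f' x) (at x)"
    "g' \<in> bump_space m c d" "\<And>x. (g has_real_derivative g' x) (at x)" by blast
  then show ?case
    by (intro bexI[of _ "\<lambda>x. f' x + g' x"] allI DERIV_add bump_space.add)
qed

lemma higher_deriv_closed:
  fixes S :: "(real \<Rightarrow> real) set"
  assumes "\<And>f. f \<in> S \<Longrightarrow> \<exists>g\<in>S. \<forall>x. (f has_real_derivative g x) (at x)" "f \<in> S"
  shows "(deriv ^^ n) f \<in> S" "(deriv ^^ n) f differentiable_on UNIV"
proof -
  have *: "deriv g \<in> S" if g: "g \<in> S" for g
  proof -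
    obtain g' where g': "g' \<in> S" "\<And>x. (g has_real_derivative g' x) (at x)" using assms(1)[OF g] by blast
    have "deriv g = g'" using g'(2) DERIV_imp_deriv by blast
    then show ?thesis using g' by simp
  qed
  show S: "(deriv ^^ n) f \<in> S" by (induction n) (use assms(2) * in auto)
  show "(deriv ^^ n) f differentiable_on UNIV"
    using assms(1)[OF S] by (auto simp: differentiable_on_def real_differentiable_def)
qed

text \<open>The shift by 1 confines the support to [c + 1/m, d - 1/m], so it is compact inside (0,L)
  even for c = 0 and d = L. As \<open>flat 1\<close> tends to 1 at infinity, the bumps tend to the
  indicator of (c,d) for large m.\<close>

definition bump :: "real \<Rightarrow> real \<Rightarrow> real \<Rightarrow> real \<Rightarrow> real" where
  "bump m c d x = flat 1 (m * (x - c) - 1) * flat 1 (m * (d - x) - 1)"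

lemma bump_in_bump_space: "bump m c d \<in> bump_space m c d"
  unfolding bump_def [abs_def] by (rule bump_space.prod)

lemma test_fun_bump:
  assumes "m > 0" "c \<ge> 0" "d \<le> L"
  shows "test_fun L (bump m c d)"
  unfolding test_fun_def
proof (intro conjI allI exI impI)
  show "(deriv ^^ n) (bump m c d) differentiable_on UNIV" for n
    by (rule higher_deriv_closed(2)[OF bump_space_has_derivative bump_in_bump_space])
  have "0 < 1 / m" using assms by simp
  then show "0 < c + 1 / m" "d - 1 / m < L" using assms by linarith+
  show "bump m c d x = 0" if "x \<notin> {c + 1 / m..d - 1 / m}" for x
    proof -
      have "m * (x - c) \<le> 1 \<or> m * (d - x) \<le> 1"
        using that assms(1) by (auto simp: not_le field_simps)
      then show ?thesis by (auto simp: bump_def flat_def)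
    qed
qed

lemma bump_bounds: "0 \<le> bump m c d x" "bump m c d x \<le> 1"
proof -
  have "0 \<le> flat 1 y" "flat 1 y \<le> 1" for y by (auto simp: flat_def)
  then show "0 \<le> bump m c d x" "bump m c d x \<le> 1" unfolding bump_def by (auto intro!: mult_le_one)
qed

lemma bump_measurable [measurable]: "bump m c d \<in> borel_measurable borel"
proof -
  obtain g where "\<And>x. (bump m c d has_real_derivative g x) (at x)"
    using bump_space_has_derivative[OF bump_in_bump_space] by blast
  then have "continuous_on UNIV (bump m c d)"
    by (meson DERIV_isCont continuous_at_imp_continuous_on)
  then show ?thesis by (rule borel_measurable_continuous_onI)
qed

lemma bump_tendsto_indicator:
  "(\<lambda>n. bump (real (Suc n)) c d x) \<longlonglongrightarrow> indicator {c<..<d} x"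
proof (cases "x \<in> {c<..<d}")
  case True
  have top: "filterlim (\<lambda>n. real (Suc n) * z - 1) at_top sequentially" if "z > 0" for z :: real
  proof -
    have "filterlim (\<lambda>n. z * real (Suc n)) at_top sequentially"
      using that by (intro filterlim_tendsto_pos_mult_at_top[OF tendsto_const]
          filterlim_compose[OF filterlim_real_sequentially filterlim_Suc]) auto
    then have "filterlim (\<lambda>n. -1 + z * real (Suc n)) at_top sequentially"
      by (intro filterlim_tendsto_add_at_top[OF tendsto_const])
    then show ?thesis by (simp add: mult.commute)
  qed
  have "((\<lambda>y. exp (- inverse y)) \<longlongrightarrow> exp (- 0)) (at_top :: real filter)"
    by (intro tendsto_intros tendsto_inverse_0_at_top filterlim_ident)
  moreover have "\<forall>\<^sub>F y in at_top. exp (- inverse y) = flat 1 y"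
    using eventually_gt_at_top[of 0] by eventually_elim (simp add: flat_def inverse_eq_divide)
  ultimately have "(flat 1 \<longlongrightarrow> exp (- 0)) at_top"
    by (rule Lim_transform_eventually)
  then have "(flat 1 \<longlongrightarrow> 1) at_top" by simp
  then have "(\<lambda>n. flat 1 (real (Suc n) * z - 1)) \<longlonglongrightarrow> 1" if "z > 0" for z
    by (rule filterlim_compose[OF _ top[OF that]])
  then have "(\<lambda>n. bump (real (Suc n)) c d x) \<longlonglongrightarrow> 1 * 1"
    unfolding bump_def using True by (intro tendsto_mult) auto
  then show ?thesis using True by simp
next
  case False
  have "bump (real (Suc n)) c d x = 0" for n
  proof -
    have "real (Suc n) * (x - c) \<le> 0 \<or> real (Suc n) * (d - x) \<le> 0"
      using False by (auto simp: mult_le_0_iff)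
    then show ?thesis unfolding bump_def flat_def by auto
  qed
  then show ?thesis using False by simp
qed

text \<open>\<open>ennreal\<close> truncates negative values, so \<open>ennreal (f y)\<close> and
  \<open>ennreal (- f y)\<close> are the positive and negative parts. Their densities define finite
  measures that agree on all half-lines, hence coincide; so the two parts are equal almost
  everywhere, and then both are 0.\<close>

lemma AE_zero_if_integral_greaterThan_zero:
  fixes f :: "real \<Rightarrow> real"
  assumes f: "integrable lborel f"
    and z: "\<And>x. (\<integral>y. f y * indicator {x<..} y \<partial>lborel) = 0"
  shows "AE x in lborel. f x = 0"
proof -
  have [measurable]: "f \<in> borel_measurable borel" using f by auto
  have fin: "(\<integral>\<^sup>+y. ennreal (f y) \<partial>lborel) < \<infinity>" "(\<integral>\<^sup>+y. ennreal (- f y) \<partial>lborel) < \<infinity>"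
    using f unfolding real_integrable_def by (auto simp: top.not_eq_extremum)
  have em: "emeasure (density lborel (\<lambda>y. ennreal (g y))) {x<..} = (\<integral>\<^sup>+y. ennreal (g y * indicator {x<..} y) \<partial>lborel)"
    if [measurable]: "g \<in> borel_measurable borel" for g :: "real \<Rightarrow> real" and x
    by (subst emeasure_density) (auto intro!: nn_integral_cong split: split_indicator)
  have le: "(\<integral>\<^sup>+y. ennreal (g y * indicator {x<..} y) \<partial>lborel) \<le> (\<integral>\<^sup>+y. ennreal (g y) \<partial>lborel)"
    for g :: "real \<Rightarrow> real" and x
    by (intro nn_integral_mono) (auto split: split_indicator)
  have "density lborel (\<lambda>y. ennreal (f y)) = density lborel (\<lambda>y. ennreal (- f y))"
  proof (rule measure_eqI_lessThan)
    fix x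
    show "emeasure (density lborel (\<lambda>y. ennreal (f y))) {x<..} < \<infinity>"
      using le[of f x] fin(1) by (simp add: em order_le_less_trans)
    have "integrable lborel (\<lambda>y. f y * indicator {x<..} y)"
      using f by (intro integrable_real_mult_indicator) auto
    then have "enn2real (\<integral>\<^sup>+y. ennreal (f y * indicator {x<..} y) \<partial>lborel) =
      enn2real (\<integral>\<^sup>+y. ennreal (- f y * indicator {x<..} y) \<partial>lborel)"
      using z[of x] by (subst (asm) real_lebesgue_integral_def) auto
    moreover have "(\<integral>\<^sup>+y. ennreal (f y * indicator {x<..} y) \<partial>lborel) < \<infinity>"
      "(\<integral>\<^sup>+y. ennreal (- f y * indicator {x<..} y) \<partial>lborel) < \<infinity>"
      using le[of f x] le[of "\<lambda>y. - f y" x] fin by (auto intro: order_le_less_trans)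
    ultimately show "emeasure (density lborel (\<lambda>y. ennreal (f y))) {x<..} =
        emeasure (density lborel (\<lambda>y. ennreal (- f y))) {x<..}"
      by (simp add: em) (metis ennreal_enn2real infinity_ennreal_def)
  qed simp_all
  then have "AE x in lborel. ennreal (f x) = ennreal (- f x)"
    by (subst (asm) finite_density_unique) (use fin in auto)
  then show ?thesis
    by eventually_elim (metis ennreal_eq_0_iff ennreal_neg linorder_le_cases neg_0_le_iff_le neg_le_0_iff_le order_antisym)
qed

section \<open>Square integrable functions and weak derivatives of order 0\<close>

lemma finite_measure_lebesgue_on_interval: "finite_measure (lebesgue_on {0<..<L::real})"
  using emeasure_bounded_finite[of "{0<..<L}"]
  by (intro finite_measureI) (auto simp: space_restrict_space emeasure_restrict_space)

lemma L2_space_diff: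
  assumes "v \<in> L2_space L" "w \<in> L2_space L"
  shows "(\<lambda>x. v x - w x) \<in> L2_space L"
proof -
  have [measurable]: "v \<in> borel_measurable (lebesgue_on {0<..<L})" "w \<in> borel_measurable (lebesgue_on {0<..<L})"
    using assms by (auto simp: L2_space_def)
  have "integrable (lebesgue_on {0<..<L}) (\<lambda>x. 2 * (v x)\<^sup>2 + 2 * (w x)\<^sup>2)"
    using assms by (auto simp: L2_space_def)
  then have "integrable (lebesgue_on {0<..<L}) (\<lambda>x. (v x - w x)\<^sup>2)"
  proof (rule Bochner_Integration.integrable_bound)
    have "(v x - w x)\<^sup>2 \<le> 2 * (v x)\<^sup>2 + 2 * (w x)\<^sup>2" for x
      using zero_le_power2[of "v x + w x"] by (simp add: power2_eq_square algebra_simps)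
    then show "AE x in lebesgue_on {0<..<L}. norm ((v x - w x)\<^sup>2) \<le> norm (2 * (v x)\<^sup>2 + 2 * (w x)\<^sup>2)"
      by (intro AE_I2) simp
  qed measurable
  then show ?thesis by (simp add: L2_space_def)
qed

lemma L2_space_cmult: "v \<in> L2_space L \<Longrightarrow> (\<lambda>x. v x / c) \<in> L2_space L"
  by (auto simp: L2_space_def power_divide)

lemma L2_space_integrable:
  assumes "v \<in> L2_space L"
  shows "integrable (lebesgue_on {0<..<L}) v"
proof -
  interpret finite_measure "lebesgue_on {0<..<L}" by (rule finite_measure_lebesgue_on_interval)
  have "integrable (lebesgue_on {0<..<L}) (\<lambda>x. 1 + (v x)\<^sup>2)"
    using assms by (auto simp: L2_space_def)
  then show ?thesis
  proof (rule Bochner_Integration.integrable_bound)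
    have "\<bar>v x\<bar> \<le> 1 + (v x)\<^sup>2" for x
      using zero_le_power2[of "\<bar>v x\<bar> - 1"] by (simp add: power2_eq_square algebra_simps)
    then show "AE x in lebesgue_on {0<..<L}. norm (v x) \<le> norm (1 + (v x)\<^sup>2)"
      by (intro AE_I2) simp
  qed (use assms in \<open>auto simp: L2_space_def\<close>)
qed

text \<open>The fundamental lemma of the calculus of variations. It is needed because
  \<open>weak_deriv\<close> chooses its value by \<open>SOME\<close> even for j = 0, so that
  \<open>sobolev_norm\<close> does not mention the function itself.\<close>

lemma weak_deriv_0_unique:
  assumes L: "0 < L" and v: "v \<in> L2_space L" and w: "w \<in> L2_space L" and wd: "has_weak_deriv L 0 v w"
  shows "AE x in lebesgue_on {0<..<L}. v x = w x"
proof -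
  define D where "D = (\<lambda>x. indicator {0<..<L} x * (v x - w x))"
  have int: "integrable (lebesgue_on {0<..<L}) (\<lambda>x. v x - w x)"
    by (intro L2_space_integrable L2_space_diff v w)
  then have D: "integrable lebesgue D"
    by (subst (asm) integrable_restrict_space) (auto simp: D_def)
  \<comment> \<open>A Borel version of D, since the half-line criterion is stated for
    \<open>lborel\<close> and D is only Lebesgue measurable.\<close>
  then obtain D' where D': "D' \<in> borel_measurable lborel" "AE x in lborel. D x = D' x"
    using completion_ex_borel_measurable_real[of D lborel] by auto
  have [measurable]: "D' \<in> borel_measurable borel" using D'(1) by simp
  have AE: "AE x in lebesgue. D x = D' x" using D'(2) by (rule AE_completion)
  have int': "integrable lebesgue D'"
    using D AE by (subst (asm) integrable_cong_AE) (use D in \<open>auto intro: measurable_completion\<close>)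
  then have int'': "integrable lborel D'" by (simp add: integrable_completion)
  have "AE x in lborel. D' x = 0"
  proof (rule AE_zero_if_integral_greaterThan_zero[OF int''])
    fix x :: real
    \<comment> \<open>D' vanishes almost everywhere outside (0,L), so bumps filling (max x 0, L)
      recover the integral over the whole half-line beyond x.\<close>
    define c where "c = max x 0"
    have zero: "(\<integral>y. D' y * bump (real (Suc n)) c L y \<partial>lborel) = 0" for n
    proof -
      let ?\<psi> = "bump (real (Suc n)) c L"
      have m: "?\<psi> \<in> borel_measurable (lebesgue_on {0<..<L})"
        by (intro measurable_restrict_space1 measurable_completion) simp
      have i: "integrable (lebesgue_on {0<..<L}) (\<lambda>y. u y * ?\<psi> y)" if "u \<in> L2_space L" for u
      proof (rule Bochner_Integration.integrable_bound[OF L2_space_integrable[OF that]])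
        show "AE y in lebesgue_on {0<..<L}. norm (u y * ?\<psi> y) \<le> norm (u y)"
          using bump_bounds[of "real (Suc n)" c L] by (intro AE_I2) (auto simp: abs_mult intro!: mult_left_le)
      qed (use that m in \<open>auto simp: L2_space_def\<close>)
      have "L2_inner L v ?\<psi> = L2_inner L w ?\<psi>"
        using wd test_fun_bump[of "real (Suc n)" c L L] unfolding has_weak_deriv_def by (auto simp: c_def)
      then have "0 = (\<integral>y. (v y - w y) * ?\<psi> y \<partial>lebesgue_on {0<..<L})"
        unfolding L2_inner_def left_diff_distrib
        using i[OF v] i[OF w] by (subst Bochner_Integration.integral_diff) simp_all
      also have "\<dots> = (\<integral>y. D y * ?\<psi> y \<partial>lebesgue)"
        by (subst integral_restrict_space) (auto simp: D_def mult_ac)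
      also have "\<dots> = (\<integral>y. D' y * ?\<psi> y \<partial>lebesgue)"
      proof (rule integral_cong_AE)
        show "(\<lambda>y. D y * ?\<psi> y) \<in> borel_measurable lebesgue"
          using D by (intro borel_measurable_times) (auto intro: measurable_completion)
        show "(\<lambda>y. D' y * ?\<psi> y) \<in> borel_measurable lebesgue"
          by (intro measurable_completion) simp
        show "AE y in lebesgue. D y * ?\<psi> y = D' y * ?\<psi> y"
          using AE by eventually_elim simp
      qed
      also have "\<dots> = (\<integral>y. D' y * ?\<psi> y \<partial>lborel)"
        by (rule integral_completion) simp
      finally show ?thesis by simp
    qed
    have "(\<lambda>n. \<integral>y. D' y * bump (real (Suc n)) c L y \<partial>lborel) \<longlonglongrightarrow>
        (\<integral>y. D' y * indicator {c<..<L} y \<partial>lborel)"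
    proof (rule integral_dominated_convergence[where w = "\<lambda>y. norm (D' y)"])
      show "AE y in lborel. (\<lambda>n. D' y * bump (real (Suc n)) c L y) \<longlonglongrightarrow> D' y * indicator {c<..<L} y"
        by (intro AE_I2 tendsto_intros bump_tendsto_indicator)
      show "AE y in lborel. norm (D' y * bump (real (Suc n)) c L y) \<le> norm (D' y)" for n
        using bump_bounds[of "real (Suc n)" c L] by (intro AE_I2) (auto simp: abs_mult intro!: mult_left_le)
    qed (use int'' in auto)
    then have "(\<integral>y. D' y * indicator {c<..<L} y \<partial>lborel) = 0"
      unfolding zero using LIMSEQ_unique tendsto_const by blast
    also have "(\<integral>y. D' y * indicator {c<..<L} y \<partial>lborel) = (\<integral>y. D' y * indicator {x<..} y \<partial>lborel)"
    proof (rule integral_cong_AE)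
      show "AE y in lborel. D' y * indicator {c<..<L} y = D' y * indicator {x<..} y"
        using D'(2) by eventually_elim (auto simp: D_def c_def split: split_indicator_asm split_indicator)
    qed auto
    finally show "(\<integral>y. D' y * indicator {x<..} y \<partial>lborel) = 0" .
  qed
  then have "AE x in lebesgue. D' x = 0" by (rule AE_completion)
  with AE have "AE x in lebesgue. x \<in> {0<..<L} \<longrightarrow> v x = w x"
    by eventually_elim (auto simp: D_def)
  then show ?thesis by (simp add: AE_restrict_space_iff)
qed

text \<open>The summand j = 0 of the squared norm is the squared L2 norm, by uniqueness of the weak
  derivative of order 0; the other summands and the seminorm are nonnegative.\<close>

lemma L2_inner_le_sobolev_norm:
  assumes L: "0 < L" and v: "v \<in> L2_space L"
  shows "L2_inner L v v \<le> (sobolev_norm L s v)\<^sup>2"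
proof -
  define w where "w = weak_deriv L 0 v"
  have "v \<in> L2_space L \<and> has_weak_deriv L 0 v v" using v by (simp add: has_weak_deriv_def)
  then have w: "w \<in> L2_space L \<and> has_weak_deriv L 0 v w"
    unfolding w_def weak_deriv_def by (rule someI[of "\<lambda>w. w \<in> L2_space L \<and> has_weak_deriv L 0 v w"])
  then have "AE x in lebesgue_on {0<..<L}. v x = w x" using weak_deriv_0_unique[OF L v] by blast
  then have "L2_inner L v v = L2_inner L w w"
    unfolding L2_inner_def
    by (intro integral_cong_AE) (use v w in \<open>auto simp: L2_space_def elim: eventually_mono\<close>)
  also have "\<dots> \<le> (\<Sum>j\<le>nat \<lfloor>s\<rfloor>. L2_inner L (weak_deriv L j v) (weak_deriv L j v))"
    unfolding w_def by (rule member_le_sum) (auto simp: L2_inner_def)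
  also have "\<dots> \<le> (sobolev_norm L s v)\<^sup>2"
  proof -
    have "0 \<le> (\<Sum>j\<le>nat \<lfloor>s\<rfloor>. L2_inner L (weak_deriv L j v) (weak_deriv L j v))"
      by (intro sum_nonneg) (auto simp: L2_inner_def)
    then show ?thesis unfolding sobolev_norm_def by (subst real_sqrt_pow2) auto
  qed
  finally show ?thesis .
qed

text \<open>Integrate |v| <= A + v^2 / A with A = N + \<delta>. The summand \<delta> keeps A
  positive when N = 0.\<close>

lemma integral_abs_le_L2:
  assumes L: "0 < L" and v: "v \<in> L2_space L" and N: "L2_inner L v v \<le> N\<^sup>2" "0 \<le> N" and \<delta>: "0 < \<delta>"
  shows "(\<integral>x. \<bar>v x\<bar> \<partial>lebesgue_on {0<..<L}) \<le> (N + \<delta>) * L + N"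
proof -
  interpret finite_measure "lebesgue_on {0<..<L}" by (rule finite_measure_lebesgue_on_interval)
  have "(\<integral>x. \<bar>v x\<bar> \<partial>lebesgue_on {0<..<L}) \<le> (\<integral>x. (N + \<delta>) + (v x)\<^sup>2 / (N + \<delta>) \<partial>lebesgue_on {0<..<L})"
  proof (rule integral_mono)
    fix x
    have "\<bar>v x\<bar> * (N + \<delta>) \<le> (N + \<delta>)\<^sup>2 + (v x)\<^sup>2"
    proof -
      have "0 \<le> \<bar>v x\<bar> * (N + \<delta>)" using N(2) \<delta> by simp
      moreover have "2 * (\<bar>v x\<bar> * (N + \<delta>)) \<le> (v x)\<^sup>2 + (N + \<delta>)\<^sup>2"
        using sum_squares_bound[of "\<bar>v x\<bar>" "N + \<delta>"] by (simp only: mult.assoc power2_abs)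
      ultimately show ?thesis by linarith
    qed
    then show "\<bar>v x\<bar> \<le> (N + \<delta>) + (v x)\<^sup>2 / (N + \<delta>)"
      using N(2) \<delta> by (simp add: field_simps power2_eq_square)
  qed (use v L2_space_integrable[OF v] in \<open>auto simp: L2_space_def\<close>)
  also have "\<dots> = (N + \<delta>) * L + L2_inner L v v / (N + \<delta>)"
    using v L by (simp add: L2_space_def L2_inner_def power2_eq_square measure_restrict_space mult.commute)
  also have "L2_inner L v v / (N + \<delta>) \<le> N"
  proof -
    have "L2_inner L v v \<le> N * (N + \<delta>)" using N \<delta> by (simp add: power2_eq_square distrib_left add_increasing2)
    then show ?thesis using N \<delta> by (simp add: field_simps)
  qed
  finally show ?thesis by simp
qed

section \<open>Identification of the pointwise and the Sobolev-valued time derivative\<close>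

lemma at_within_Icc_sequence:
  fixes T :: real
  assumes "0 < T" "t \<in> {0..T}"
  obtains r :: "nat \<Rightarrow> real" where "\<And>n. r n \<in> {0..T}" "\<And>n. r n \<noteq> t" "filterlim r (at t within {0..T}) sequentially"
proof -
  have "t islimpt {0..T}"
    using assms by (metis atLeastAtMost_iff islimpt_Icc)
  then obtain r where r: "\<And>n::nat. r n \<in> {0..T} - {t}" "r \<longlonglongrightarrow> t"
    unfolding islimpt_sequential by blast
  then have "filterlim r (at t within {0..T}) sequentially"
    by (auto simp: filterlim_at)
  then show thesis using that r by blast
qed

text \<open>Difference quotients converge to \<open>ft\<close> pointwise and to the Sobolev-valued
  derivative in L2, so the two agree almost everywhere at each time. The exceptional set may depend
  on t; this is harmless because both claims are about integrals at one or two fixed times.\<close>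

lemma C1_sobolev_imp_L1_derivative:
  fixes f :: "real \<Rightarrow> real \<Rightarrow> real"
  assumes L: "0 < L" and T: "0 < T" and C: "C1_sobolev T L s f"
    and ft: "\<And>x t. x \<in> {0<..<L} \<Longrightarrow> t \<in> {0..T} \<Longrightarrow> ((\<lambda>t. f t x) has_real_derivative ft x t) (at t within {0..T})"
  shows "\<And>t. t \<in> {0..T} \<Longrightarrow> integrable (lebesgue_on {0<..<L}) (\<lambda>x. ft x t)"
    and "\<And>t. t \<in> {0..T} \<Longrightarrow> ((\<lambda>r. \<integral>x. \<bar>ft x r - ft x t\<bar> \<partial>lebesgue_on {0<..<L}) \<longlongrightarrow> 0) (at t within {0..T})"
proof -
  let ?M = "lebesgue_on {0<..<L}"
  obtain f' where f': "\<And>t. t \<in> {0..T} \<Longrightarrow> f t \<in> L2_space L" "\<And>t. t \<in> {0..T} \<Longrightarrow> f' t \<in> L2_space L"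
    "\<And>t. t \<in> {0..T} \<Longrightarrow> ((\<lambda>r. sobolev_norm L s (\<lambda>x. (f r x - f t x) / (r - t) - f' t x)) \<longlongrightarrow> 0) (at t within {0..T})"
    "\<And>t. t \<in> {0..T} \<Longrightarrow> ((\<lambda>r. sobolev_norm L s (\<lambda>x. f' r x - f' t x)) \<longlongrightarrow> 0) (at t within {0..T})"
    using C unfolding C1_sobolev_def sobolev_def by blast
  have AE: "AE x in ?M. ft x t = f' t x" if t: "t \<in> {0..T}" for t
  proof -
    obtain r where r: "\<And>n::nat. r n \<in> {0..T}" "\<And>n. r n \<noteq> t" "filterlim r (at t within {0..T}) sequentially"
      using at_within_Icc_sequence[OF T t] by blast
    define q where "q = (\<lambda>n x. (f (r n) x - f t x) / (r n - t) - f' t x)"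
    have q: "q n \<in> L2_space L" for n
      unfolding q_def by (intro L2_space_diff L2_space_cmult f' r t)
    have [measurable]: "q n \<in> borel_measurable ?M" for n using q[of n] by (simp add: L2_space_def)
    have lim: "(\<lambda>n. q n x) \<longlonglongrightarrow> ft x t - f' t x" if "x \<in> {0<..<L}" for x
      unfolding q_def
      by (intro tendsto_diff tendsto_const filterlim_compose[OF _ r(3)])
        (use ft[OF that t] in \<open>simp add: has_field_derivative_iff\<close>)
    have sp: "space ?M = {0<..<L}" by (simp add: space_restrict_space)
    have [measurable]: "(\<lambda>x. ft x t - f' t x) \<in> borel_measurable ?M"
      by (rule borel_measurable_LIMSEQ_real[where u=q]) (use lim sp in auto)
    have "(\<lambda>n. sobolev_norm L s (q n)) \<longlonglongrightarrow> 0"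
      using filterlim_compose[OF f'(3)[OF t] r(3)] unfolding q_def .
    then have lim0: "(\<lambda>n. ennreal ((sobolev_norm L s (q n))\<^sup>2)) \<longlonglongrightarrow> ennreal (0\<^sup>2)"
      by (intro tendsto_intros)
    have le: "(\<integral>\<^sup>+x. ennreal ((q n x)\<^sup>2) \<partial>?M) \<le> ennreal ((sobolev_norm L s (q n))\<^sup>2)" for n
    proof -
      have "(\<integral>\<^sup>+x. ennreal ((q n x)\<^sup>2) \<partial>?M) = ennreal (L2_inner L (q n) (q n))"
        using q[of n] unfolding L2_inner_def power2_eq_square
        by (intro nn_integral_eq_integral) (auto simp: L2_space_def power2_eq_square)
      then show ?thesis using L2_inner_le_sobolev_norm[OF L q[of n]] by (simp add: ennreal_leI)
    qed
    have "(\<lambda>n. \<integral>\<^sup>+x. ennreal ((q n x)\<^sup>2) \<partial>?M) \<longlonglongrightarrow> 0"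
      by (rule tendsto_sandwich[OF _ _ tendsto_const lim0[simplified]]) (simp_all add: le)
    then have liminf0: "liminf (\<lambda>n. \<integral>\<^sup>+x. ennreal ((q n x)\<^sup>2) \<partial>?M) = 0"
      by (rule lim_imp_Liminf[OF trivial_limit_sequentially])
    \<comment> \<open>Fatou: the squared L2 norms of q n tend to 0, while q n tends pointwise to
      \<open>ft\<close> minus the Sobolev derivative.\<close>
    have "(\<integral>\<^sup>+x. ennreal ((ft x t - f' t x)\<^sup>2) \<partial>?M) = (\<integral>\<^sup>+x. liminf (\<lambda>n. ennreal ((q n x)\<^sup>2)) \<partial>?M)"
    proof (rule nn_integral_cong)
      fix x assume "x \<in> space ?M"
      then have "(\<lambda>n. ennreal ((q n x)\<^sup>2)) \<longlonglongrightarrow> ennreal ((ft x t - f' t x)\<^sup>2)"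
        using lim sp by (intro tendsto_intros) auto
      then show "ennreal ((ft x t - f' t x)\<^sup>2) = liminf (\<lambda>n. ennreal ((q n x)\<^sup>2))"
        by (rule lim_imp_Liminf[OF trivial_limit_sequentially, symmetric])
    qed
    also have "\<dots> \<le> liminf (\<lambda>n. \<integral>\<^sup>+x. ennreal ((q n x)\<^sup>2) \<partial>?M)"
      by (rule nn_integral_liminf) simp
    finally have "(\<integral>\<^sup>+x. ennreal ((ft x t - f' t x)\<^sup>2) \<partial>?M) = 0"
      unfolding liminf0 by simp
    then have "AE x in ?M. ennreal ((ft x t - f' t x)\<^sup>2) = 0"
      by (subst (asm) nn_integral_0_iff_AE) auto
    then show ?thesis by eventually_elim auto
  qed
  have meas: "(\<lambda>x. ft x t) \<in> borel_measurable ?M" if t: "t \<in> {0..T}" for t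
  proof -
    obtain r where r: "\<And>n::nat. r n \<in> {0..T}" "\<And>n. r n \<noteq> t" "filterlim r (at t within {0..T}) sequentially"
      using at_within_Icc_sequence[OF T t] by blast
    have [measurable]: "f r \<in> borel_measurable ?M" if "r \<in> {0..T}" for r
      using f'(1)[OF that] by (simp add: L2_space_def)
    show ?thesis
    proof (rule borel_measurable_LIMSEQ_real)
      show "(\<lambda>n. (f (r n) x - f t x) / (r n - t)) \<longlonglongrightarrow> ft x t" if "x \<in> space ?M" for x
        by (rule filterlim_compose[OF _ r(3)])
          (use ft[OF _ t, of x] that in \<open>simp add: has_field_derivative_iff space_restrict_space\<close>)
      show "(\<lambda>x. (f (r n) x - f t x) / (r n - t)) \<in> borel_measurable ?M" for n
        using r(1)[of n] t by measurable
    qed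
  qed
  show "integrable ?M (\<lambda>x. ft x t)" if t: "t \<in> {0..T}" for t
    by (rule integrable_cong_AE_imp[OF L2_space_integrable[OF f'(2)[OF t]] meas[OF t]])
      (use AE[OF t] in \<open>eventually_elim, simp\<close>)
  show "((\<lambda>r. \<integral>x. \<bar>ft x r - ft x t\<bar> \<partial>?M) \<longlongrightarrow> 0) (at t within {0..T})" if t: "t \<in> {0..T}" for t
  proof -
    define N where "N = (\<lambda>r. sobolev_norm L s (\<lambda>x. f' r x - f' t x))"
    have N: "(N \<longlongrightarrow> 0) (at t within {0..T})" unfolding N_def by (rule f'(4)[OF t])
    \<comment> \<open>|r - t| serves as the \<delta> of \<open>integral_abs_le_L2\<close>: positive
      for r different from t and vanishing in the limit.\<close>
    have le: "\<forall>\<^sub>F r in at t within {0..T}. (\<integral>x. \<bar>ft x r - ft x t\<bar> \<partial>?M) \<le> (\<bar>N r\<bar> + \<bar>r - t\<bar>) * L + \<bar>N r\<bar>"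
      unfolding eventually_at_filter
    proof (intro always_eventually allI impI)
      fix r assume r: "r \<noteq> t" "r \<in> {0..T}"
      have d: "(\<lambda>x. f' r x - f' t x) \<in> L2_space L" by (intro L2_space_diff f' r t)
      have "(\<integral>x. \<bar>ft x r - ft x t\<bar> \<partial>?M) = (\<integral>x. \<bar>f' r x - f' t x\<bar> \<partial>?M)"
      proof (rule integral_cong_AE)
        show "AE x in ?M. \<bar>ft x r - ft x t\<bar> = \<bar>f' r x - f' t x\<bar>"
          using AE[OF r(2)] AE[OF t] by eventually_elim simp
      qed (use meas[OF r(2)] meas[OF t] d in \<open>auto simp: L2_space_def\<close>)
      also have "\<dots> \<le> (\<bar>N r\<bar> + \<bar>r - t\<bar>) * L + \<bar>N r\<bar>"
        by (rule integral_abs_le_L2[OF L d])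
          (use L2_inner_le_sobolev_norm[OF L d, of s] r in \<open>auto simp: N_def\<close>)
      finally show "(\<integral>x. \<bar>ft x r - ft x t\<bar> \<partial>?M) \<le> (\<bar>N r\<bar> + \<bar>r - t\<bar>) * L + \<bar>N r\<bar>" .
    qed
    have "((\<lambda>r. (\<bar>N r\<bar> + \<bar>r - t\<bar>) * L + \<bar>N r\<bar>) \<longlongrightarrow> (\<bar>0\<bar> + \<bar>t - t\<bar>) * L + \<bar>0\<bar>) (at t within {0..T})"
      by (intro tendsto_intros N)
    then have lim: "((\<lambda>r. (\<bar>N r\<bar> + \<bar>r - t\<bar>) * L + \<bar>N r\<bar>) \<longlongrightarrow> 0) (at t within {0..T})" by simp
    show ?thesis
      by (rule tendsto_sandwich[OF _ le tendsto_const lim]) (intro always_eventually allI, simp)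
  qed
qed

section \<open>Pairings of continuous curves in \<open>L\<^sup>1\<close>\<close>

text \<open>Replace t by floor (n t) / n: on each of countably many strips the function then depends
  on y alone and is measurable, and continuity in t gives convergence as n grows.\<close>

lemma borel_measurable_caratheodory:
  fixes f :: "real \<Rightarrow> real \<Rightarrow> real"
  assumes [measurable]: "\<And>t. (\<lambda>y. f y t) \<in> borel_measurable borel"
    and c: "\<And>y. continuous_on UNIV (f y)"
  shows "(\<lambda>(y, t). f y t) \<in> borel_measurable (borel \<Otimes>\<^sub>M borel)"
proof (rule borel_measurable_LIMSEQ_real)
  fix p :: "real \<times> real"
  let ?r = "\<lambda>n. real_of_int \<lfloor>real (Suc n) * snd p\<rfloor> / real (Suc n)"
  have fl: "x - 1 / N \<le> real_of_int \<lfloor>N * x\<rfloor> / N" "real_of_int \<lfloor>N * x\<rfloor> / N \<le> x"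
    if "N > 0" for N x :: real
  proof -
    have "N * x - 1 \<le> real_of_int \<lfloor>N * x\<rfloor>" "real_of_int \<lfloor>N * x\<rfloor> \<le> N * x" by linarith+
    then show "x - 1 / N \<le> real_of_int \<lfloor>N * x\<rfloor> / N" "real_of_int \<lfloor>N * x\<rfloor> / N \<le> x"
      using that divide_right_mono[of "N * x - 1" "real_of_int \<lfloor>N * x\<rfloor>" N]
      by (simp_all add: diff_divide_distrib pos_divide_le_eq mult.commute)
  qed
  have "?r \<longlonglongrightarrow> snd p"
  proof (rule tendsto_sandwich[where f = "\<lambda>n. snd p - 1 / real (Suc n)" and h = "\<lambda>_. snd p"])
    show "\<forall>\<^sub>F n in sequentially. snd p - 1 / real (Suc n) \<le> ?r n"
      by (intro always_eventually allI fl) simp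
    show "\<forall>\<^sub>F n in sequentially. ?r n \<le> snd p"
      by (intro always_eventually allI fl) simp
    have "(\<lambda>n. snd p - 1 / real (Suc n)) \<longlonglongrightarrow> snd p - 0"
      by (intro tendsto_intros LIMSEQ_inverse_real_of_nat[unfolded inverse_eq_divide])
    then show "(\<lambda>n. snd p - 1 / real (Suc n)) \<longlonglongrightarrow> snd p" by simp
  qed simp
  moreover have "isCont (f (fst p)) (snd p)"
    using c continuous_on_eq_continuous_at by blast
  ultimately have "(\<lambda>n. f (fst p) (?r n)) \<longlonglongrightarrow> f (fst p) (snd p)"
    by (rule isCont_tendsto_compose[rotated])
  then show "(\<lambda>n. f (fst p) (?r n)) \<longlonglongrightarrow> (case p of (y, t) \<Rightarrow> f y t)"
    by (simp add: case_prod_beta)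
next
  fix n
  have "(\<lambda>p. (\<lambda>i::int. \<lambda>p::real \<times> real. f (fst p) (real_of_int i / real (Suc n))) \<lfloor>real (Suc n) * snd p\<rfloor> p)
      \<in> borel_measurable (borel \<Otimes>\<^sub>M borel)"
    by (rule measurable_compose_countable) measurable
  then show "(\<lambda>p. f (fst p) (real_of_int \<lfloor>real (Suc n) * snd p\<rfloor> / real (Suc n)))
      \<in> borel_measurable (borel \<Otimes>\<^sub>M borel)" .
qed

text \<open>The antiderivative - (t - \<sigma>) powr (1 - \<alpha>) / (1 - \<alpha>) is continuous
  up to the singular end point, so the fundamental theorem applies with differentiability inside
  only. Nonnegativity carries the gauge integral over to the Lebesgue integral.\<close>

lemma abel_kernel_integral:
  fixes \<alpha> t :: real
  assumes \<alpha>: "0 \<le> \<alpha>" "\<alpha> < 1" and t: "0 < t"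
  shows "integrable lborel (\<lambda>\<sigma>. indicator {0<..<t} \<sigma> * (t - \<sigma>) powr (- \<alpha>))"
    and "(\<integral>\<sigma>. indicator {0<..<t} \<sigma> * (t - \<sigma>) powr (- \<alpha>) \<partial>lborel) = t powr (1 - \<alpha>) / (1 - \<alpha>)"
proof -
  have "((\<lambda>\<sigma>. (t - \<sigma>) powr (- \<alpha>)) has_integral
      (- ((t - t) powr (1 - \<alpha>) / (1 - \<alpha>)) - (- ((t - 0) powr (1 - \<alpha>) / (1 - \<alpha>))))) {0..t}"
  proof (rule fundamental_theorem_of_calculus_interior)
    show "continuous_on {0..t} (\<lambda>\<sigma>. - ((t - \<sigma>) powr (1 - \<alpha>) / (1 - \<alpha>)))"
      using \<alpha> by (intro continuous_intros continuous_on_powr') auto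
    fix x assume x: "x \<in> {0<..<t}"
    have "((\<lambda>\<sigma>. (t - \<sigma>) powr (1 - \<alpha>)) has_real_derivative (1 - \<alpha>) * (t - x) powr (1 - \<alpha> - 1) * (0 - 1)) (at x)"
      using x by (intro DERIV_chain2[OF has_real_derivative_powr] derivative_intros) auto
    from DERIV_minus[OF DERIV_cdivide[OF this, of "1 - \<alpha>"]]
    show "((\<lambda>\<sigma>. - ((t - \<sigma>) powr (1 - \<alpha>) / (1 - \<alpha>))) has_vector_derivative (t - x) powr - \<alpha>) (at x)"
      using \<alpha> unfolding has_real_derivative_iff_has_vector_derivative[symmetric] by simp
  qed (use t in auto)
  then have hi: "((\<lambda>\<sigma>. (t - \<sigma>) powr (- \<alpha>)) has_integral t powr (1 - \<alpha>) / (1 - \<alpha>)) {0..t}"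
    using t by simp
  have hi': "((\<lambda>\<sigma>. if \<sigma> \<in> {0..t} then (t - \<sigma>) powr (- \<alpha>) else 0) has_integral t powr (1 - \<alpha>) / (1 - \<alpha>)) UNIV"
    using hi by (simp only: has_integral_restrict_UNIV)
  have eq: "(\<lambda>\<sigma>. if \<sigma> \<in> {0..t} then (t - \<sigma>) powr (- \<alpha>) else (0::real)) x = indicator {0<..<t} x * (t - x) powr (- \<alpha>)"
    if "x \<in> UNIV - {0, t}" for x
    using that by (auto split: split_indicator)
  have hU: "((\<lambda>\<sigma>. indicator {0<..<t} \<sigma> * (t - \<sigma>) powr (- \<alpha>)) has_integral t powr (1 - \<alpha>) / (1 - \<alpha>)) UNIV"
    by (rule has_integral_spike[of "{0, t}", OF _ eq[symmetric] hi']) auto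
  have hb: "has_bochner_integral lborel (\<lambda>\<sigma>. indicator {0<..<t} \<sigma> * (t - \<sigma>) powr (- \<alpha>)) (t powr (1 - \<alpha>) / (1 - \<alpha>))"
    using nn_integral_has_integral_lborel[OF _ _ hU] \<alpha>
    by (intro has_bochner_integral_nn_integral) simp_all
  show "integrable lborel (\<lambda>\<sigma>. indicator {0<..<t} \<sigma> * (t - \<sigma>) powr (- \<alpha>))"
    using hb by (simp add: has_bochner_integral_iff)
  show "(\<integral>\<sigma>. indicator {0<..<t} \<sigma> * (t - \<sigma>) powr (- \<alpha>) \<partial>lborel) = t powr (1 - \<alpha>) / (1 - \<alpha>)"
    using hb by (rule has_bochner_integral_integral_eq)
qed

text \<open>A continuous curve in L1 whose values are also continuous in t for each y. The second
  property yields joint measurability; the first bounds the L1 norms on compact time intervals,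
  which replaces a dominating function in y.\<close>

locale L1_family =
  fixes F :: "real \<Rightarrow> real \<Rightarrow> real"
  assumes integrable_F: "\<And>t. integrable lborel (\<lambda>y. F y t)"
    and L1_continuous: "\<And>t. ((\<lambda>\<rho>. \<integral>y. \<bar>F y \<rho> - F y t\<bar> \<partial>lborel) \<longlongrightarrow> 0) (at t)"
    and continuous_F: "\<And>y. continuous_on UNIV (F y)"
begin

lemma measurable_F [measurable]: "(\<lambda>(y, t). F y t) \<in> borel_measurable (borel \<Otimes>\<^sub>M borel)"
  using integrable_F by (intro borel_measurable_caratheodory continuous_F) auto

lemma integrable_mult_F:
  assumes [measurable]: "s \<in> borel_measurable borel" and S: "\<And>y. \<bar>s y\<bar> \<le> S"
  shows "integrable lborel (\<lambda>y. s y * F y t)"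
proof (rule Bochner_Integration.integrable_bound)
  show "integrable lborel (\<lambda>y. S * F y t)" using integrable_F by simp
  show "AE y in lborel. norm (s y * F y t) \<le> norm (S * F y t)"
    using order_trans[OF S abs_ge_self] by (intro AE_I2) (simp add: abs_mult mult_right_mono)
qed measurable

lemma continuous_pairing:
  assumes s: "s \<in> borel_measurable borel" "\<And>y. \<bar>s y\<bar> \<le> S"
  shows "continuous_on A (\<lambda>t. \<integral>y. s y * F y t \<partial>lborel)"
proof -
  have "((\<lambda>\<rho>. (\<integral>y. s y * F y \<rho> \<partial>lborel) - (\<integral>y. s y * F y t \<partial>lborel)) \<longlongrightarrow> 0) (at t)" for t
  proof (rule Lim_null_comparison)
    show "\<forall>\<^sub>F \<rho> in at t. norm ((\<integral>y. s y * F y \<rho> \<partial>lborel) - (\<integral>y. s y * F y t \<partial>lborel))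
        \<le> S * (\<integral>y. \<bar>F y \<rho> - F y t\<bar> \<partial>lborel)"
    proof (intro always_eventually allI)
      fix \<rho>
      have "(\<integral>y. s y * F y \<rho> \<partial>lborel) - (\<integral>y. s y * F y t \<partial>lborel) = (\<integral>y. s y * F y \<rho> - s y * F y t \<partial>lborel)"
        by (intro Bochner_Integration.integral_diff[symmetric] integrable_mult_F[OF s])
      also have "norm \<dots> \<le> (\<integral>y. S * \<bar>F y \<rho> - F y t\<bar> \<partial>lborel)"
      proof (rule Bochner_Integration.integral_norm_bound_integral)
        show "norm (s y * F y \<rho> - s y * F y t) \<le> S * \<bar>F y \<rho> - F y t\<bar>" for y
          using s(2)[of y] by (simp add: right_diff_distrib[symmetric] abs_mult mult_right_mono)
      qed (intro Bochner_Integration.integrable_diff integrable_mult_F[OF s] integrable_mult_right integrable_abs integrable_F)+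
      finally show "norm ((\<integral>y. s y * F y \<rho> \<partial>lborel) - (\<integral>y. s y * F y t \<partial>lborel))
        \<le> S * (\<integral>y. \<bar>F y \<rho> - F y t\<bar> \<partial>lborel)" by simp
    qed
    show "((\<lambda>\<rho>. S * (\<integral>y. \<bar>F y \<rho> - F y t\<bar> \<partial>lborel)) \<longlongrightarrow> 0) (at t)"
      by (intro tendsto_mult_right_zero L1_continuous)
  qed
  then have "isCont (\<lambda>t. \<integral>y. s y * F y t \<partial>lborel) t" for t
    unfolding isCont_def by (subst LIM_zero_iff[symmetric]) 
  then show ?thesis by (simp add: continuous_at_imp_continuous_on)
qed

lemma continuous_L1_norm: "continuous_on A (\<lambda>t. \<integral>y. \<bar>F y t\<bar> \<partial>lborel)"
proof -
  have "((\<lambda>\<rho>. (\<integral>y. \<bar>F y \<rho>\<bar> \<partial>lborel) - (\<integral>y. \<bar>F y t\<bar> \<partial>lborel)) \<longlongrightarrow> 0) (at t)" for t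
  proof (rule Lim_null_comparison[OF _ L1_continuous])
    show "\<forall>\<^sub>F \<rho> in at t. norm ((\<integral>y. \<bar>F y \<rho>\<bar> \<partial>lborel) - (\<integral>y. \<bar>F y t\<bar> \<partial>lborel)) \<le> (\<integral>y. \<bar>F y \<rho> - F y t\<bar> \<partial>lborel)"
    proof (intro always_eventually allI)
      fix \<rho>
      have "(\<integral>y. \<bar>F y \<rho>\<bar> \<partial>lborel) - (\<integral>y. \<bar>F y t\<bar> \<partial>lborel) = (\<integral>y. \<bar>F y \<rho>\<bar> - \<bar>F y t\<bar> \<partial>lborel)"
        by (intro Bochner_Integration.integral_diff[symmetric] integrable_abs integrable_F)
      also have "norm \<dots> \<le> (\<integral>y. \<bar>F y \<rho> - F y t\<bar> \<partial>lborel)"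
        by (rule Bochner_Integration.integral_norm_bound_integral)
          (auto intro!: Bochner_Integration.integrable_diff integrable_abs integrable_F)
      finally show "norm ((\<integral>y. \<bar>F y \<rho>\<bar> \<partial>lborel) - (\<integral>y. \<bar>F y t\<bar> \<partial>lborel)) \<le> (\<integral>y. \<bar>F y \<rho> - F y t\<bar> \<partial>lborel)" .
    qed
  qed
  then have "isCont (\<lambda>t. \<integral>y. \<bar>F y t\<bar> \<partial>lborel) t" for t
    unfolding isCont_def by (subst LIM_zero_iff[symmetric])
  then show ?thesis by (simp add: continuous_at_imp_continuous_on)
qed

text \<open>On the support of q the L1 norms of F are bounded, so q(\<sigma>) s(y) F(y,\<sigma>) is
  integrable on the product. Only integrability of q is asked, since q will be a singular Abel
  kernel.\<close>

lemma pairing_Fubini: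
  assumes s: "s \<in> borel_measurable borel" "\<And>y. \<bar>s y\<bar> \<le> S"
    and q: "integrable lborel q" "\<And>\<sigma>. \<sigma> \<notin> {0..\<tau>} \<Longrightarrow> q \<sigma> = 0"
  shows "integrable lborel (\<lambda>y. s y * (\<integral>\<sigma>. q \<sigma> * F y \<sigma> \<partial>lborel))"
    and "(\<integral>y. s y * (\<integral>\<sigma>. q \<sigma> * F y \<sigma> \<partial>lborel) \<partial>lborel) = (\<integral>\<sigma>. q \<sigma> * (\<integral>y. s y * F y \<sigma> \<partial>lborel) \<partial>lborel)"
    and "integrable lborel (\<lambda>\<sigma>. q \<sigma> * (\<integral>y. s y * F y \<sigma> \<partial>lborel))"
proof -
  note s(1)[measurable]
  have [measurable]: "q \<in> borel_measurable borel" using q(1) by auto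
  have [measurable]: "(\<lambda>p. F (snd p) (fst p)) \<in> borel_measurable (borel \<Otimes>\<^sub>M borel)"
    using measurable_compose[OF measurable_Pair[OF measurable_snd measurable_fst] measurable_F]
    by simp
  have S0: "0 \<le> S" using s(2)[of 0] by auto
  obtain N where N: "\<And>t. t \<in> {0..\<tau>} \<Longrightarrow> (\<integral>y. \<bar>F y t\<bar> \<partial>lborel) \<le> N"
  proof -
    have "bounded ((\<lambda>t. \<integral>y. \<bar>F y t\<bar> \<partial>lborel) ` {0..\<tau>})"
      by (intro compact_imp_bounded compact_continuous_image continuous_L1_norm) simp
    then obtain N where "\<forall>t\<in>{0..\<tau>}. \<bar>\<integral>y. \<bar>F y t\<bar> \<partial>lborel\<bar> \<le> N"
      by (auto simp: bounded_iff)
    then show thesis using that[of N] by fastforce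
  qed
  let ?f = "\<lambda>\<sigma> y. q \<sigma> * (s y * F y \<sigma>)"
  have I: "integrable (lborel \<Otimes>\<^sub>M lborel) (case_prod ?f)"
  proof (rule lborel_pair.Fubini_integrable)
    show "case_prod ?f \<in> borel_measurable (lborel \<Otimes>\<^sub>M lborel)"
      unfolding case_prod_beta by measurable
    show "AE \<sigma> in lborel. integrable lborel (\<lambda>y. case (\<sigma>, y) of (\<sigma>, y) \<Rightarrow> ?f \<sigma> y)"
      by (intro AE_I2) (simp add: integrable_mult_F[OF s])
    have "integrable lborel (\<lambda>\<sigma>. \<integral>y. norm (?f \<sigma> y) \<partial>lborel)"
    proof (rule Bochner_Integration.integrable_bound)
      show "integrable lborel (\<lambda>\<sigma>. q \<sigma> * (S * N))" using q(1) by simp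
      show "(\<lambda>\<sigma>. \<integral>y. norm (?f \<sigma> y) \<partial>lborel) \<in> borel_measurable lborel"
        by measurable
      show "AE \<sigma> in lborel. norm (\<integral>y. norm (?f \<sigma> y) \<partial>lborel) \<le> norm (q \<sigma> * (S * N))"
      proof (rule AE_I2)
        fix \<sigma>
        show "norm (\<integral>y. norm (?f \<sigma> y) \<partial>lborel) \<le> norm (q \<sigma> * (S * N))"
        proof (cases "\<sigma> \<in> {0..\<tau>}")
          case True
          have "(\<integral>y. norm (?f \<sigma> y) \<partial>lborel) \<le> (\<integral>y. \<bar>q \<sigma>\<bar> * (S * \<bar>F y \<sigma>\<bar>) \<partial>lborel)"
          proof (rule integral_mono)
            show "norm (?f \<sigma> y) \<le> \<bar>q \<sigma>\<bar> * (S * \<bar>F y \<sigma>\<bar>)" for y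
              using s(2)[of y] by (auto simp: abs_mult intro!: mult_left_mono mult_right_mono)
          qed (intro integrable_norm integrable_mult_right integrable_mult_F[OF s] integrable_abs integrable_F)+
          also have "\<dots> = \<bar>q \<sigma>\<bar> * (S * (\<integral>y. \<bar>F y \<sigma>\<bar> \<partial>lborel))" by simp
          also have "\<dots> \<le> \<bar>q \<sigma>\<bar> * (S * N)"
            using N[OF True] S0 by (intro mult_left_mono) auto
          also have "\<dots> \<le> norm (q \<sigma> * (S * N))"
            by (simp only: real_norm_def abs_mult[of "q \<sigma>"]) (intro mult_left_mono abs_ge_self abs_ge_zero)
          finally show ?thesis by simp
        qed (simp add: q(2))
      qed
    qed
    then show "integrable lborel (\<lambda>\<sigma>. \<integral>y. norm (case (\<sigma>, y) of (\<sigma>, y) \<Rightarrow> ?f \<sigma> y) \<partial>lborel)" by simp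
  qed
  have eq: "(\<integral>\<sigma>. ?f \<sigma> y \<partial>lborel) = s y * (\<integral>\<sigma>. q \<sigma> * F y \<sigma> \<partial>lborel)" for y
    by (subst integral_mult_right_zero[symmetric]) (simp add: mult_ac)
  show "integrable lborel (\<lambda>y. s y * (\<integral>\<sigma>. q \<sigma> * F y \<sigma> \<partial>lborel))"
    using lborel_pair.integrable_snd[OF I] unfolding eq .
  show "(\<integral>y. s y * (\<integral>\<sigma>. q \<sigma> * F y \<sigma> \<partial>lborel) \<partial>lborel) = (\<integral>\<sigma>. q \<sigma> * (\<integral>y. s y * F y \<sigma> \<partial>lborel) \<partial>lborel)"
    using lborel_pair.Fubini_integral[OF I] unfolding eq by simp
  show "integrable lborel (\<lambda>\<sigma>. q \<sigma> * (\<integral>y. s y * F y \<sigma> \<partial>lborel))"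
    using lborel_pair.integrable_fst[OF I] by simp
qed

end

section \<open>Unique continuation from a point\<close>

lemma integral_lborel_Icc:
  fixes f :: "real \<Rightarrow> real"
  assumes "continuous_on {a..b} f"
  shows "integrable lborel (\<lambda>y. indicator {a..b} y * f y)"
    and "(\<integral>y. indicator {a..b} y * f y \<partial>lborel) = integral {a..b} f"
proof -
  have i: "set_integrable lborel {a..b} f" using borel_integrable_atLeastAtMost' assms by blast
  then show "integrable lborel (\<lambda>y. indicator {a..b} y * f y)"
    by (simp add: set_integrable_def)
  show "(\<integral>y. indicator {a..b} y * f y \<partial>lborel) = integral {a..b} f"
    using set_borel_integral_eq_integral(2)[OF i] by (simp add: set_lebesgue_integral_def)
qed

text \<open>The function \<open>\<theta>\<close> bounds the operator norm of the memory term on \<open>[0,t]\<close>.\<close>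

locale memory_heat =
  fixes l r \<tau> K :: real and \<kappa> \<alpha> \<theta> :: "real \<Rightarrow> real" and v vt vx vxx :: "real \<Rightarrow> real \<Rightarrow> real"
  assumes lr: "l < r" and \<tau>: "0 < \<tau>" and K: "0 < K"
    and cont_v: "\<And>t. t \<in> {0..\<tau>} \<Longrightarrow> continuous_on {l..r} (\<lambda>y. v y t)"
    and cont_vt: "\<And>y. y \<in> {l..r} \<Longrightarrow> continuous_on {0..\<tau>} (vt y)"
    and deriv_t: "\<And>y t. y \<in> {l..r} \<Longrightarrow> t \<in> {0..\<tau>} \<Longrightarrow> (v y has_real_derivative vt y t) (at t within {0..\<tau>})"
    and deriv_x: "\<And>y t. y \<in> {l..r} \<Longrightarrow> t \<in> {0<..\<tau>} \<Longrightarrow> ((\<lambda>y. v y t) has_real_derivative vx y t) (at y within {l..r})"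
    and deriv_xx: "\<And>y t. y \<in> {l..r} \<Longrightarrow> t \<in> {0<..\<tau>} \<Longrightarrow> ((\<lambda>y. vx y t) has_real_derivative vxx y t) (at y within {l..r})"
    and eqn: "\<And>y t. y \<in> {l..r} \<Longrightarrow> t \<in> {0<..\<tau>} \<Longrightarrow>
      K * vxx y t = vt y t + \<kappa> t * (LBINT \<sigma>:{0<..<t}. vt y \<sigma> / (t - \<sigma>) powr \<alpha> t)"
    and order: "\<And>t. t \<in> {0<..\<tau>} \<Longrightarrow> 0 \<le> \<alpha> t" "\<And>t. t \<in> {0<..\<tau>} \<Longrightarrow> \<alpha> t < 1"
    and memory: "\<And>t. t \<in> {0<..\<tau>} \<Longrightarrow> \<bar>\<kappa> t\<bar> * (t powr (1 - \<alpha> t) / (1 - \<alpha> t)) \<le> \<theta> t"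
      "\<And>t. t \<in> {0<..\<tau>} \<Longrightarrow> \<theta> t \<le> 1 / 4" "(\<theta> \<longlongrightarrow> 0) (at_right 0)"
    and vt_L1: "\<And>t. t \<in> {0..\<tau>} \<Longrightarrow> set_integrable lborel {l..r} (\<lambda>y. vt y t)"
      "\<And>t. t \<in> {0..\<tau>} \<Longrightarrow> ((\<lambda>\<rho>. LBINT y:{l..r}. \<bar>vt y \<rho> - vt y t\<bar>) \<longlongrightarrow> 0) (at t within {0..\<tau>})"
begin

text \<open>Extends \<open>vt\<close> constantly beyond both ends of [0,\<tau>], so that the
  two-sided, all-time assumptions of \<open>L1_family\<close> can be met.\<close>

definition clamp_t :: "real \<Rightarrow> real" where "clamp_t t = max 0 (min \<tau> t)"

definition F :: "real \<Rightarrow> real \<Rightarrow> real" where "F y t = indicator {l..r} y * vt y (clamp_t t)"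

lemma clamp_t_in: "clamp_t t \<in> {0..\<tau>}" using \<tau> by (auto simp: clamp_t_def)

lemma clamp_t_id: "t \<in> {0..\<tau>} \<Longrightarrow> clamp_t t = t" by (auto simp: clamp_t_def)

lemma continuous_clamp_t: "continuous_on A clamp_t"
  unfolding clamp_t_def [abs_def] by (intro continuous_intros)

sublocale L1_family F
proof
  show "integrable lborel (\<lambda>y. F y t)" for t
    using vt_L1(1)[OF clamp_t_in[of t]] by (simp add: F_def set_integrable_def)
  show "continuous_on UNIV (F y)" for y
  proof (cases "y \<in> {l..r}")
    case True
    have "continuous_on UNIV (\<lambda>t. vt y (clamp_t t))"
      by (rule continuous_on_compose2[OF cont_vt[OF True] continuous_clamp_t]) (use clamp_t_in in auto)
    then show ?thesis unfolding F_def by (intro continuous_intros)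
  qed (simp add: F_def)
  show "((\<lambda>\<rho>. \<integral>y. \<bar>F y \<rho> - F y t\<bar> \<partial>lborel) \<longlongrightarrow> 0) (at t)" for t
  proof -
    define D where "D = (\<lambda>\<rho>. LBINT y:{l..r}. \<bar>vt y \<rho> - vt y (clamp_t t)\<bar>)"
    have "D (clamp_t t) = 0" by (simp add: D_def set_lebesgue_integral_def)
    then have cD: "continuous (at (clamp_t t) within {0..\<tau>}) D"
      unfolding continuous_within using vt_L1(2)[OF clamp_t_in[of t]] by (simp add: D_def)
    have "(clamp_t \<longlongrightarrow> clamp_t t) (at t)"
      using continuous_clamp_t[of UNIV] by (simp add: continuous_on_def)
    then have "((\<lambda>\<rho>. D (clamp_t \<rho>)) \<longlongrightarrow> D (clamp_t t)) (at t)"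
      by (rule continuous_within_tendsto_compose'[OF cD clamp_t_in])
    then have "((\<lambda>\<rho>. D (clamp_t \<rho>)) \<longlongrightarrow> 0) (at t)"
      unfolding \<open>D (clamp_t t) = 0\<close> .
    moreover have "D (clamp_t \<rho>) = (\<integral>y. \<bar>F y \<rho> - F y t\<bar> \<partial>lborel)" for \<rho>
      unfolding D_def F_def set_lebesgue_integral_def
      by (intro Bochner_Integration.integral_cong) (auto split: split_indicator)
    ultimately show ?thesis by simp
  qed
qed

text \<open>Since \<open>s'' = \<mu>\<^sup>2 s\<close>, integrating by parts twice shows that \<open>W t = integral {l..r} (\<lambda>y. s y * v y t)\<close>
  satisfies the scalar equation \<open>W' = K \<mu>\<^sup>2 W + K \<cdot> boundary - memory\<close>.\<close>

lemma weighted_initial_bound: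
  fixes s s' :: "real \<Rightarrow> real" and \<mu> C :: real
  assumes \<mu>: "1 \<le> \<mu>"
    and s: "\<And>y. (s has_real_derivative s' y) (at y)" and s': "\<And>y. (s' has_real_derivative \<mu>\<^sup>2 * s y) (at y)"
    and bd: "\<And>t. t \<in> {0<..\<tau>} \<Longrightarrow>
      \<bar>(s r * vx r t - s' r * v r t) - (s l * vx l t - s' l * v l t)\<bar> \<le> \<mu> * C"
  shows "\<bar>integral {l..r} (\<lambda>y. s y * v y 0)\<bar> \<le>
    8 * C / \<mu> + \<bar>integral {l..r} (\<lambda>y. s y * v y \<tau>)\<bar> * exp (- (K * \<mu>\<^sup>2) * \<tau> / 2)"
proof -
  define s1 where "s1 = (\<lambda>y. indicator {l..r} y * s y)"
  define g where "g = (\<lambda>t. \<integral>y. s1 y * F y t \<partial>lborel)"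
  define W where "W = (\<lambda>t. integral {l..r} (\<lambda>y. s y * v y t))"
  define Bd where "Bd = (\<lambda>t. (s r * vx r t - s' r * v r t) - (s l * vx l t - s' l * v l t))"
  define \<nu> where "\<nu> = K * \<mu>\<^sup>2"
  have \<nu>: "0 < \<nu>" using K \<mu> by (simp add: \<nu>_def)
  have cs: "continuous_on A s" and cs': "continuous_on A s'" for A
    using s s' by (meson DERIV_isCont continuous_at_imp_continuous_on)+
  have s1m: "s1 \<in> borel_measurable borel"
    unfolding s1_def using borel_measurable_continuous_onI[OF cs] by measurable
  obtain S where S: "\<And>y. \<bar>s1 y\<bar> \<le> S"
  proof -
    have "bounded (s ` {l..r})" by (intro compact_imp_bounded compact_continuous_image cs) simp
    then obtain S where S: "\<forall>y\<in>{l..r}. \<bar>s y\<bar> \<le> S" by (auto simp: bounded_iff)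
    moreover have "0 \<le> S" using S[rule_format, of l] lr by simp
    ultimately show thesis by (intro that[of S]) (auto simp: s1_def split: split_indicator)
  qed
  note pairing = pairing_Fubini[OF s1m S, where \<tau> = \<tau>]
  have cg: "continuous_on A g" for A unfolding g_def by (rule continuous_pairing[OF s1m S])
  have contsv: "continuous_on {l..r} (\<lambda>y. s y * v y t)" if "t \<in> {0..\<tau>}" for t
    by (intro continuous_intros cs cont_v that)
  \<comment> \<open>Differentiating under the integral would need a bound on \<open>vt\<close>
    uniform in time. Instead Fubini with the indicator of [0,t] writes W as an integral of the
    continuous function g.\<close>
  have W_eq: "W t = W 0 + integral {0..t} g" if t: "t \<in> {0..\<tau>}" for t
  proof -
    define q where "q = (\<lambda>\<sigma>. indicator {0..t} \<sigma> :: real)"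
    have q: "integrable lborel q" "\<And>\<sigma>. \<sigma> \<notin> {0..\<tau>} \<Longrightarrow> q \<sigma> = 0"
      using t by (auto simp: q_def)
    have inner: "(\<integral>\<sigma>. q \<sigma> * F y \<sigma> \<partial>lborel) = v y t - v y 0" if y: "y \<in> {l..r}" for y
    proof -
      have c: "continuous_on {0..t} (vt y)"
        using cont_vt[OF y] t by (auto intro: continuous_on_subset)
      have "(\<integral>\<sigma>. q \<sigma> * F y \<sigma> \<partial>lborel) = (\<integral>\<sigma>. indicator {0..t} \<sigma> * vt y \<sigma> \<partial>lborel)"
        using y t by (intro Bochner_Integration.integral_cong)
          (auto simp: q_def F_def clamp_t_id split: split_indicator)
      also have "\<dots> = integral {0..t} (vt y)" by (rule integral_lborel_Icc(2)[OF c])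
      also have "\<dots> = v y t - v y 0"
      proof (intro integral_unique fundamental_theorem_of_calculus)
        fix x assume "x \<in> {0..t}"
        then have "(v y has_real_derivative vt y x) (at x within {0..t})"
          using t by (intro has_field_derivative_subset[OF deriv_t[OF y]]) auto
        then show "(v y has_vector_derivative vt y x) (at x within {0..t})"
          by (simp add: has_real_derivative_iff_has_vector_derivative)
      qed (use t in simp)
      finally show ?thesis .
    qed
    have "integral {0..t} g = (\<integral>\<sigma>. q \<sigma> * g \<sigma> \<partial>lborel)"
      unfolding q_def by (rule integral_lborel_Icc(2)[OF cg, symmetric])
    also have "\<dots> = (\<integral>y. s1 y * (\<integral>\<sigma>. q \<sigma> * F y \<sigma> \<partial>lborel) \<partial>lborel)"
      unfolding g_def using pairing(2)[OF q] by simp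
    also have "\<dots> = (\<integral>y. indicator {l..r} y * (s y * v y t - s y * v y 0) \<partial>lborel)"
      by (intro Bochner_Integration.integral_cong refl)
        (auto simp: s1_def inner right_diff_distrib split: split_indicator)
    also have "\<dots> = integral {l..r} (\<lambda>y. s y * v y t - s y * v y 0)"
      by (intro integral_lborel_Icc(2) continuous_intros contsv) (use t \<tau> in auto)
    also have "\<dots> = W t - W 0"
      unfolding W_def
      by (intro Henstock_Kurzweil_Integration.integral_diff integrable_continuous_real contsv) (use t \<tau> in auto)
    finally show ?thesis by simp
  qed
  have dW: "(W has_real_derivative g t) (at t within {0..\<tau>})" if t: "t \<in> {0..\<tau>}" for t
  proof -
    have "((\<lambda>t. W 0 + integral {0..t} g) has_real_derivative 0 + g t) (at t within {0..\<tau>})"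
      by (intro DERIV_add DERIV_const integral_has_real_derivative cg t)
    then have "((\<lambda>t. W 0 + integral {0..t} g) has_real_derivative g t) (at t within {0..\<tau>})" by simp
    then show ?thesis
      by (rule has_field_derivative_transform_within[where d = 1]) (rule zero_less_one t W_eq[symmetric], assumption?)+
  qed
  have main: "\<bar>g t - \<nu> * W t - K * Bd t\<bar> \<le> M * \<theta> t"
    if t: "t \<in> {0<..\<tau>}" and M: "\<And>\<sigma>. \<sigma> \<in> {0..t} \<Longrightarrow> \<bar>g \<sigma>\<bar> \<le> M" for t M
  proof -
    have t': "t \<in> {0..\<tau>}" "0 < t" using t by auto
    define q where "q = (\<lambda>\<sigma>. indicator {0<..<t} \<sigma> * (t - \<sigma>) powr (- \<alpha> t))"
    have q: "integrable lborel q" "(\<integral>\<sigma>. q \<sigma> \<partial>lborel) = t powr (1 - \<alpha> t) / (1 - \<alpha> t)"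
      unfolding q_def using abel_kernel_integral[OF order(1)[OF t] order(2)[OF t] t'(2)] by auto
    have q0: "\<And>\<sigma>. \<sigma> \<notin> {0..\<tau>} \<Longrightarrow> q \<sigma> = 0" using t by (auto simp: q_def)
    \<comment> \<open>This is s times the right-hand side of \<open>eqn\<close>, cut off to [l,r].
      Its integrability comes from the L1 theory, so s * K * \<open>vxx\<close> is integrable by the
      equation.\<close>
    define h where "h = (\<lambda>y. s1 y * F y t + \<kappa> t * (s1 y * (\<integral>\<sigma>. q \<sigma> * F y \<sigma> \<partial>lborel)))"
    have h: "integrable lborel h" "(\<integral>y. h y \<partial>lborel) = g t + \<kappa> t * (\<integral>\<sigma>. q \<sigma> * g \<sigma> \<partial>lborel)"
      unfolding h_def using integrable_mult_F[OF s1m S, of t] pairing[OF q(1) q0]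
      by (simp_all add: g_def)
    have h_eq: "h y = indicator {l..r} y * (s y * (K * vxx y t))" for y
    proof (cases "y \<in> {l..r}")
      case True
      have "(\<integral>\<sigma>. q \<sigma> * F y \<sigma> \<partial>lborel) = (LBINT \<sigma>:{0<..<t}. vt y \<sigma> / (t - \<sigma>) powr \<alpha> t)"
        unfolding set_lebesgue_integral_def
        using True t by (intro Bochner_Integration.integral_cong)
          (auto simp: q_def F_def clamp_t_id powr_minus divide_inverse split: split_indicator)
      then show ?thesis
        using eqn[OF True t] True t' by (simp add: h_def s1_def F_def clamp_t_id algebra_simps)
    qed (simp add: h_def s1_def)
    have "set_integrable lborel {l..r} (\<lambda>y. s y * (K * vxx y t))"
      using h(1) unfolding h_eq[abs_def] set_integrable_def by simp
    from set_borel_integral_eq_integral[OF this] h(2)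
    have i1: "((\<lambda>y. s y * (K * vxx y t)) has_integral g t + \<kappa> t * (\<integral>\<sigma>. q \<sigma> * g \<sigma> \<partial>lborel)) {l..r}"
      unfolding h_eq[abs_def] set_lebesgue_integral_def by (simp add: has_integral_iff)
    \<comment> \<open>Both integrations by parts at once: the derivative of s * \<open>vx\<close> -
      s' * v is s * \<open>vxx\<close> - \<mu>^2 * s * v, because s'' = \<mu>^2 s. The gauge
      integral needs no prior integrability of this derivative.\<close>
    have "((\<lambda>y. s y * vxx y t - \<mu>\<^sup>2 * (s y * v y t)) has_integral Bd t) {l..r}"
      unfolding Bd_def
    proof (rule fundamental_theorem_of_calculus)
      fix y assume y: "y \<in> {l..r}"
      have "((\<lambda>y. s y * vx y t - s' y * v y t) has_real_derivative
          (s' y * vx y t + vxx y t * s y) - (\<mu>\<^sup>2 * s y * v y t + vx y t * s' y)) (at y within {l..r})"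
        by (intro DERIV_diff DERIV_mult deriv_x[OF y t] deriv_xx[OF y t]
            has_field_derivative_at_within[OF s] has_field_derivative_at_within[OF s'])
      then show "((\<lambda>y. s y * vx y t - s' y * v y t) has_vector_derivative
          s y * vxx y t - \<mu>\<^sup>2 * (s y * v y t)) (at y within {l..r})"
        by (simp add: has_real_derivative_iff_has_vector_derivative[symmetric] algebra_simps)
    qed (use lr in simp)
    from has_integral_mult_right[OF this, of K]
    have i2: "((\<lambda>y. K * (s y * vxx y t - \<mu>\<^sup>2 * (s y * v y t))) has_integral K * Bd t) {l..r}" .
    have "((\<lambda>y. s y * v y t) has_integral W t) {l..r}"
      unfolding W_def by (intro integrable_integral integrable_continuous_real contsv t')
    from has_integral_mult_right[OF this, of \<nu>]
    have i3: "((\<lambda>y. \<nu> * (s y * v y t)) has_integral \<nu> * W t) {l..r}" .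
    have "((\<lambda>y. s y * (K * vxx y t)) has_integral K * Bd t + \<nu> * W t) {l..r}"
      using has_integral_add[OF i2 i3] by (simp add: \<nu>_def algebra_simps)
    then have "g t + \<kappa> t * (\<integral>\<sigma>. q \<sigma> * g \<sigma> \<partial>lborel) = K * Bd t + \<nu> * W t"
      using i1 has_integral_unique by blast
    then have "g t - \<nu> * W t - K * Bd t = - (\<kappa> t * (\<integral>\<sigma>. q \<sigma> * g \<sigma> \<partial>lborel))" by linarith
    then have eq: "\<bar>g t - \<nu> * W t - K * Bd t\<bar> = \<bar>\<kappa> t\<bar> * \<bar>\<integral>\<sigma>. q \<sigma> * g \<sigma> \<partial>lborel\<bar>"
      by (simp add: abs_mult)
    have "norm (\<integral>\<sigma>. q \<sigma> * g \<sigma> \<partial>lborel) \<le> (\<integral>\<sigma>. M * q \<sigma> \<partial>lborel)"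
    proof (rule Bochner_Integration.integral_norm_bound_integral)
      show "integrable lborel (\<lambda>\<sigma>. q \<sigma> * g \<sigma>)" unfolding g_def by (rule pairing(3)[OF q(1) q0])
      show "norm (q \<sigma> * g \<sigma>) \<le> M * q \<sigma>" for \<sigma>
      proof (cases "\<sigma> \<in> {0<..<t}")
        case True
        then have "(t - \<sigma>) powr (- \<alpha> t) * \<bar>g \<sigma>\<bar> \<le> (t - \<sigma>) powr (- \<alpha> t) * M"
          using M[of \<sigma>] by (intro mult_left_mono) auto
        then show ?thesis using True by (simp add: q_def abs_mult mult.commute)
      qed (simp add: q_def)
    qed (use q in auto)
    then have "\<bar>\<integral>\<sigma>. q \<sigma> * g \<sigma> \<partial>lborel\<bar> \<le> M * (t powr (1 - \<alpha> t) / (1 - \<alpha> t))"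
      by (simp add: q(2))
    then have "\<bar>g t - \<nu> * W t - K * Bd t\<bar> \<le> \<bar>\<kappa> t\<bar> * (M * (t powr (1 - \<alpha> t) / (1 - \<alpha> t)))"
      unfolding eq by (rule mult_left_mono) simp
    also have "\<dots> = M * (\<bar>\<kappa> t\<bar> * (t powr (1 - \<alpha> t) / (1 - \<alpha> t)))" by (simp only: mult_ac)
    also have "\<dots> \<le> M * \<theta> t"
    proof -
      have "0 \<le> M" using M[of 0] t' by auto
      then show ?thesis by (intro mult_left_mono memory(1)[OF t])
    qed
    finally show ?thesis .
  qed
  have Bd: "\<bar>K * Bd t\<bar> \<le> K * (\<mu> * C)" if "t \<in> {0<..\<tau>}" for t
    using bd[OF that] K by (simp add: Bd_def abs_mult)
  define f where "f = (\<lambda>t. if t = 0 then g 0 - \<nu> * W 0 else K * Bd t)"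
  have cW: "continuous_on {0..\<tau>} W" using dW by (rule DERIV_continuous_on)
  have f0: "\<bar>g 0 - \<nu> * W 0\<bar> \<le> K * (\<mu> * C)"
  proof -
    obtain M where M: "\<And>\<sigma>. \<sigma> \<in> {0..\<tau>} \<Longrightarrow> \<bar>g \<sigma>\<bar> \<le> M"
    proof -
      have "bounded (g ` {0..\<tau>})" by (intro compact_imp_bounded compact_continuous_image cg) simp
      then have "\<exists>M. \<forall>\<sigma>\<in>{0..\<tau>}. \<bar>g \<sigma>\<bar> \<le> M" by (auto simp: bounded_iff)
      then show thesis using that by blast
    qed
    have lim: "((\<lambda>t. \<bar>g t - \<nu> * W t\<bar>) \<longlongrightarrow> \<bar>g 0 - \<nu> * W 0\<bar>) (at_right 0)"
    proof -
      have "continuous_on {0..\<tau>} (\<lambda>t. \<bar>g t - \<nu> * W t\<bar>)" by (intro continuous_intros cg cW)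
      then have "((\<lambda>t. \<bar>g t - \<nu> * W t\<bar>) \<longlongrightarrow> \<bar>g 0 - \<nu> * W 0\<bar>) (at 0 within {0..\<tau>})"
        using \<tau> by (auto simp: continuous_on_def)
      then show ?thesis using \<tau> by (simp add: at_within_Icc_at_right)
    qed
    have "((\<lambda>t. K * (\<mu> * C) + M * \<theta> t) \<longlongrightarrow> K * (\<mu> * C) + M * 0) (at_right 0)"
      by (intro tendsto_intros memory(3))
    moreover have "\<forall>\<^sub>F t in at_right 0. \<bar>g t - \<nu> * W t\<bar> \<le> K * (\<mu> * C) + M * \<theta> t"
      unfolding eventually_at_right_field
    proof (intro exI[of _ \<tau>] conjI allI impI \<tau>)
      fix t assume "0 < t" "t < \<tau>"
      then have "\<bar>g t - \<nu> * W t - K * Bd t\<bar> \<le> M * \<theta> t" "\<bar>K * Bd t\<bar> \<le> K * (\<mu> * C)"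
        using main[of t M] M Bd[of t] by auto
      then show "\<bar>g t - \<nu> * W t\<bar> \<le> K * (\<mu> * C) + M * \<theta> t" by linarith
    qed
    ultimately have "\<bar>g 0 - \<nu> * W 0\<bar> \<le> K * (\<mu> * C) + M * 0"
      by (intro tendsto_le[OF _ _ lim]) auto
    then show ?thesis by simp
  qed
  have "\<bar>W 0\<bar> \<le> 8 * (K * (\<mu> * C)) / \<nu> + \<bar>W \<tau>\<bar> * exp (- \<nu> * \<tau> / 2)"
  proof (rule volterra_growth[OF \<tau> \<nu> dW cg, where f = f])
    show "\<bar>f t\<bar> \<le> K * (\<mu> * C)" if "t \<in> {0..\<tau>}" for t
      using that f0 Bd[of t] by (auto simp: f_def)
    fix t M assume t: "t \<in> {0..\<tau>}" and M: "\<And>s. s \<in> {0..t} \<Longrightarrow> \<bar>g s\<bar> \<le> M"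
    have M0: "0 \<le> M" using M[of 0] t by auto
    show "\<bar>g t - \<nu> * W t - f t\<bar> \<le> M / 4"
    proof (cases "t = 0")
      case False
      then have t': "t \<in> {0<..\<tau>}" using t by auto
      have "\<bar>g t - \<nu> * W t - K * Bd t\<bar> \<le> M * \<theta> t" by (rule main[OF t' M])
      also have "\<dots> \<le> M * (1 / 4)" using M0 by (intro mult_left_mono memory(2)[OF t'])
      finally show ?thesis using False by (simp add: f_def)
    qed (use M0 in \<open>simp add: f_def\<close>)
  qed
  also have "8 * (K * (\<mu> * C)) / \<nu> = 8 * C / \<mu>"
    using K \<mu> by (simp add: \<nu>_def power2_eq_square)
  finally show ?thesis by (simp add: W_def \<nu>_def)
qed

end

section \<open>Sinh weights and exponential moments of the initial values\<close>

lemma abs_sinh_le_exp: "0 \<le> x \<Longrightarrow> x \<le> y \<Longrightarrow> \<bar>sinh x\<bar> \<le> exp (y::real)"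
proof -
  assume xy: "0 \<le> x" "x \<le> y"
  have "\<bar>sinh x\<bar> = (exp x - exp (- x)) / 2" using xy by (simp add: sinh_def)
  also have "\<dots> \<le> exp x" by (simp add: field_simps add_increasing)
  also have "\<dots> \<le> exp y" using xy by simp
  finally show ?thesis .
qed

context memory_heat
begin

text \<open>At time \<tau> the weighted integral is at most of order exp (\<mu> a) with a = r - l,
  and the Gaussian factor exp (- K \<mu>^2 \<tau> / 2) wins uniformly in \<mu>. Hence B depends
  neither on \<mu> nor on the weight.\<close>

lemma weighted_initial_bound_uniform:
  obtains B where "\<And>s s' \<mu>. 1 \<le> \<mu> \<Longrightarrow> (\<And>y. (s has_real_derivative s' y) (at y)) \<Longrightarrow>
    (\<And>y. (s' has_real_derivative \<mu>\<^sup>2 * s y) (at y)) \<Longrightarrow>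
    (\<And>t. t \<in> {0<..\<tau>} \<Longrightarrow>
      \<bar>(s r * vx r t - s' r * v r t) - (s l * vx l t - s' l * v l t)\<bar> \<le> \<mu> * C) \<Longrightarrow>
    (\<And>y. y \<in> {l..r} \<Longrightarrow> \<bar>s y\<bar> \<le> exp (\<mu> * (r - l))) \<Longrightarrow>
    \<bar>integral {l..r} (\<lambda>y. s y * v y 0)\<bar> \<le> B"
proof -
  have "bounded ((\<lambda>y. v y \<tau>) ` {l..r})"
    using \<tau> by (intro compact_imp_bounded compact_continuous_image cont_v) auto
  then have "\<exists>V. \<forall>y\<in>{l..r}. \<bar>v y \<tau>\<bar> \<le> V" by (auto simp: bounded_iff)
  then obtain V where V: "\<And>y. y \<in> {l..r} \<Longrightarrow> \<bar>v y \<tau>\<bar> \<le> V" by blast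
  have V0: "0 \<le> V" using V[of l] lr by simp
  define a where "a = r - l"
  have a: "0 < a" using lr by (simp add: a_def)
  show thesis
  proof (rule that)
    fix s s' :: "real \<Rightarrow> real" and \<mu> :: real
    assume \<mu>: "1 \<le> \<mu>" and s: "\<And>y. (s has_real_derivative s' y) (at y)"
      and s': "\<And>y. (s' has_real_derivative \<mu>\<^sup>2 * s y) (at y)"
      and bd: "\<And>t. t \<in> {0<..\<tau>} \<Longrightarrow>
        \<bar>(s r * vx r t - s' r * v r t) - (s l * vx l t - s' l * v l t)\<bar> \<le> \<mu> * C"
      and s_le: "\<And>y. y \<in> {l..r} \<Longrightarrow> \<bar>s y\<bar> \<le> exp (\<mu> * (r - l))"
    have "0 \<le> \<mu> * C" using bd[of \<tau>] \<tau> by (intro order_trans[OF abs_ge_zero]) auto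
    then have C: "0 \<le> C" using \<mu> by (simp add: zero_le_mult_iff)
    have cs: "continuous_on {l..r} s"
      using s by (meson DERIV_isCont continuous_at_imp_continuous_on)
    have "norm (integral {l..r} (\<lambda>y. s y * v y \<tau>)) \<le> exp (\<mu> * a) * V * (r - l)"
    proof (rule integral_bound)
      show "norm (s y * v y \<tau>) \<le> exp (\<mu> * a) * V" if "y \<in> {l..r}" for y
        using V[OF that] s_le[OF that] by (simp add: abs_mult a_def mult_mono)
      show "continuous_on {l..r} (\<lambda>y. s y * v y \<tau>)"
        using \<tau> by (intro continuous_intros cs cont_v) auto
    qed (use lr in simp)
    then have "\<bar>integral {l..r} (\<lambda>y. s y * v y \<tau>)\<bar> * exp (- (K * \<mu>\<^sup>2) * \<tau> / 2) \<le>
        (exp (\<mu> * a) * V * (r - l)) * exp (- (K * \<mu>\<^sup>2) * \<tau> / 2)"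
      by (intro mult_right_mono) auto
    also have "\<dots> = V * a * exp (\<mu> * a - K * \<mu>\<^sup>2 * \<tau> / 2)"
    proof -
      have "exp (\<mu> * a - K * \<mu>\<^sup>2 * \<tau> / 2) = exp (\<mu> * a) * exp (- (K * \<mu>\<^sup>2) * \<tau> / 2)"
        by (simp add: exp_add[symmetric])
      then show ?thesis by (simp only: a_def[symmetric] mult_ac)
    qed
    \<comment> \<open>Completing the square: \<mu> a - K \<mu>^2 \<tau> / 2 is largest at \<mu> = a
      / (K \<tau>), with value a^2 / (2 K \<tau>).\<close>
    also have "\<dots> \<le> V * a * exp (a\<^sup>2 / (2 * K * \<tau>))"
    proof -
      have "0 \<le> (a - K * \<tau> * \<mu>)\<^sup>2 / (2 * K * \<tau>)" using K \<tau> by simp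
      also have "(a - K * \<tau> * \<mu>)\<^sup>2 / (2 * K * \<tau>) = a\<^sup>2 / (2 * K * \<tau>) - (\<mu> * a - K * \<mu>\<^sup>2 * \<tau> / 2)"
        using K \<tau> by (simp add: power2_eq_square field_simps)
      finally show ?thesis using V0 a by (intro mult_left_mono) auto
    qed
    finally have "\<bar>integral {l..r} (\<lambda>y. s y * v y \<tau>)\<bar> * exp (- (K * \<mu>\<^sup>2) * \<tau> / 2) \<le>
      V * a * exp (a\<^sup>2 / (2 * K * \<tau>))" .
    moreover have "8 * C / \<mu> \<le> 8 * C"
      using C \<mu> mult_left_mono[OF \<mu> C] by (simp add: field_simps)
    ultimately show "\<bar>integral {l..r} (\<lambda>y. s y * v y 0)\<bar> \<le> 8 * C + V * a * exp (a\<^sup>2 / (2 * K * \<tau>))"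
      using weighted_initial_bound[OF \<mu> s s' bd] by linarith
  qed
qed

text \<open>exp z = 2 sinh z + exp (- z), and the last term is at most 1 because \<open>e\<close> is
  nonnegative.\<close>

lemma exp_moment_bound:
  fixes e :: "nat \<Rightarrow> real \<Rightarrow> real"
  assumes B: "\<And>n. 1 \<le> n \<Longrightarrow> \<bar>integral {l..r} (\<lambda>y. sinh (real n * e n y) * v y 0)\<bar> \<le> B"
    and e: "\<And>n. continuous_on {l..r} (e n)" "\<And>n y. y \<in> {l..r} \<Longrightarrow> 0 \<le> e n y"
  obtains B' where "\<And>n. 1 \<le> n \<Longrightarrow> \<bar>integral {l..r} (\<lambda>y. exp (real n * e n y) * v y 0)\<bar> \<le> B'"
proof -
  have c0: "continuous_on {l..r} (\<lambda>y. v y 0)" using \<tau> by (intro cont_v) auto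
  have "bounded ((\<lambda>y. v y 0) ` {l..r})"
    by (intro compact_imp_bounded compact_continuous_image c0) simp
  then have "\<exists>V. \<forall>y\<in>{l..r}. \<bar>v y 0\<bar> \<le> V" by (auto simp: bounded_iff)
  then obtain V where V: "\<And>y. y \<in> {l..r} \<Longrightarrow> \<bar>v y 0\<bar> \<le> V" by blast
  have V0: "0 \<le> V" using V[of l] lr by simp
  show thesis
  proof (rule that)
    fix n :: nat assume n: "1 \<le> n"
    have i1: "(\<lambda>y. 2 * (sinh (real n * e n y) * v y 0)) integrable_on {l..r}"
      by (intro integrable_continuous_real continuous_intros e c0)
    have c2: "continuous_on {l..r} (\<lambda>y. exp (- (real n * e n y)) * v y 0)"
      by (intro continuous_intros e c0)
    have "integral {l..r} (\<lambda>y. exp (real n * e n y) * v y 0) =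
      integral {l..r} (\<lambda>y. 2 * (sinh (real n * e n y) * v y 0) + exp (- (real n * e n y)) * v y 0)"
      by (intro Henstock_Kurzweil_Integration.integral_cong) (simp add: sinh_def field_simps)
    also have "\<dots> = 2 * integral {l..r} (\<lambda>y. sinh (real n * e n y) * v y 0) +
        integral {l..r} (\<lambda>y. exp (- (real n * e n y)) * v y 0)"
      using i1 integrable_continuous_real[OF c2]
      by (subst Henstock_Kurzweil_Integration.integral_add) auto
    finally have eq: "integral {l..r} (\<lambda>y. exp (real n * e n y) * v y 0) = \<dots>" .
    have "norm (integral {l..r} (\<lambda>y. exp (- (real n * e n y)) * v y 0)) \<le> V * (r - l)"
    proof (rule integral_bound[OF _ c2])
      fix y assume y: "y \<in> {l..r}"
      have "exp (- (real n * e n y)) * \<bar>v y 0\<bar> \<le> 1 * V"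
        using e(2)[OF y, of n] V[OF y] by (intro mult_mono) auto
      then show "norm (exp (- (real n * e n y)) * v y 0) \<le> V" by (simp add: abs_mult)
    qed (use lr in simp)
    then show "\<bar>integral {l..r} (\<lambda>y. exp (real n * e n y) * v y 0)\<bar> \<le> 2 * B + V * (r - l)"
      unfolding eq using B[OF n] by simp
  qed
qed

text \<open>The weight sinh (n (r - y)) vanishes at r with slope - n. So the unknown slope
  \<open>vx r t\<close> drops out, the Cauchy data at l contribute nothing, and the boundary term is
  n * \<open>v r t\<close>, bounded by \<mu> C with \<mu> = n.\<close>

lemma initial_zero_if_left_cauchy_zero:
  assumes z: "\<And>t. t \<in> {0<..\<tau>} \<Longrightarrow> v l t = 0" "\<And>t. t \<in> {0<..\<tau>} \<Longrightarrow> vx l t = 0"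
    and C: "\<And>t. t \<in> {0<..\<tau>} \<Longrightarrow> \<bar>v r t\<bar> \<le> C" and y: "y \<in> {l..r}"
  shows "v y 0 = 0"
proof -
  obtain B where B: "\<And>s s' \<mu>. 1 \<le> \<mu> \<Longrightarrow> (\<And>y. (s has_real_derivative s' y) (at y)) \<Longrightarrow>
    (\<And>y. (s' has_real_derivative \<mu>\<^sup>2 * s y) (at y)) \<Longrightarrow>
    (\<And>t. t \<in> {0<..\<tau>} \<Longrightarrow>
      \<bar>(s r * vx r t - s' r * v r t) - (s l * vx l t - s' l * v l t)\<bar> \<le> \<mu> * C) \<Longrightarrow>
    (\<And>y. y \<in> {l..r} \<Longrightarrow> \<bar>s y\<bar> \<le> exp (\<mu> * (r - l))) \<Longrightarrow>
    \<bar>integral {l..r} (\<lambda>y. s y * v y 0)\<bar> \<le> B"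
    using weighted_initial_bound_uniform by blast
  have "\<bar>integral {l..r} (\<lambda>y. sinh (real n * (r - y)) * v y 0)\<bar> \<le> B" if n: "1 \<le> n" for n
  proof (rule B[where \<mu> = "real n" and s' = "\<lambda>y. - (real n * cosh (real n * (r - y)))"])
    show "\<bar>sinh (real n * (r - y))\<bar> \<le> exp (real n * (r - l))" if "y \<in> {l..r}" for y
      using that by (intro abs_sinh_le_exp mult_left_mono) auto
  qed (use n z C in \<open>auto intro!: derivative_eq_intros simp: power2_eq_square abs_mult mult_left_mono\<close>)
  then obtain B' where B': "\<And>n. 1 \<le> n \<Longrightarrow> \<bar>integral {l..r} (\<lambda>y. exp (real n * (r - y)) * v y 0)\<bar> \<le> B'"
    by (rule exp_moment_bound[of "\<lambda>_ y. r - y"]) (auto intro!: continuous_intros)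
  show ?thesis
    by (rule bounded_exp_moments_imp_zero[OF _ lr B' y]) (use \<tau> in \<open>auto intro: cont_v\<close>)
qed

text \<open>The mirror image, with the weight sinh (n (y - l)) vanishing at l.\<close>

lemma initial_zero_if_right_cauchy_zero:
  assumes z: "\<And>t. t \<in> {0<..\<tau>} \<Longrightarrow> v r t = 0" "\<And>t. t \<in> {0<..\<tau>} \<Longrightarrow> vx r t = 0"
    and C: "\<And>t. t \<in> {0<..\<tau>} \<Longrightarrow> \<bar>v l t\<bar> \<le> C" and y: "y \<in> {l..r}"
  shows "v y 0 = 0"
proof -
  obtain B where B: "\<And>s s' \<mu>. 1 \<le> \<mu> \<Longrightarrow> (\<And>y. (s has_real_derivative s' y) (at y)) \<Longrightarrow>
    (\<And>y. (s' has_real_derivative \<mu>\<^sup>2 * s y) (at y)) \<Longrightarrow>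
    (\<And>t. t \<in> {0<..\<tau>} \<Longrightarrow>
      \<bar>(s r * vx r t - s' r * v r t) - (s l * vx l t - s' l * v l t)\<bar> \<le> \<mu> * C) \<Longrightarrow>
    (\<And>y. y \<in> {l..r} \<Longrightarrow> \<bar>s y\<bar> \<le> exp (\<mu> * (r - l))) \<Longrightarrow>
    \<bar>integral {l..r} (\<lambda>y. s y * v y 0)\<bar> \<le> B"
    using weighted_initial_bound_uniform by blast
  have "\<bar>integral {l..r} (\<lambda>y. sinh (real n * (y - l)) * v y 0)\<bar> \<le> B" if n: "1 \<le> n" for n
  proof (rule B[where \<mu> = "real n" and s' = "\<lambda>y. real n * cosh (real n * (y - l))"])
    show "\<bar>sinh (real n * (y - l))\<bar> \<le> exp (real n * (r - l))" if "y \<in> {l..r}" for y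
      using that by (intro abs_sinh_le_exp mult_left_mono) auto
  qed (use n z C in \<open>auto intro!: derivative_eq_intros simp: power2_eq_square abs_mult mult_left_mono\<close>)
  then obtain B' where B': "\<And>n. 1 \<le> n \<Longrightarrow> \<bar>integral {l..r} (\<lambda>y. exp (real n * (y - l)) * v y 0)\<bar> \<le> B'"
    by (rule exp_moment_bound[of "\<lambda>_ y. y - l"]) (auto intro!: continuous_intros)
  \<comment> \<open>The reflection y -> - y turns moments weighted from l into the form required by
    the moment lemma.\<close>
  have "v (- (- y)) 0 = 0"
  proof (rule bounded_exp_moments_imp_zero[of "-r" "-l" "\<lambda>y. v (- y) 0" B' "- y"])
    show "continuous_on {- r..- l} (\<lambda>y. v (- y) 0)"
      by (rule continuous_on_compose2[OF cont_v[of 0]]) (use \<tau> in \<open>auto intro!: continuous_intros\<close>)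
    show "\<bar>integral {- r..- l} (\<lambda>y. exp (real n * (- l - y)) * v (- y) 0)\<bar> \<le> B'" if "1 \<le> n" for n
      using B'[OF that] Henstock_Kurzweil_Integration.integral_reflect_real
        [of r l "\<lambda>y. exp (real n * (y - l)) * v y 0"] by (simp add: minus_diff_commute)
  qed (use lr y in auto)
  then show ?thesis by simp
qed

end

section \<open>Uniqueness of the order\<close>

text \<open>In the open interval the two-sided \<open>deriv G\<close> agrees with the one-sided
  derivative g, and a bounded g times the Abel kernel is integrable. The gauge form feeds the
  extremum principle, the Lebesgue form the memory equation.\<close>

lemma caputo_has_integral:
  assumes t: "0 < t" "t \<le> T" and \<alpha>: "0 \<le> \<alpha> t" "\<alpha> t < 1"
    and G: "\<And>s. s \<in> {0..T} \<Longrightarrow> (G has_real_derivative g s) (at s within {0..T})"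
    and g: "continuous_on {0..T} g"
  shows "((\<lambda>s. frac_kernel (\<alpha> t) (t - s) * g s) has_integral caputo \<alpha> G t) {0..t}"
    and "caputo \<alpha> G t = 1 / Gamma (1 - \<alpha> t) * (LBINT s:{0<..<t}. g s / (t - s) powr \<alpha> t)"
proof -
  have deriv: "deriv G s = g s" if "s \<in> {0<..<t}" for s
    using G[of s] at_within_Icc_at[of 0 s T] that t by (auto intro: DERIV_imp_deriv)
  show c: "caputo \<alpha> G t = 1 / Gamma (1 - \<alpha> t) * (LBINT s:{0<..<t}. g s / (t - s) powr \<alpha> t)"
    unfolding caputo_def using deriv
    by (auto intro!: arg_cong[where f = "(*) _"] set_lebesgue_integral_cong simp: divide_inverse)
  have gt: "continuous_on {0..t} g" using t by (intro continuous_on_subset[OF g]) auto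
  have "bounded (g ` {0..t})" by (intro compact_imp_bounded compact_continuous_image gt) simp
  then have "\<exists>M. \<forall>s\<in>{0..t}. \<bar>g s\<bar> \<le> M" by (auto simp: bounded_iff)
  then obtain M where M: "\<And>s. s \<in> {0..t} \<Longrightarrow> \<bar>g s\<bar> \<le> M" by blast
  have int: "set_integrable lborel {0<..<t} (\<lambda>s. g s / (t - s) powr \<alpha> t)"
    unfolding set_integrable_def
  proof (rule Bochner_Integration.integrable_bound)
    show "integrable lborel (\<lambda>s. M * (indicator {0<..<t} s * (t - s) powr (- \<alpha> t)))"
      using abel_kernel_integral(1)[OF \<alpha> t(1)] by simp
    have [measurable]: "(\<lambda>s. indicator {0<..<t} s *\<^sub>R g s) \<in> borel_measurable borel"
      by (rule borel_measurable_continuous_on_indicator[OF _ continuous_on_subset[OF gt]]) auto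
    have "(\<lambda>s. (indicator {0<..<t} s *\<^sub>R g s) / (t - s) powr \<alpha> t) \<in> borel_measurable lborel"
      by measurable
    then show "(\<lambda>s. indicator {0<..<t} s *\<^sub>R (g s / (t - s) powr \<alpha> t)) \<in> borel_measurable lborel"
      by simp
    show "AE s in lborel. norm (indicator {0<..<t} s *\<^sub>R (g s / (t - s) powr \<alpha> t))
        \<le> norm (M * (indicator {0<..<t} s * (t - s) powr (- \<alpha> t)))"
    proof (rule AE_I2)
      fix s
      show "norm (indicator {0<..<t} s *\<^sub>R (g s / (t - s) powr \<alpha> t))
        \<le> norm (M * (indicator {0<..<t} s * (t - s) powr (- \<alpha> t)))"
      proof (cases "s \<in> {0<..<t}")
        case True
        then have "\<bar>g s\<bar> \<le> \<bar>M\<bar>" using M[of s] by auto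
        then show ?thesis using True
          by (simp add: abs_mult powr_minus divide_inverse mult_right_mono)
      qed simp
    qed
  qed
  have "((\<lambda>s. g s / (t - s) powr \<alpha> t) has_integral (LBINT s:{0<..<t}. g s / (t - s) powr \<alpha> t)) {0<..<t}"
    using set_borel_integral_eq_integral[OF int] by (simp add: has_integral_iff)
  then have "((\<lambda>s. g s / (t - s) powr \<alpha> t) has_integral (LBINT s:{0<..<t}. g s / (t - s) powr \<alpha> t)) {0..t}"
    by (simp only: has_integral_Icc_iff_Ioo)
  from has_integral_mult_right[OF this, of "1 / Gamma (1 - \<alpha> t)"]
  show "((\<lambda>s. frac_kernel (\<alpha> t) (t - s) * g s) has_integral caputo \<alpha> G t) {0..t}"
    unfolding c by (simp add: frac_kernel_def powr_minus divide_inverse mult_ac)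
qed

text \<open>The extremum principle is applied on [0,m], where m is a maximum point of G on [0,t].
  Which order is the larger at time m does not matter, since the two may be exchanged.\<close>

lemma equal_caputo_imp_le_initial:
  assumes \<tau>: "0 < \<tau>" "\<tau> \<le> T" "\<tau> < exp (Digamma (1 - b))" and b: "b < 1"
    and \<alpha>: "\<And>t. t \<in> {0<..\<tau>} \<Longrightarrow> 0 \<le> \<alpha> t" "\<And>t. t \<in> {0<..\<tau>} \<Longrightarrow> \<alpha> t \<le> b"
    and \<alpha>': "\<And>t. t \<in> {0<..\<tau>} \<Longrightarrow> 0 \<le> \<alpha>' t" "\<And>t. t \<in> {0<..\<tau>} \<Longrightarrow> \<alpha>' t \<le> b"
    and ne: "\<And>t. t \<in> {0<..\<tau>} \<Longrightarrow> \<alpha> t \<noteq> \<alpha>' t"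
    and G: "\<And>s. s \<in> {0..T} \<Longrightarrow> (G has_real_derivative g s) (at s within {0..T})"
    and g: "continuous_on {0..T} g"
    and eq: "\<And>t. t \<in> {0<..\<tau>} \<Longrightarrow> caputo \<alpha> G t = caputo \<alpha>' G t"
    and t: "t \<in> {0..\<tau>}"
  shows "G t \<le> G 0"
proof -
  have "continuous_on {0..t} G"
    using t \<tau> by (intro continuous_on_subset[OF DERIV_continuous_on[OF G]]) auto
  then obtain m where m: "m \<in> {0..t}" "\<And>s. s \<in> {0..t} \<Longrightarrow> G s \<le> G m"
    using continuous_attains_sup[of "{0..t}" G] t by auto
  have "G m \<le> G 0"
  proof (cases "m = 0")
    case False
    then have m0: "m \<in> {0<..\<tau>}" "0 < m" "m \<le> T" using m(1) t \<tau> by auto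
    have G': "\<And>s. s \<in> {0..m} \<Longrightarrow> (G has_real_derivative g s) (at s within {0..m})"
      using m0 by (intro has_field_derivative_subset[OF G]) auto
    have g': "continuous_on {0..m} g" using m0 by (intro continuous_on_subset[OF g]) auto
    have max: "\<And>s. s \<in> {0..m} \<Longrightarrow> G s \<le> G m" using m by auto
    have less: "m < exp (Digamma (1 - b))" using m0 \<tau> by auto
    have lt1: "\<alpha> m < 1" "\<alpha>' m < 1" using \<alpha>(2)[OF m0(1)] \<alpha>'(2)[OF m0(1)] b by auto
    note I = caputo_has_integral(1)[where \<alpha> = \<alpha> and t = m, OF m0(2,3) \<alpha>(1)[OF m0(1)] lt1(1) G g]
    note I' = caputo_has_integral(1)[where \<alpha> = \<alpha>' and t = m, OF m0(2,3) \<alpha>'(1)[OF m0(1)] lt1(2) G g]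
    consider "\<alpha> m < \<alpha>' m" | "\<alpha>' m < \<alpha> m" using ne[OF m0(1)] by linarith
    then show ?thesis
    proof cases
      case 1
      have int: "((\<lambda>s. (frac_kernel (\<alpha>' m) (m - s) - frac_kernel (\<alpha> m) (m - s)) * g s) has_integral 0) {0..m}"
        using has_integral_diff[OF I' I] eq[OF m0(1)] by (simp add: left_diff_distrib)
      show ?thesis
        by (rule frac_kernel_extremum[OF \<alpha>(1)[OF m0(1)] 1 \<alpha>'(2)[OF m0(1)] b m0(2) less G' g' max int])
    next
      case 2
      have int: "((\<lambda>s. (frac_kernel (\<alpha> m) (m - s) - frac_kernel (\<alpha>' m) (m - s)) * g s) has_integral 0) {0..m}"
        using has_integral_diff[OF I I'] eq[OF m0(1)] by (simp add: left_diff_distrib)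
      show ?thesis
        by (rule frac_kernel_extremum[OF \<alpha>'(1)[OF m0(1)] 2 \<alpha>(2)[OF m0(1)] b m0(2) less G' g' max int])
    qed
  qed simp
  then show ?thesis using m(2)[of t] t by auto
qed

lemma caputo_uminus:
  assumes t: "0 < t" "t \<le> T" and \<alpha>: "0 \<le> \<alpha> t" "\<alpha> t < 1"
    and G: "\<And>s. s \<in> {0..T} \<Longrightarrow> (G has_real_derivative g s) (at s within {0..T})"
    and g: "continuous_on {0..T} g"
  shows "caputo \<alpha> (\<lambda>s. - G s) t = - caputo \<alpha> G t"
proof -
  have "((\<lambda>s. frac_kernel (\<alpha> t) (t - s) * - g s) has_integral caputo \<alpha> (\<lambda>s. - G s) t) {0..t}"
    by (rule caputo_has_integral(1)[where \<alpha> = \<alpha> and t = t, OF t \<alpha>]) (auto intro!: DERIV_minus G continuous_intros g)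
  moreover have "((\<lambda>s. frac_kernel (\<alpha> t) (t - s) * - g s) has_integral - caputo \<alpha> G t) {0..t}"
    using has_integral_neg[OF caputo_has_integral(1)[where \<alpha> = \<alpha> and t = t, OF t \<alpha> G g]] by simp
  ultimately show ?thesis by (rule has_integral_unique)
qed

text \<open>The one-sided bound, applied to G and to - G.\<close>

lemma equal_caputo_imp_constant:
  assumes \<tau>: "0 < \<tau>" "\<tau> \<le> T" "\<tau> < exp (Digamma (1 - b))" and b: "b < 1"
    and \<alpha>: "\<And>t. t \<in> {0<..\<tau>} \<Longrightarrow> 0 \<le> \<alpha> t" "\<And>t. t \<in> {0<..\<tau>} \<Longrightarrow> \<alpha> t \<le> b"
    and \<alpha>': "\<And>t. t \<in> {0<..\<tau>} \<Longrightarrow> 0 \<le> \<alpha>' t" "\<And>t. t \<in> {0<..\<tau>} \<Longrightarrow> \<alpha>' t \<le> b"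
    and ne: "\<And>t. t \<in> {0<..\<tau>} \<Longrightarrow> \<alpha> t \<noteq> \<alpha>' t"
    and G: "\<And>s. s \<in> {0..T} \<Longrightarrow> (G has_real_derivative g s) (at s within {0..T})"
    and g: "continuous_on {0..T} g"
    and eq: "\<And>t. t \<in> {0<..\<tau>} \<Longrightarrow> caputo \<alpha> G t = caputo \<alpha>' G t"
    and t: "t \<in> {0..\<tau>}"
  shows "G t = G 0"
proof (rule antisym)
  show "G t \<le> G 0"
    by (rule equal_caputo_imp_le_initial[OF \<tau> b \<alpha> \<alpha>' ne G g eq t])
  have "- G t \<le> - G 0"
  proof (rule equal_caputo_imp_le_initial[OF \<tau> b \<alpha> \<alpha>' ne _ _ _ t, where G = "\<lambda>s. - G s" and g = "\<lambda>s. - g s"])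
    fix t assume t: "t \<in> {0<..\<tau>}"
    then have t': "0 < t" "t \<le> T" using \<tau> by auto
    have "\<alpha> t < 1" "\<alpha>' t < 1" using \<alpha>(2)[OF t] \<alpha>'(2)[OF t] b by auto
    then show "caputo \<alpha> (\<lambda>s. - G s) t = caputo \<alpha>' (\<lambda>s. - G s) t"
      using caputo_uminus[where \<alpha> = \<alpha>, OF t' _ _ G g] caputo_uminus[where \<alpha> = \<alpha>', OF t' _ _ G g] \<alpha>(1)[OF t] \<alpha>'(1)[OF t] eq[OF t]
      by simp
  qed (auto intro!: DERIV_minus G continuous_intros g)
  then show "G 0 \<le> G t" by simp
qed

section \<open>Measurability and kernel bounds for the heat equation with memory\<close>

lemma interval_L1_le:
  fixes w :: "real \<Rightarrow> real"
  assumes m: "(\<lambda>y. indicator {0..L} y * w y) \<in> borel_measurable borel"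
    and i: "integrable (lebesgue_on {0<..<L}) w" and sub: "{l..r} \<subseteq> {0..L}"
  shows "set_integrable lborel {l..r} w"
    and "(LBINT y:{l..r}. \<bar>w y\<bar>) \<le> (\<integral>y. \<bar>w y\<bar> \<partial>lebesgue_on {0<..<L})"
proof -
  define w0 where "w0 = (\<lambda>y. indicator {0..L} y * w y)"
  define w1 where "w1 = (\<lambda>y. indicator {0<..<L} y * w y)"
  have [measurable]: "w0 \<in> borel_measurable borel" using m by (simp add: w0_def)
  have w1_eq: "w1 = (\<lambda>y. indicator {0<..<L} y * w0 y)"
    by (auto simp: w1_def w0_def fun_eq_iff split: split_indicator)
  have w1m [measurable]: "w1 \<in> borel_measurable borel" unfolding w1_eq by measurable
  have "integrable lebesgue w1"
    using i by (subst (asm) integrable_restrict_space) (auto simp: w1_def)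
  then have w1: "integrable lborel w1" by (simp add: integrable_completion)
  have lr_eq: "(\<lambda>y. indicator {l..r} y *\<^sub>R w y) = (\<lambda>y. indicator {l..r} y * w0 y)"
    using sub by (auto simp: w0_def fun_eq_iff split: split_indicator)
  \<comment> \<open>The closed interval may contain 0 or L, which the space (0,L) omits; both are
    null sets.\<close>
  have AE: "AE y in lborel. \<bar>indicator {l..r} y *\<^sub>R w y\<bar> \<le> \<bar>w1 y\<bar>"
    using AE_lborel_singleton[of 0] AE_lborel_singleton[of L]
  proof eventually_elim
    case (elim y)
    show ?case
    proof (cases "y \<in> {l..r}")
      case True
      then have "y \<in> {0..L}" using sub by blast
      then have "y \<in> {0<..<L}" using elim by auto
      then show ?thesis by (simp add: w1_def abs_mult split: split_indicator)
    qed simp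
  qed
  show s: "set_integrable lborel {l..r} w"
    unfolding set_integrable_def
  proof (rule Bochner_Integration.integrable_bound[OF w1])
    show "(\<lambda>y. indicator {l..r} y *\<^sub>R w y) \<in> borel_measurable lborel"
      unfolding lr_eq by measurable
  qed (use AE in simp)
  have "(LBINT y:{l..r}. \<bar>w y\<bar>) = (\<integral>y. \<bar>indicator {l..r} y *\<^sub>R w y\<bar> \<partial>lborel)"
    unfolding set_lebesgue_integral_def by (simp add: abs_mult)
  also have "\<dots> \<le> (\<integral>y. \<bar>w1 y\<bar> \<partial>lborel)"
    using s w1 AE unfolding set_integrable_def by (intro integral_mono_AE integrable_abs)
  also have "\<dots> = (\<integral>y. \<bar>w1 y\<bar> \<partial>lebesgue)"
    by (rule integral_completion[symmetric]) simp
  also have "\<dots> = (\<integral>y. \<bar>w y\<bar> \<partial>lebesgue_on {0<..<L})"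
    by (subst integral_restrict_space) (auto simp: w1_def abs_mult)
  finally show "(LBINT y:{l..r}. \<bar>w y\<bar>) \<le> (\<integral>y. \<bar>w y\<bar> \<partial>lebesgue_on {0<..<L})" .
qed

text \<open>The difference quotients are continuous in y, so their limit is Borel. The Sobolev
  argument yields Lebesgue measurability on (0,L), whereas Fubini is used over
  \<open>lborel\<close>.\<close>

lemma difference_quotient_limit_measurable:
  fixes f :: "real \<Rightarrow> real \<Rightarrow> real"
  assumes T: "0 < T" and t: "t \<in> {0..T}" and f: "\<And>t. t \<in> {0..T} \<Longrightarrow> continuous_on {0..L} (\<lambda>y. f y t)"
    and ft: "\<And>y. y \<in> {0..L} \<Longrightarrow> (f y has_real_derivative ft y t) (at t within {0..T})"
  shows "(\<lambda>y. indicator {0..L} y * ft y t) \<in> borel_measurable borel"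
proof -
  obtain q where q: "\<And>n::nat. q n \<in> {0..T}" "\<And>n. q n \<noteq> t" "filterlim q (at t within {0..T}) sequentially"
    using at_within_Icc_sequence[OF T t] by blast
  show ?thesis
  proof (rule borel_measurable_LIMSEQ_real)
    show "(\<lambda>n. indicator {0..L} y *\<^sub>R ((f y (q n) - f y t) / (q n - t))) \<longlonglongrightarrow> indicator {0..L} y * ft y t" for y
    proof (cases "y \<in> {0..L}")
      case True
      have "(\<lambda>n. (f y (q n) - f y t) / (q n - t)) \<longlonglongrightarrow> ft y t"
        by (rule filterlim_compose[OF _ q(3)]) (use ft[OF True] in \<open>simp add: has_field_derivative_iff\<close>)
      then show ?thesis using True by simp
    qed simp
    show "(\<lambda>y. indicator {0..L} y *\<^sub>R ((f y (q n) - f y t) / (q n - t))) \<in> borel_measurable borel" for n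
      using q(2)[of n] by (intro borel_measurable_continuous_on_indicator continuous_intros f q t) auto
  qed
qed

lemma Gamma_lower_bound:
  fixes b :: real
  assumes "0 \<le> b" "b < 1"
  obtains c where "0 < c" "\<And>x. x \<in> {1 - b..1} \<Longrightarrow> c \<le> Gamma x"
proof -
  have "continuous_on {1 - b..1} (Gamma :: real \<Rightarrow> real)"
  proof (intro continuous_on_Gamma)
    show "{1 - b..1} \<inter> \<int>\<^sub>\<le>\<^sub>0 = {}" using assms by (auto dest!: nonpos_Ints_nonpos)
  qed
  then obtain m where "m \<in> {1 - b..1}" "\<And>x. x \<in> {1 - b..1} \<Longrightarrow> Gamma m \<le> Gamma x"
    using continuous_attains_inf[of "{1 - b..1}" Gamma] assms by auto
  then show thesis using that[of "Gamma m"] assms by auto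
qed

text \<open>Subtracting from a solution an affine function of \<open>x\<close> gives another solution, so it suffices that
  the Cauchy data at \<open>c\<close> do not depend on time.\<close>

lemma stationary_cauchy_data_imp_zero:
  fixes u :: "real \<Rightarrow> real \<Rightarrow> real"
  assumes L: "0 < L" and T: "0 < T" and K: "0 < K"
    and k: "continuous_on {0..T} k"
    and b: "0 \<le> b" "b < 1" and \<alpha>: "\<And>t. t \<in> {0..T} \<Longrightarrow> 0 \<le> \<alpha> t \<and> \<alpha> t \<le> b"
    and C1: "C1_sobolev T L \<gamma> (\<lambda>t x. u x t)"
    and cu: "\<And>t. t \<in> {0..T} \<Longrightarrow> continuous_on {0..L} (\<lambda>x. u x t)"
    and ut: "\<And>x. x \<in> {0..L} \<Longrightarrow> continuous_on {0..T} (ut x)"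
      "\<And>x t. x \<in> {0..L} \<Longrightarrow> t \<in> {0..T} \<Longrightarrow> (u x has_real_derivative ut x t) (at t within {0..T})"
    and ux: "\<And>x t. x \<in> {0..L} \<Longrightarrow> t \<in> {0<..T} \<Longrightarrow> ((\<lambda>y. u y t) has_real_derivative ux x t) (at x within {0..L})"
    and uxx: "\<And>x t. x \<in> {0..L} \<Longrightarrow> t \<in> {0<..T} \<Longrightarrow> ((\<lambda>y. ux y t) has_real_derivative uxx x t) (at x within {0..L})"
    and eqn: "\<And>x t. x \<in> {0..L} \<Longrightarrow> t \<in> {0<..T} \<Longrightarrow> ut x t + k t * caputo \<alpha> (u x) t - K * uxx x t = 0"
    and bc: "\<And>t. t \<in> {0..T} \<Longrightarrow> u 0 t = 0 \<and> u L t = 0"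
    and c: "0 < c" "c < L" and \<tau>0: "0 < \<tau>0" "\<tau>0 \<le> T"
    and cauchy: "\<And>t. t \<in> {0<..\<tau>0} \<Longrightarrow> u c t = u c 0" "\<And>t. t \<in> {0<..\<tau>0} \<Longrightarrow> ux c t = m"
    and x: "x \<in> {0..L}"
  shows "u x 0 = 0"
proof -
  obtain c0 where c0: "0 < c0" "\<And>x. x \<in> {1 - b..1} \<Longrightarrow> c0 \<le> Gamma x"
    using Gamma_lower_bound[OF b] by blast
  have "bounded (k ` {0..T})" by (intro compact_imp_bounded compact_continuous_image k) simp
  then have "\<exists>M. \<forall>t\<in>{0..T}. \<bar>k t\<bar> \<le> M" by (auto simp: bounded_iff)
  then obtain M where M: "\<And>t. t \<in> {0..T} \<Longrightarrow> \<bar>k t\<bar> \<le> M" by blast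
  have M0: "0 \<le> M" using M[of 0] T by auto
  define \<kappa> where "\<kappa> = (\<lambda>t. k t / Gamma (1 - \<alpha> t))"
  \<comment> \<open>M / c0 bounds |\<kappa> t|, and the other factor bounds the mass of the Abel
    kernel after replacing \<alpha> t by its upper bound b.\<close>
  define \<theta> where "\<theta> = (\<lambda>t. M / c0 * (t powr (1 - b) / (1 - b)))"
  have \<theta>_lim: "(\<theta> \<longlongrightarrow> 0) (at_right 0)"
  proof -
    have "((\<lambda>t. t powr (1 - b)) \<longlongrightarrow> 0) (at_right (0::real))"
      by (rule tendsto_zero_powrI[where b = "1 - b"])
        (use b in \<open>auto simp: eventually_at_filter intro!: tendsto_eq_intros\<close>)
    from tendsto_mult_right_zero[OF this, of "M / c0 / (1 - b)"] show ?thesis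
      by (simp add: \<theta>_def)
  qed
  then have "\<forall>\<^sub>F t in at_right 0. \<theta> t < 1 / 4" by (rule order_tendstoD) simp
  then obtain d where d: "0 < d" "\<And>t. 0 < t \<Longrightarrow> t < d \<Longrightarrow> \<theta> t < 1 / 4"
    by (auto simp: eventually_at_right_field)
  \<comment> \<open>\<tau> <= 1 makes t powr (1 - \<alpha> t) <= t powr (1 - b) on (0,\<tau>];
    \<tau> < d keeps \<theta> below 1/4 there.\<close>
  define \<tau> where "\<tau> = min \<tau>0 (min 1 (d / 2))"
  have \<tau>: "0 < \<tau>" "\<tau> \<le> \<tau>0" "\<tau> \<le> 1" "\<tau> < d" "\<tau> \<le> T" using \<tau>0 d by (auto simp: \<tau>_def)
  define v where "v = (\<lambda>y t. u y t - (u c 0 + m * (y - c)))"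
  define vx where "vx = (\<lambda>y t. ux y t - m)"
  have ut_meas: "(\<lambda>y. indicator {0..L} y * ut y t) \<in> borel_measurable borel" if "t \<in> {0..T}" for t
    by (rule difference_quotient_limit_measurable[where f = u and ft = ut, OF T that cu ut(2)[OF _ that]])
  have C1': "integrable (lebesgue_on {0<..<L}) (\<lambda>x. ut x t)"
    "((\<lambda>r. \<integral>x. \<bar>ut x r - ut x t\<bar> \<partial>lebesgue_on {0<..<L}) \<longlongrightarrow> 0) (at t within {0..T})"
    if "t \<in> {0..T}" for t
    by (rule C1_sobolev_imp_L1_derivative[OF L T C1 _ that, of ut]; rule ut(2); simp)+
  have heat: "memory_heat l r \<tau> K \<kappa> \<alpha> \<theta> v ut vx uxx" if lr: "l < r" "{l..r} \<subseteq> {0..L}" for l r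
  proof
    show "continuous_on {l..r} (\<lambda>y. v y t)" if "t \<in> {0..\<tau>}" for t
      unfolding v_def using that \<tau> lr by (intro continuous_intros continuous_on_subset[OF cu]) auto
    fix y assume "y \<in> {l..r}"
    then have y: "y \<in> {0..L}" using lr by auto
    show "continuous_on {0..\<tau>} (ut y)"
      using \<tau> by (intro continuous_on_subset[OF ut(1)[OF y]]) auto
    show "(v y has_real_derivative ut y t) (at t within {0..\<tau>})" if t: "t \<in> {0..\<tau>}" for t
    proof -
      have "(u y has_real_derivative ut y t) (at t within {0..\<tau>})"
        using t \<tau> by (intro has_field_derivative_subset[OF ut(2)[OF y]]) auto
      from DERIV_diff[OF this DERIV_const] show ?thesis unfolding v_def by simp
    qed
    fix t assume t: "t \<in> {0<..\<tau>}"
    then have t': "t \<in> {0<..T}" "t \<in> {0..T}" "0 < t" "t \<le> T" "t \<le> 1" "t < d" using \<tau> by auto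
    show "((\<lambda>y. v y t) has_real_derivative vx y t) (at y within {l..r})"
    proof -
      have "((\<lambda>y. u y t) has_real_derivative ux y t) (at y within {l..r})"
        using lr by (intro has_field_derivative_subset[OF ux[OF y t'(1)]])
      then show ?thesis unfolding v_def vx_def by (auto intro!: derivative_eq_intros)
    qed
    show "((\<lambda>y. vx y t) has_real_derivative uxx y t) (at y within {l..r})"
    proof -
      have "((\<lambda>y. ux y t) has_real_derivative uxx y t) (at y within {l..r})"
        using lr by (intro has_field_derivative_subset[OF uxx[OF y t'(1)]])
      then show ?thesis unfolding vx_def by (auto intro!: derivative_eq_intros)
    qed
    have \<alpha>t: "0 \<le> \<alpha> t" "\<alpha> t \<le> b" "\<alpha> t < 1" using \<alpha>[OF t'(2)] b by auto
    have "caputo \<alpha> (u y) t = 1 / Gamma (1 - \<alpha> t) * (LBINT s:{0<..<t}. ut y s / (t - s) powr \<alpha> t)"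
      by (rule caputo_has_integral(2)[where \<alpha> = \<alpha> and t = t, OF t'(3,4) \<alpha>t(1,3) ut(2)[OF y] ut(1)[OF y]])
    then show "K * uxx y t = ut y t + \<kappa> t * (LBINT s:{0<..<t}. ut y s / (t - s) powr \<alpha> t)"
      using eqn[OF y t'(1)] by (simp add: \<kappa>_def)
  next
    fix t assume t: "t \<in> {0<..\<tau>}"
    then have t': "t \<in> {0..T}" "0 < t" "t \<le> 1" "t < d" using \<tau> by auto
    have \<alpha>t: "0 \<le> \<alpha> t" "\<alpha> t \<le> b" "\<alpha> t < 1" using \<alpha>[OF t'(1)] b by auto
    show "0 \<le> \<alpha> t" "\<alpha> t < 1" using \<alpha>t by auto
    show "\<theta> t \<le> 1 / 4" using d(2)[OF t'(2,4)] by simp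
    have G: "c0 \<le> Gamma (1 - \<alpha> t)" using \<alpha>t by (intro c0(2)) auto
    have "\<bar>\<kappa> t\<bar> \<le> M / c0"
      unfolding \<kappa>_def using M[OF t'(1)] G c0(1) M0 by (auto simp: abs_div intro!: frac_le)
    moreover have "t powr (1 - \<alpha> t) / (1 - \<alpha> t) \<le> t powr (1 - b) / (1 - b)"
      using \<alpha>t b t' by (intro frac_le powr_mono') auto
    ultimately show "\<bar>\<kappa> t\<bar> * (t powr (1 - \<alpha> t) / (1 - \<alpha> t)) \<le> \<theta> t"
      unfolding \<theta>_def using \<alpha>t M0 c0(1) by (intro mult_mono) auto
  next
    fix t assume "t \<in> {0..\<tau>}"
    then have t: "t \<in> {0..T}" using \<tau> by auto
    show "set_integrable lborel {l..r} (\<lambda>y. ut y t)"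
      by (rule interval_L1_le(1)[OF ut_meas[OF t] C1'(1)[OF t] lr(2)])
    have le: "(LBINT y:{l..r}. \<bar>ut y \<rho> - ut y t\<bar>) \<le> (\<integral>y. \<bar>ut y \<rho> - ut y t\<bar> \<partial>lebesgue_on {0<..<L})"
      if \<rho>: "\<rho> \<in> {0..\<tau>}" for \<rho>
    proof (rule interval_L1_le(2)[OF _ _ lr(2)])
      have \<rho>': "\<rho> \<in> {0..T}" using \<rho> \<tau> by auto
      show "(\<lambda>y. indicator {0..L} y * (ut y \<rho> - ut y t)) \<in> borel_measurable borel"
        unfolding right_diff_distrib by (intro borel_measurable_diff ut_meas \<rho>' t)
      show "integrable (lebesgue_on {0<..<L}) (\<lambda>y. ut y \<rho> - ut y t)"
        by (intro Bochner_Integration.integrable_diff C1'(1) \<rho>' t)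
    qed
    show "((\<lambda>\<rho>. LBINT y:{l..r}. \<bar>ut y \<rho> - ut y t\<bar>) \<longlongrightarrow> 0) (at t within {0..\<tau>})"
    proof (rule tendsto_sandwich[OF _ _ tendsto_const])
      show "((\<lambda>\<rho>. \<integral>y. \<bar>ut y \<rho> - ut y t\<bar> \<partial>lebesgue_on {0<..<L}) \<longlongrightarrow> 0) (at t within {0..\<tau>})"
        using \<tau> by (intro tendsto_within_subset[OF C1'(2)[OF t]]) auto
      show "\<forall>\<^sub>F \<rho> in at t within {0..\<tau>}. (LBINT y:{l..r}. \<bar>ut y \<rho> - ut y t\<bar>)
          \<le> (\<integral>y. \<bar>ut y \<rho> - ut y t\<bar> \<partial>lebesgue_on {0<..<L})"
        unfolding eventually_at_filter using le by (intro always_eventually) auto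
      show "\<forall>\<^sub>F \<rho> in at t within {0..\<tau>}. 0 \<le> (LBINT y:{l..r}. \<bar>ut y \<rho> - ut y t\<bar>)"
        unfolding set_lebesgue_integral_def by (intro always_eventually allI integral_nonneg) auto
    qed
  qed (use lr \<tau> K \<theta>_lim in auto)
  have zc: "v c t = 0" "vx c t = 0" if "t \<in> {0<..\<tau>}" for t
    using that \<tau> cauchy[of t] by (auto simp: v_def vx_def)
  have vL: "\<bar>v L t\<bar> \<le> \<bar>u c 0 + m * (L - c)\<bar>" "\<bar>v 0 t\<bar> \<le> \<bar>u c 0 + m * (0 - c)\<bar>" if "t \<in> {0<..\<tau>}" for t
    using that \<tau> bc[of t] by (auto simp: v_def)
  have v0: "v y 0 = 0" if y: "y \<in> {0..L}" for y
  proof (cases "c \<le> y")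
    case True
    interpret memory_heat c L \<tau> K \<kappa> \<alpha> \<theta> v ut vx uxx using c by (intro heat) auto
    show ?thesis using initial_zero_if_left_cauchy_zero[OF zc vL(1)] True y by auto
  next
    case False
    interpret memory_heat 0 c \<tau> K \<kappa> \<alpha> \<theta> v ut vx uxx using c by (intro heat) auto
    show ?thesis using initial_zero_if_right_cauchy_zero[OF zc vL(2)] False y by auto
  qed
  have affine: "u y 0 = u c 0 + m * (y - c)" if "y \<in> {0..L}" for y
    using v0[OF that] by (simp add: v_def)
  have "u c 0 + m * (0 - c) = 0" "u c 0 + m * (L - c) = 0"
    using affine[of 0] affine[of L] bc[of 0] L T by auto
  then have "m * L = 0" "u c 0 = m * c" by (auto simp: algebra_simps)
  then show ?thesis using affine[OF x] L by simp
qed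

theorem theorem4p1:
  fixes L T K \<gamma> a b :: real
    and k u0 \<alpha> \<alpha>' :: "real \<Rightarrow> real"
    and u u' :: "real \<Rightarrow> real \<Rightarrow> real"
  assumes "L > 0" and "T > 0" and "K > 0" and "\<gamma> > 1/2"
    and "continuous_on {0..T} k" and "k 0 \<noteq> 0"
    and "u0 \<in> H_check K L (\<gamma> + 2)" and "\<exists>x\<in>{0..L}. u0 x \<noteq> 0"
    and "\<alpha> \<in> admissible T" and "\<alpha>' \<in> admissible T"
    and "is_solution L T K \<gamma> k \<alpha> u0 u"
    and "is_solution L T K \<gamma> k \<alpha>' u0 u'"
    and "a < b" and "{a<..<b} \<subseteq> {0..L}"
    and "\<forall>x\<in>{a<..<b}. \<forall>t\<in>{0..T}. u x t = u' x t"
  shows "\<forall>t\<in>{0..T}. \<alpha> t = \<alpha>' t"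
proof (rule ccontr)
  assume neq: "\<not> (\<forall>t\<in>{0..T}. \<alpha> t = \<alpha>' t)"
  note T = \<open>T > 0\<close>
  obtain \<beta>1 where \<beta>1: "\<beta>1 < 1" "\<And>t. t \<in> {0..T} \<Longrightarrow> 0 \<le> \<alpha> t \<and> \<alpha> t \<le> \<beta>1"
    and an1: "real_analytic_on \<alpha> {0..T}"
    using \<open>\<alpha> \<in> admissible T\<close> unfolding admissible_def by blast
  obtain \<beta>2 where \<beta>2: "\<beta>2 < 1" "\<And>t. t \<in> {0..T} \<Longrightarrow> 0 \<le> \<alpha>' t \<and> \<alpha>' t \<le> \<beta>2"
    and an2: "real_analytic_on \<alpha>' {0..T}"
    using \<open>\<alpha>' \<in> admissible T\<close> unfolding admissible_def by blast
  define \<beta> where "\<beta> = max \<beta>1 \<beta>2"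
  have \<beta>: "0 \<le> \<beta>" "\<beta> < 1" "\<And>t. t \<in> {0..T} \<Longrightarrow> 0 \<le> \<alpha> t \<and> \<alpha> t \<le> \<beta>"
    "\<And>t. t \<in> {0..T} \<Longrightarrow> 0 \<le> \<alpha>' t \<and> \<alpha>' t \<le> \<beta>"
    using \<beta>1 \<beta>2 \<beta>1(2)[of 0] T by (force simp: \<beta>_def)+
  obtain \<epsilon> where \<epsilon>: "\<epsilon> > 0" "\<epsilon> \<le> T" "\<And>t. 0 < t \<Longrightarrow> t < \<epsilon> \<Longrightarrow> \<alpha> t - \<alpha>' t \<noteq> 0"
    using real_analytic_on_zero_or_eventually_nonzero[OF real_analytic_on_diff[OF an1 an2] T] neq by auto
  have "\<exists>\<delta>>0. \<forall>t\<in>{0..T}. dist t 0 < \<delta> \<longrightarrow> dist (k t) (k 0) < \<bar>k 0\<bar>"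
    using \<open>continuous_on {0..T} k\<close>[unfolded continuous_on_iff, rule_format, of 0 "\<bar>k 0\<bar>"]
      \<open>k 0 \<noteq> 0\<close> T by simp
  then obtain \<delta> where \<delta>: "\<delta> > 0" "\<And>t. t \<in> {0..T} \<Longrightarrow> dist t 0 < \<delta> \<Longrightarrow> dist (k t) (k 0) < \<bar>k 0\<bar>"
    by blast
  \<comment> \<open>Up to \<tau> the orders differ (\<epsilon>), k is nonzero (\<delta>), and the
    kernels are strictly ordered (Digamma threshold). The halves make these strict conditions hold
    at \<tau> itself.\<close>
  define \<tau> where "\<tau> = min (\<epsilon> / 2) (min (\<delta> / 2) (exp (Digamma (1 - \<beta>)) / 2))"
  have \<tau>: "0 < \<tau>" "\<tau> \<le> T" "\<tau> < exp (Digamma (1 - \<beta>))" "\<tau> < \<epsilon>" "\<tau> < \<delta>"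
    using \<epsilon> \<delta> unfolding \<tau>_def by (auto simp: min_def)
  have k_ne: "k t \<noteq> 0" if "t \<in> {0<..\<tau>}" for t
    using \<delta>(2)[of t] that \<tau> by (auto simp: dist_real_def)
  obtain ut ux uxx where u: "C1_sobolev T L \<gamma> (\<lambda>t x. u x t)"
    "\<And>t. t \<in> {0..T} \<Longrightarrow> continuous_on {0..L} (\<lambda>x. u x t)"
    "\<And>x. x \<in> {0..L} \<Longrightarrow> continuous_on {0..T} (ut x)"
    "\<And>x t. x \<in> {0..L} \<Longrightarrow> t \<in> {0..T} \<Longrightarrow> (u x has_real_derivative ut x t) (at t within {0..T})"
    "\<And>x t. x \<in> {0..L} \<Longrightarrow> t \<in> {0<..T} \<Longrightarrow> ((\<lambda>y. u y t) has_real_derivative ux x t) (at x within {0..L})"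
    "\<And>x t. x \<in> {0..L} \<Longrightarrow> t \<in> {0<..T} \<Longrightarrow> ((\<lambda>y. ux y t) has_real_derivative uxx x t) (at x within {0..L})"
    "\<And>x t. x \<in> {0..L} \<Longrightarrow> t \<in> {0<..T} \<Longrightarrow> ut x t + k t * caputo \<alpha> (u x) t - K * uxx x t = 0"
    "\<And>x. x \<in> {0..L} \<Longrightarrow> u x 0 = u0 x"
    "\<And>t. t \<in> {0..T} \<Longrightarrow> u 0 t = 0 \<and> u L t = 0"
    using \<open>is_solution L T K \<gamma> k \<alpha> u0 u\<close> unfolding is_solution_def by blast
  obtain ut' ux' uxx' where u':
    "\<And>x t. x \<in> {0..L} \<Longrightarrow> t \<in> {0..T} \<Longrightarrow> (u' x has_real_derivative ut' x t) (at t within {0..T})"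
    "\<And>x t. x \<in> {0..L} \<Longrightarrow> t \<in> {0<..T} \<Longrightarrow> ((\<lambda>y. u' y t) has_real_derivative ux' x t) (at x within {0..L})"
    "\<And>x t. x \<in> {0..L} \<Longrightarrow> t \<in> {0<..T} \<Longrightarrow> ((\<lambda>y. ux' y t) has_real_derivative uxx' x t) (at x within {0..L})"
    "\<And>x t. x \<in> {0..L} \<Longrightarrow> t \<in> {0<..T} \<Longrightarrow> ut' x t + k t * caputo \<alpha>' (u' x) t - K * uxx' x t = 0"
    using \<open>is_solution L T K \<gamma> k \<alpha>' u0 u'\<close> unfolding is_solution_def by blast
  have sub: "x \<in> {0..L}" "x \<in> interior {0..L}" "0 < x" "x < L" if "x \<in> {a<..<b}" for x
  proof -
    show "x \<in> interior {0..L}"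
      using interior_maximal[OF \<open>{a<..<b} \<subseteq> {0..L}\<close>] that by auto
    then show "x \<in> {0..L}" "0 < x" "x < L" by auto
  qed
  have at_eq: "at x within {0..L} = at x" if "x \<in> {a<..<b}" for x
    using sub(2)[OF that] by (rule at_within_interior)
  have uu': "u x t = u' x t" if "x \<in> {a<..<b}" "t \<in> {0..T}" for x t
    using assms(15) that by blast
  have ux_eq: "ux x t = ux' x t" if x: "x \<in> {a<..<b}" and t: "t \<in> {0<..T}" for x t
  proof -
    have "((\<lambda>y. u y t) has_real_derivative ux' x t) (at x)"
      by (rule has_field_derivative_transform_within_open[OF _ open_greaterThanLessThan x])
        (use u'(2)[OF sub(1)[OF x] t] uu' t in \<open>auto simp: at_eq[OF x]\<close>)
    then show ?thesis using u(5)[OF sub(1)[OF x] t] DERIV_unique by (auto simp: at_eq[OF x])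
  qed
  have uxx_eq: "uxx x t = uxx' x t" if x: "x \<in> {a<..<b}" and t: "t \<in> {0<..T}" for x t
  proof -
    have "((\<lambda>y. ux y t) has_real_derivative uxx' x t) (at x)"
      by (rule has_field_derivative_transform_within_open[OF _ open_greaterThanLessThan x])
        (use u'(3)[OF sub(1)[OF x] t] ux_eq t in \<open>auto simp: at_eq[OF x]\<close>)
    then show ?thesis using u(6)[OF sub(1)[OF x] t] DERIV_unique by (auto simp: at_eq[OF x])
  qed
  have interior_t: "at t within {0..T} = at t" if "t \<in> {0<..<T}" for t
    using that by (simp add: at_within_Icc_at)
  have caputo_eq: "caputo \<alpha> (u x) t = caputo \<alpha>' (u x) t" if x: "x \<in> {a<..<b}" and t: "t \<in> {0<..\<tau>}" for x t
  proof -
    have t': "t \<in> {0<..T}" "t \<in> {0<..<T}" "t \<in> {0..T}" using t \<tau> \<epsilon> by auto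
    have "(u x has_real_derivative ut' x t) (at t)"
      by (rule has_field_derivative_transform_within_open[OF _ open_greaterThanLessThan t'(2)])
        (use u'(1)[OF sub(1)[OF x] t'(3)] uu' x in \<open>auto simp: interior_t[OF t'(2)]\<close>)
    then have ut_eq: "ut x t = ut' x t"
      using u(4)[OF sub(1)[OF x] t'(3)] DERIV_unique by (auto simp: interior_t[OF t'(2)])
    have cap: "caputo \<alpha>' (u' x) t = caputo \<alpha>' (u x) t"
    proof -
      have "deriv (u' x) s = deriv (u x) s" if s: "s \<in> {0<..<t}" for s
      proof -
        have "\<forall>\<^sub>F r in nhds s. r \<in> {0<..<T}"
          using s t' by (intro eventually_nhds_in_open) auto
        then have "\<forall>\<^sub>F r in nhds s. u' x r = u x r"
          by eventually_elim (use uu'[OF x] in auto)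
        then show ?thesis by (rule deriv_cong_ev) simp
      qed
      then show ?thesis
        unfolding caputo_def by (auto intro!: arg_cong[where f = "(*) _"] set_lebesgue_integral_cong simp: divide_inverse)
    qed
    \<comment> \<open>On (a,b) the two solutions share the t-derivative and the second x-derivative,
      so subtracting the equations leaves only the Caputo terms; k t can then be cancelled.\<close>
    have "k t * caputo \<alpha> (u x) t = k t * caputo \<alpha>' (u x) t"
      using u(7)[OF sub(1)[OF x] t'(1)] u'(4)[OF sub(1)[OF x] t'(1)]
      unfolding ut_eq uxx_eq[OF x t'(1)] cap by linarith
    then show ?thesis using k_ne[OF t] by simp
  qed
  have stationary: "u x t = u x 0" if x: "x \<in> {a<..<b}" and t: "t \<in> {0..\<tau>}" for x t
  proof (rule equal_caputo_imp_constant[OF \<tau>(1-3) \<beta>(2) _ _ _ _ _ _ _ _ t])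
    show "(u x has_real_derivative ut x s) (at s within {0..T})" if "s \<in> {0..T}" for s
      by (rule u(4)[OF sub(1)[OF x] that])
    show "continuous_on {0..T} (ut x)" by (rule u(3)[OF sub(1)[OF x]])
    fix s assume s: "s \<in> {0<..\<tau>}"
    then have s': "s \<in> {0..T}" using \<tau> by auto
    show "0 \<le> \<alpha> s" "\<alpha> s \<le> \<beta>" "0 \<le> \<alpha>' s" "\<alpha>' s \<le> \<beta>" using \<beta>(3,4)[OF s'] by auto
    show "\<alpha> s \<noteq> \<alpha>' s" using \<epsilon>(3)[of s] s \<tau> by auto
    show "caputo \<alpha> (u x) s = caputo \<alpha>' (u x) s" by (rule caputo_eq[OF x s])
  qed
  define c where "c = (a + b) / 2"
  have c: "c \<in> {a<..<b}" using \<open>a < b\<close> by (auto simp: c_def)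
  \<comment> \<open>By stationarity u(.,t) and u(.,\<tau>) are the same function on (a,b), hence
    have the same slope at c. The reference time is \<tau> because x-derivatives are given only for
    positive times.\<close>
  have ux_c: "ux c t = ux c \<tau>" if t: "t \<in> {0<..\<tau>}" for t
  proof -
    have t': "t \<in> {0<..T}" "\<tau> \<in> {0<..T}" using t \<tau> by auto
    have "((\<lambda>y. u y \<tau>) has_real_derivative ux c t) (at c)"
    proof (rule has_field_derivative_transform_within_open[OF _ open_greaterThanLessThan c])
      show "((\<lambda>y. u y t) has_real_derivative ux c t) (at c)"
        using u(5)[OF sub(1)[OF c] t'(1)] by (simp add: at_eq[OF c])
      show "u y t = u y \<tau>" if "y \<in> {a<..<b}" for y
        using stationary[OF that, of t] stationary[OF that, of \<tau>] t \<tau>(1) by simp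
    qed
    then show ?thesis using u(5)[OF sub(1)[OF c] t'(2)] DERIV_unique by (auto simp: at_eq[OF c])
  qed
  have "u x 0 = 0" if "x \<in> {0..L}" for x
  proof (rule stationary_cauchy_data_imp_zero[OF \<open>L > 0\<close> T \<open>K > 0\<close> \<open>continuous_on {0..T} k\<close> \<beta>(1,2,3)
        u(1-7,9) sub(3,4)[OF c] \<tau>(1,2) _ ux_c that])
    show "u c t = u c 0" if "t \<in> {0<..\<tau>}" for t using stationary[OF c, of t] that by auto
  qed
  then show False using u(8) \<open>\<exists>x\<in>{0..L}. u0 x \<noteq> 0\<close> by auto
qed

end
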